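(* Let $X$ be a one-dimensional two-sided 1-step mixing shift of finite type over a finite alphabet $\mathcal{A}$, let $Y$ be a sofic shift over $\mathcal{A}$, and let $\pi:X\to Y$ be a 1-block factor map onto $Y$. If there is a periodic point $y\in Y$ which admits a right transition between distinct right classes (i.e. there are right classes $C\neq C'$ over $y$ with $C\to^r C'$), then there is a fully supported Markov measure $\mu$ on $X$ such that the image measure $\pi\mu$ is not a Gibbs measure on $Y$ (for any continuous potential).
   Context: Notation: $\mathcal{B}(X)$ is the set of words occurring in points of $X$; $X$ is 1-step if $uv,vw\in\mathcal{B}(X)$ with $|v|=1$ implies $uvw\in\mathcal{B}(X)$. $\sigma$ is the shift. For a point $x$ and an interval $I\subset\mathbb{Z}$, $x|_I$ is the restriction of $x$ to $I$. $[w]_i$ denotes the cylinder set of points $x$ with $x|_{[i,i+|w|-1]}=w$. A 1-block map $\pi$ is induced by a map on symbols, also denoted $\pi$. Right classes: Let $y\in Y$ and $x,x'\in\pi^{-1}(y)$. For $m\in\mathbb{Z}$ a right $m$-bridge from $x$ to $x'$ is a point $\vec x\in\pi^{-1}(y)$ such that for some $n>m$, $\vec x|_{(-\infty,m]}=x|_{(-\infty,m]}$ and $\vec x|_{[n,\infty)}=x'|_{[n,\infty)}$. Write $x\to^r x'$ (a right transition) if for every $m\in\mathbb{Z}$ there is a right $m$-bridge from $x$ to $x'$. Write $x\sim^r x'$ if $x\to^r x'$ and $x'\to^r x$; this is an equivalence relation on $\pi^{-1}(y)$ and its classes $[x]^r$ are the right (transition) classes over $y$. For right classes $C,C'$ over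 $y$, $C\to^r C'$ means $x\to^r x'$ for $x\in C,x'\in C'$ (independent of the choice of representatives). Measures: All measures are Borel probability measures. A $\sigma$-invariant measure $\mu$ on a shift of finite type over alphabet $\mathcal{A}$ is a 1-step Markov measure if there are a probability vector $p$ on $\mathcal{A}$ and an $\mathcal{A}\times\mathcal{A}$ stochastic matrix $P$ with $\mu[a_1\cdots a_n]_0=p_{a_1}P_{a_1,a_2}\cdots P_{a_{n-1},a_n}$ for all words $a_1\cdots a_n$ of the shift. A Markov measure on $X$ is a measure conjugate (via a topological conjugacy) to a 1-step Markov measure on a shift of finite type. Fully supported means positive on every nonempty cylinder of $X$. A $\sigma$-invariant measure $\nu$ on a shift space $Z$ is a Gibbs measure for a continuous $f:Z\to\mathbb{R}$ if there are $K_1,K_2>0$ and $P\in\mathbb{R}$ with $K_1<\nu[z|_{[0,n-1]}]_0/\exp(-nP+\sum_{j=0}^{n-1}f(\sigma^j z))<K_2$ for all $z\in Z$, $n\in\mathbb{N}$; it is a Gibbs measure if it is so for some continuous $f$. $\pi\mu$ denotes the push-forward $\mu\circ\pi^{-1}$. *)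

theory Defs
  imports "HOL-Probability.Probability"
begin

text \<open>
  Points over an alphabet \<open>A\<close> are functions \<open>int \<Rightarrow> 'a\<close> with values in \<open>A\<close>;
  the alphabet is an explicit set so that it can be quantified over.  Words are lists.
\<close>

section \<open>Shift spaces\<close>

definition full_shift_topology :: "'a set \<Rightarrow> (int \<Rightarrow> 'a) topology" where
  "full_shift_topology A = product_topology (\<lambda>_. discrete_topology A) UNIV"

definition shift_topology :: "'a set \<Rightarrow> (int \<Rightarrow> 'a) set \<Rightarrow> (int \<Rightarrow> 'a) topology" where
  "shift_topology A X = subtopology (full_shift_topology A) X"

definition shift_map :: "(int \<Rightarrow> 'a) \<Rightarrow> int \<Rightarrow> 'a" where
  "shift_map x = (\<lambda>i. x (i + 1))"

definition shift_space :: "'a set \<Rightarrow> (int \<Rightarrow> 'a) set \<Rightarrow> bool" where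
  "shift_space A X \<longleftrightarrow> closedin (full_shift_topology A) X \<and> shift_map ` X = X"

text \<open>\<open>block x i n\<close> is the restriction of \<open>x\<close> to the interval \<open>[i, i + n - 1]\<close>, read as a word.\<close>

definition block :: "(int \<Rightarrow> 'a) \<Rightarrow> int \<Rightarrow> nat \<Rightarrow> 'a list" where
  "block x i n = map (\<lambda>k. x (i + int k)) [0..<n]"

definition language :: "(int \<Rightarrow> 'a) set \<Rightarrow> 'a list set" where
  "language X = {block x i n | x i n. x \<in> X}"

definition cylinder :: "(int \<Rightarrow> 'a) set \<Rightarrow> 'a list \<Rightarrow> int \<Rightarrow> (int \<Rightarrow> 'a) set" where
  "cylinder X w i = {x \<in> X. block x i (length w) = w}"

definition sft :: "'a set \<Rightarrow> (int \<Rightarrow> 'a) set \<Rightarrow> bool" where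
  "sft A X \<longleftrightarrow> (\<exists>F. finite F \<and> F \<subseteq> lists A \<and>
     X = {x. range x \<subseteq> A \<and> (\<forall>w\<in>F. \<forall>i. block x i (length w) \<noteq> w)})"

definition one_step :: "(int \<Rightarrow> 'a) set \<Rightarrow> bool" where
  "one_step X \<longleftrightarrow> (\<forall>u v w. length v = 1 \<longrightarrow> u @ v \<in> language X \<longrightarrow> v @ w \<in> language X
     \<longrightarrow> u @ v @ w \<in> language X)"

definition mixing :: "(int \<Rightarrow> 'a) set \<Rightarrow> bool" where
  "mixing X \<longleftrightarrow> (\<forall>u\<in>language X. \<forall>v\<in>language X. \<exists>N. \<forall>n\<ge>N. \<exists>w.
     length w = n \<and> u @ w @ v \<in> language X)"

definition periodic_point :: "(int \<Rightarrow> 'a) \<Rightarrow> bool" where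
  "periodic_point x \<longleftrightarrow> (\<exists>p>0. (shift_map ^^ p) x = x)"

section \<open>Factor maps and conjugacies\<close>

definition factor_map ::
  "'a set \<Rightarrow> (int \<Rightarrow> 'a) set \<Rightarrow> 'b set \<Rightarrow> (int \<Rightarrow> 'b) set \<Rightarrow> ((int \<Rightarrow> 'a) \<Rightarrow> int \<Rightarrow> 'b) \<Rightarrow> bool" where
  "factor_map A X B Y \<phi> \<longleftrightarrow>
     continuous_map (shift_topology A X) (shift_topology B Y) \<phi> \<and>
     (\<forall>x\<in>X. \<phi> (shift_map x) = shift_map (\<phi> x)) \<and> \<phi> ` X = Y"

definition conjugacy ::
  "'a set \<Rightarrow> (int \<Rightarrow> 'a) set \<Rightarrow> 'b set \<Rightarrow> (int \<Rightarrow> 'b) set \<Rightarrow> ((int \<Rightarrow> 'a) \<Rightarrow> int \<Rightarrow> 'b) \<Rightarrow> bool" where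
  "conjugacy A X B Y \<phi> \<longleftrightarrow>
     homeomorphic_map (shift_topology A X) (shift_topology B Y) \<phi> \<and>
     (\<forall>x\<in>X. \<phi> (shift_map x) = shift_map (\<phi> x))"

definition one_block :: "('a \<Rightarrow> 'b) \<Rightarrow> (int \<Rightarrow> 'a) \<Rightarrow> int \<Rightarrow> 'b" where
  "one_block \<pi> x = \<pi> \<circ> x"

text \<open>
  HOL cannot quantify over types inside a formula.  Whenever a definition asks for some shift
  space over some finite alphabet, that alphabet is a finite set of natural numbers, which is
  no restriction up to renaming of symbols.
\<close>

definition sofic :: "'a set \<Rightarrow> (int \<Rightarrow> 'a) set \<Rightarrow> bool" where
  "sofic A Y \<longleftrightarrow> shift_space A Y \<and>
     (\<exists>(B :: nat set) Z \<phi>. finite B \<and> sft B Z \<and> factor_map B Z A Y \<phi>)"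

section \<open>Right transitions and right classes\<close>

definition fiber :: "('a \<Rightarrow> 'b) \<Rightarrow> (int \<Rightarrow> 'a) set \<Rightarrow> (int \<Rightarrow> 'b) \<Rightarrow> (int \<Rightarrow> 'a) set" where
  "fiber \<pi> X y = {x \<in> X. one_block \<pi> x = y}"

definition right_bridge ::
  "('a \<Rightarrow> 'b) \<Rightarrow> (int \<Rightarrow> 'a) set \<Rightarrow> (int \<Rightarrow> 'b) \<Rightarrow> int \<Rightarrow>
     (int \<Rightarrow> 'a) \<Rightarrow> (int \<Rightarrow> 'a) \<Rightarrow> (int \<Rightarrow> 'a) \<Rightarrow> bool" where
  "right_bridge \<pi> X y m x x' z \<longleftrightarrow> z \<in> fiber \<pi> X y \<and>
     (\<exists>n>m. (\<forall>i\<le>m. z i = x i) \<and> (\<forall>i\<ge>n. z i = x' i))"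

definition right_trans ::
  "('a \<Rightarrow> 'b) \<Rightarrow> (int \<Rightarrow> 'a) set \<Rightarrow> (int \<Rightarrow> 'b) \<Rightarrow> (int \<Rightarrow> 'a) rel" where
  "right_trans \<pi> X y = {(x, x'). x \<in> fiber \<pi> X y \<and> x' \<in> fiber \<pi> X y \<and>
     (\<forall>m. \<exists>z. right_bridge \<pi> X y m x x' z)}"

definition right_equiv ::
  "('a \<Rightarrow> 'b) \<Rightarrow> (int \<Rightarrow> 'a) set \<Rightarrow> (int \<Rightarrow> 'b) \<Rightarrow> (int \<Rightarrow> 'a) rel" where
  "right_equiv \<pi> X y = right_trans \<pi> X y \<inter> (right_trans \<pi> X y)\<inverse>"

definition right_classes ::
  "('a \<Rightarrow> 'b) \<Rightarrow> (int \<Rightarrow> 'a) set \<Rightarrow> (int \<Rightarrow> 'b) \<Rightarrow> (int \<Rightarrow> 'a) set set" where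
  "right_classes \<pi> X y = fiber \<pi> X y // right_equiv \<pi> X y"

definition class_trans ::
  "('a \<Rightarrow> 'b) \<Rightarrow> (int \<Rightarrow> 'a) set \<Rightarrow> (int \<Rightarrow> 'b) \<Rightarrow> (int \<Rightarrow> 'a) set \<Rightarrow> (int \<Rightarrow> 'a) set \<Rightarrow> bool" where
  "class_trans \<pi> X y C C' \<longleftrightarrow> (\<forall>x\<in>C. \<forall>x'\<in>C'. (x, x') \<in> right_trans \<pi> X y)"

section \<open>Measures\<close>

definition shift_borel :: "'a set \<Rightarrow> (int \<Rightarrow> 'a) set \<Rightarrow> (int \<Rightarrow> 'a) measure" where
  "shift_borel A X = sigma (topspace (shift_topology A X)) {U. openin (shift_topology A X) U}"

definition invariant_measure :: "'a set \<Rightarrow> (int \<Rightarrow> 'a) set \<Rightarrow> (int \<Rightarrow> 'a) measure \<Rightarrow> bool" where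
  "invariant_measure A X \<mu> \<longleftrightarrow> prob_space \<mu> \<and> sets \<mu> = sets (shift_borel A X) \<and>
     distr \<mu> (shift_borel A X) shift_map = \<mu>"

definition probability_vector :: "'a set \<Rightarrow> ('a \<Rightarrow> real) \<Rightarrow> bool" where
  "probability_vector A p \<longleftrightarrow> (\<forall>a\<in>A. 0 \<le> p a) \<and> (\<Sum>a\<in>A. p a) = 1"

definition stochastic_matrix :: "'a set \<Rightarrow> ('a \<Rightarrow> 'a \<Rightarrow> real) \<Rightarrow> bool" where
  "stochastic_matrix A P \<longleftrightarrow> (\<forall>a\<in>A. probability_vector A (P a))"

definition one_step_markov :: "'a set \<Rightarrow> (int \<Rightarrow> 'a) set \<Rightarrow> (int \<Rightarrow> 'a) measure \<Rightarrow> bool" where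
  "one_step_markov A X \<mu> \<longleftrightarrow> invariant_measure A X \<mu> \<and>
     (\<exists>p P. probability_vector A p \<and> stochastic_matrix A P \<and>
       (\<forall>w\<in>language X. w \<noteq> [] \<longrightarrow>
          measure \<mu> (cylinder X w 0) = p (w ! 0) * (\<Prod>i<length w - 1. P (w ! i) (w ! Suc i))))"

definition markov_measure :: "'a set \<Rightarrow> (int \<Rightarrow> 'a) set \<Rightarrow> (int \<Rightarrow> 'a) measure \<Rightarrow> bool" where
  "markov_measure A X \<mu> \<longleftrightarrow> invariant_measure A X \<mu> \<and>
     (\<exists>(B :: nat set) Z \<nu> \<phi>. finite B \<and> sft B Z \<and> one_step_markov B Z \<nu> \<and>
        conjugacy A X B Z \<phi> \<and> distr \<mu> (shift_borel B Z) \<phi> = \<nu>)"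

definition fully_supported :: "(int \<Rightarrow> 'a) set \<Rightarrow> (int \<Rightarrow> 'a) measure \<Rightarrow> bool" where
  "fully_supported X \<mu> \<longleftrightarrow> (\<forall>w i. cylinder X w i \<noteq> {} \<longrightarrow> measure \<mu> (cylinder X w i) > 0)"

definition gibbs_measure_for ::
  "'a set \<Rightarrow> (int \<Rightarrow> 'a) set \<Rightarrow> ((int \<Rightarrow> 'a) \<Rightarrow> real) \<Rightarrow> (int \<Rightarrow> 'a) measure \<Rightarrow> bool" where
  "gibbs_measure_for A Z f \<nu> \<longleftrightarrow> invariant_measure A Z \<nu> \<and>
     (\<exists>K\<^sub>1>0. \<exists>K\<^sub>2>0. \<exists>P::real. \<forall>z\<in>Z. \<forall>n\<ge>1.
        (let r = measure \<nu> (cylinder Z (block z 0 n) 0)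
                 / exp (- real n * P + (\<Sum>j<n. f ((shift_map ^^ j) z)))
         in K\<^sub>1 < r \<and> r < K\<^sub>2))"

definition gibbs_measure :: "'a set \<Rightarrow> (int \<Rightarrow> 'a) set \<Rightarrow> (int \<Rightarrow> 'a) measure \<Rightarrow> bool" where
  "gibbs_measure A Z \<nu> \<longleftrightarrow>
     (\<exists>f. continuous_map (shift_topology A Z) euclideanreal f \<and> gibbs_measure_for A Z f \<nu>)"

end

theory Submission
  imports Defs
begin

text \<open>
  Let \<open>N\<close> be a period of \<open>y\<close> and pass to the graph of \<open>N\<close>-blocks of \<open>X\<close>; there the phase of a block
  over \<open>y\<close> is visible.  A transition between distinct right classes yields two different strong
  components of the subgraph lying over \<open>y\<close>, each containing a cycle, the second reachable from
  the first.  Choose a stochastic matrix that is, up to a diagonal conjugation, \<open>1/4\<close> times a matrix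
  which is stochastic on each of these two components and has row sums at most 1 off them.  The two
  components then have the same growth rate, maximal among all components over \<open>y\<close>, so the
  probability of seeing a word \<open>y\<^sub>i \<dots> y\<^sub>i\<^sub>+\<^sub>m\<close> is at least of order \<open>m 4\<^sup>-\<^sup>m\<close> and at most of order
  \<open>m\<^sup>2 4\<^sup>-\<^sup>m\<close>.  For a Gibbs measure this probability is purely exponential along the periodic
  orbit, which is impossible.
\<close>

section \<open>Finite Markov chains and path weights\<close>

text \<open>The obstacle is that the chain has to be stochastic and positive on every block edge,
  for full support, while its part over \<open>y\<close> must have two components of exactly equal
  growth rate. With unequal rates the larger one would dominate. With equal rates a path may switch
  from the first component to the second at any of about m times, and these contributions of the
  same size produce the factor m. Diagonal conjugation keeps growth rates, and this freedom is
  needed: a state all of whose edges lie over \<open>y\<close> must have row sum 1 on them. The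
  constant 1/4 buys slack. The weights inside a chosen component sum to 1 in each row and those on
  the edges leaving it to at most 1, so rows sum to at most 2; any factor below 1/2 makes them
  strictly less than 1. The exponent in the upper bound is immaterial: linear growth excludes a
  Gibbs rate at most that of the chain, and any polynomial bound excludes a larger one.\<close>

text \<open>States are eliminated one at a time: the chain is watched only while it is in
  \<open>S\<close>, which is again a stochastic chain, and its stationary vector is extended to
  \<open>s\<close> by the balance equation there.\<close>

lemma stationary_exists:
  assumes "finite S" "S \<noteq> {}" "stochastic_matrix S P"
  shows "\<exists>p. probability_vector S p \<and> (\<forall>b\<in>S. (\<Sum>a\<in>S. p a * P a b) = p b)"
  using assms
proof (induction S arbitrary: P rule: finite_ne_induct)
  case (singleton s)
  then show ?case
    by (intro exI[of _ "\<lambda>_. 1"]) (auto simp: stochastic_matrix_def probability_vector_def)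
next
  case (insert s S)
  have nn: "0 \<le> P a b" if "a \<in> insert s S" "b \<in> insert s S" for a b
    using insert.prems that by (auto simp: stochastic_matrix_def probability_vector_def)
  have row: "P a s + (\<Sum>b\<in>S. P a b) = 1" if "a \<in> insert s S" for a
    using insert.prems insert.hyps that by (auto simp: stochastic_matrix_def probability_vector_def)
  have Pss: "P s s \<le> 1"
    using row[of s] sum_nonneg[of S "P s"] nn by force
  show ?case
  proof (cases "P s s = 1")
    case True
    have z: "P s b = 0" if "b \<in> S" for b
      using row[of s] True nn insert.hyps that by (simp add: sum_nonneg_eq_0_iff)
    have "(\<Sum>a\<in>insert s S. (if a = s then 1 else 0) * P a b) = (if b = s then 1 else 0)"
      if "b \<in> insert s S" for b
    proof -
      have "(\<Sum>a\<in>insert s S. (if a = s then 1 else 0) * P a b) = (\<Sum>a\<in>insert s S. if a = s then P a b else 0)"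
        by (intro sum.cong) auto
      also have "\<dots> = P s b" using insert.hyps by simp
      finally show ?thesis using True z that by auto
    qed
    then show ?thesis using insert.hyps
      by (intro exI[of _ "\<lambda>a. if a = s then 1 else 0"]) (auto simp: probability_vector_def)
  next
    case False
    define d where "d = 1 - P s s"
    have d: "d > 0" using False Pss by (auto simp: d_def)
    \<comment> \<open>The chain with excursions to \<open>s\<close> cut out: the factor
      \<open>1 / d\<close> is the geometric series over the time spent at \<open>s\<close>. If
      \<open>P s s = 1\<close> this diverges, but then the point mass at \<open>s\<close> is
      stationary.\<close>
    define Q where "Q a b = P a b + P a s * P s b / d" for a b
    have rs: "(\<Sum>b\<in>S. P s b) = d" using row[of s] by (simp add: d_def)
    have "stochastic_matrix S Q"
      unfolding stochastic_matrix_def probability_vector_def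
    proof (intro ballI conjI)
      fix a b assume "a \<in> S" "b \<in> S" then show "0 \<le> Q a b"
        using nn d by (auto simp: Q_def)
    next
      fix a assume a: "a \<in> S"
      have "(\<Sum>b\<in>S. Q a b) = (\<Sum>b\<in>S. P a b) + P a s * (\<Sum>b\<in>S. P s b) / d"
        by (simp add: Q_def sum.distrib sum_distrib_left sum_divide_distrib)
      then show "(\<Sum>b\<in>S. Q a b) = 1" using rs d row[of a] a by simp
    qed
    then obtain p where p: "probability_vector S p" "\<And>b. b \<in> S \<Longrightarrow> (\<Sum>a\<in>S. p a * Q a b) = p b"
      using insert.IH by blast
    \<comment> \<open>The mass at \<open>s\<close> before normalisation, solved from
      \<open>t = t * P s s + (\<Sum>a\<in>S. p a * P a s)\<close>.\<close>
    define t where "t = (\<Sum>a\<in>S. p a * P a s) / d"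
    have t: "t \<ge> 0" using d p(1) nn unfolding t_def probability_vector_def
      by (auto intro!: divide_nonneg_nonneg sum_nonneg)
    define q where "q a = (if a = s then t else p a) / (1 + t)" for a
    have q0: "(\<Sum>a\<in>S. h (if a = s then t else p a) a) = (\<Sum>a\<in>S. h (p a) a)" for h :: "real \<Rightarrow> 'a \<Rightarrow> real"
      using insert.hyps by (intro sum.cong) auto
    have "(\<Sum>a\<in>insert s S. q a) = 1"
      using insert.hyps p(1) t q0[of "\<lambda>x _. x"]
      by (simp add: q_def probability_vector_def flip: sum_divide_distrib)
    moreover have "0 \<le> q a" if "a \<in> insert s S" for a
      using that p(1) t by (auto simp: q_def probability_vector_def)
    moreover have "(\<Sum>a\<in>insert s S. q a * P a b) = q b" if b: "b \<in> insert s S" for b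
    proof -
      have "(\<Sum>a\<in>insert s S. q a * P a b) = (t * P s b + (\<Sum>a\<in>S. p a * P a b)) / (1 + t)"
        using insert.hyps q0[of "\<lambda>x a. x * P a b / (1 + t)"]
        by (simp add: q_def add_divide_distrib sum_divide_distrib)
      also have "t * P s b + (\<Sum>a\<in>S. p a * P a b) = (if b = s then t else p b)"
      proof (cases "b = s")
        case True
        have "(\<Sum>a\<in>S. p a * P a s) = t * d" using d by (simp add: t_def)
        then show ?thesis using True by (simp add: d_def algebra_simps)
      next
        case False
        then have "b \<in> S" using b by auto
        have "p b = (\<Sum>a\<in>S. p a * P a b + p a * P a s * (P s b / d))"
          using p(2)[OF \<open>b \<in> S\<close>] by (simp add: Q_def algebra_simps)
        also have "\<dots> = (\<Sum>a\<in>S. p a * P a b) + t * P s b"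
          by (simp add: sum.distrib t_def sum_distrib_right sum_divide_distrib)
        finally show ?thesis using False by simp
      qed
      finally show ?thesis by (simp add: q_def)
    qed
    ultimately show ?thesis unfolding probability_vector_def by blast
  qed
qed

lemma stationary_pos:
  assumes fin: "finite S" and P: "stochastic_matrix S P" and p: "probability_vector S p"
    and st: "\<And>b. b \<in> S \<Longrightarrow> (\<Sum>a\<in>S. p a * P a b) = p b"
    and E: "E \<subseteq> S \<times> S" "\<And>a b. (a, b) \<in> E \<Longrightarrow> 0 < P a b"
    and irr: "\<And>a b. a \<in> S \<Longrightarrow> b \<in> S \<Longrightarrow> (a, b) \<in> E\<^sup>*" and b: "b \<in> S"
  shows "0 < p b"
proof -
  have "\<exists>a\<in>S. 0 < p a"
  proof (rule ccontr)
    assume "\<not> ?thesis"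
    then have "(\<Sum>a\<in>S. p a) \<le> 0" by (intro sum_nonpos) force
    then show False using p by (simp add: probability_vector_def)
  qed
  then obtain a where a: "a \<in> S" "0 < p a" by blast
  have "(a, b) \<in> E\<^sup>*" using irr a b by blast
  then show ?thesis
  proof (induction rule: rtrancl_induct)
    case base show ?case by (rule a)
  next
    case (step c d)
    have cd: "c \<in> S" "d \<in> S" using E step by auto
    have "0 < p c * P c d" using step E by simp
    also have "\<dots> \<le> (\<Sum>a\<in>S. p a * P a d)"
      using fin cd P p by (intro member_le_sum) (auto simp: stochastic_matrix_def probability_vector_def)
    finally show ?case using st cd by simp
  qed
qed

section \<open>Growth of path weights through strong components\<close>

text \<open>The m-th power of the matrix \<open>W\<close> restricted to \<open>F\<close>, applied to
  the vector \<open>r\<close>. A general terminal vector is carried along because diagonal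
  conjugation turns the constant 1 into \<open>r\<close>.\<close>

primrec path_weight :: "('s \<times> 's) set \<Rightarrow> ('s \<Rightarrow> 's \<Rightarrow> real) \<Rightarrow> ('s \<Rightarrow> real) \<Rightarrow> nat \<Rightarrow> 's \<Rightarrow> real" where
  "path_weight F W r 0 v = r v"
| "path_weight F W r (Suc m) v = (\<Sum>w\<in>F `` {v}. W v w * path_weight F W r m w)"

definition scc :: "('s \<times> 's) set \<Rightarrow> 's \<Rightarrow> 's set" where
  "scc F a = {v. (a, v) \<in> F\<^sup>* \<and> (v, a) \<in> F\<^sup>*}"

lemma path_weight_nonneg:
  assumes "\<And>v w. (v, w) \<in> F \<Longrightarrow> 0 \<le> W v w" "\<And>v. 0 \<le> r v"
  shows "0 \<le> path_weight F W r m v"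
  using assms by (induction m arbitrary: v) (auto intro!: sum_nonneg mult_nonneg_nonneg)

lemma path_weight_term_nonneg:
  assumes "\<And>v w. (v, w) \<in> F \<Longrightarrow> 0 < W v w" "\<And>v. 0 < r v" "(v, w) \<in> F"
  shows "0 \<le> W v w * path_weight F W r m w"
  using assms by (intro mult_nonneg_nonneg path_weight_nonneg) (auto intro: less_imp_le)

lemma path_weight_scale:
  "path_weight F (\<lambda>v w. e * W v w) r m v = e ^ m * path_weight F W r m v"
  by (induction m arbitrary: v) (auto simp: sum_distrib_left intro!: sum.cong)

text \<open>Along a path the factors \<open>r w / r v\<close> telescope, leaving \<open>r\<close> at
  the end over \<open>r\<close> at the start.\<close>

lemma path_weight_conj:
  assumes "finite S" "F \<subseteq> S \<times> S" "\<And>v. v \<in> S \<Longrightarrow> r v > 0" "v \<in> S"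
    and P: "\<And>v w. (v, w) \<in> F \<Longrightarrow> P v w = W v w * r w / r v"
  shows "path_weight F P (\<lambda>_. 1) m v = path_weight F W r m v / r v"
  using assms(4)
proof (induction m arbitrary: v)
  case 0
  then show ?case using assms(3)[of v] by auto
next
  case (Suc m)
  have "P v w * path_weight F P (\<lambda>_. 1) m w = W v w * path_weight F W r m w / r v" if "(v,w) \<in> F" for w
  proof -
    have "w \<in> S" using that assms by auto
    then show ?thesis using Suc.IH[of w] P[OF that] assms(3)[of w] by simp
  qed
  then show ?case by (simp add: sum_divide_distrib)
qed

lemma scc_irreducible:
  assumes "u \<in> scc F a" "v \<in> scc F a"
  shows "(u, v) \<in> (F \<inter> scc F a \<times> scc F a)\<^sup>*"
proof -
  have "(u, v) \<in> F\<^sup>*" "(v, a) \<in> F\<^sup>*" "(a, u) \<in> F\<^sup>*"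
    using assms by (auto simp: scc_def)
  from this(1,2) show ?thesis
  proof (induction rule: rtrancl_induct)
    case base show ?case by simp
  next
    case (step b c)
    have 1: "(b, a) \<in> F\<^sup>*" using step by (meson converse_rtrancl_into_rtrancl)
    have 2: "(a, b) \<in> F\<^sup>*" using step(1) \<open>(a, u) \<in> F\<^sup>*\<close> by simp
    have "(b, c) \<in> F \<inter> scc F a \<times> scc F a"
      using 1 2 step by (auto simp: scc_def)
    then show ?case using step.IH[OF 1] by (meson rtrancl.rtrancl_into_rtrancl)
  qed
qed

text \<open>The cycle through \<open>a\<close> excludes a trivial one-point component; without an
  inner edge no row could be normalised inside the component.\<close>

lemma scc_out:
  assumes "(a, a) \<in> F\<^sup>+" "v \<in> scc F a"
  shows "\<exists>w\<in>scc F a. (v, w) \<in> F"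
proof -
  have "(v, a) \<in> F\<^sup>+" using assms by (auto simp: scc_def intro: rtrancl_trancl_trancl)
  then obtain w where "(v, w) \<in> F" "(w, a) \<in> F\<^sup>*" by (meson tranclD)
  moreover have "(a, w) \<in> F\<^sup>*" using assms \<open>(v,w) \<in> F\<close> by (auto simp: scc_def)
  ultimately show ?thesis by (auto simp: scc_def)
qed

text \<open>Supplies the edge through which weight leaks out of the first component towards the
  second.\<close>

lemma rtrancl_exits:
  assumes "(a, b) \<in> F\<^sup>*" "a \<in> C" "b \<notin> C"
  shows "\<exists>v\<in>C. \<exists>w. w \<notin> C \<and> (v, w) \<in> F \<and> (w, b) \<in> F\<^sup>*"
  using assms by (induction rule: converse_rtrancl_induct) auto

text \<open>A bound uniform in the length of the path survives the prepending of one edge, hence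
  travels backwards from \<open>b\<close>.\<close>

lemma path_weight_lower_bound:
  assumes "(v, b) \<in> F\<^sup>*" and fin: "\<And>v. finite (F `` {v})"
    and W: "\<And>v w. (v, w) \<in> F \<Longrightarrow> 0 < W v w" and r: "\<And>v. 0 < r v"
    and b: "\<exists>c>0. \<forall>m. c \<le> path_weight F W r m b"
  shows "\<exists>c>0. \<forall>m. c \<le> path_weight F W r m v"
  using assms(1)
proof (induction rule: converse_rtrancl_induct)
  case base show ?case by (rule b)
next
  case (step v w)
  then obtain c where c: "c > 0" "\<And>m. c \<le> path_weight F W r m w" by blast
  \<comment> \<open>The entry \<open>r v\<close> covers length 0, where the edge to \<open>w\<close>
    is not yet taken.\<close>
  have "min (r v) (W v w * c) \<le> path_weight F W r m v" for m
  proof (cases m)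
    case (Suc k)
    have "W v w * c \<le> W v w * path_weight F W r k w"
      using c W[of v w] step by (intro mult_left_mono) auto
    also have "\<dots> \<le> path_weight F W r (Suc k) v"
      unfolding path_weight.simps
      by (rule member_le_sum[of w "F `` {v}" "\<lambda>w. W v w * path_weight F W r k w"])
         (use fin step path_weight_term_nonneg[OF W r] in auto)
    finally show ?thesis using Suc by simp
  qed simp
  moreover have "min (r v) (W v w * c) > 0" using c W r step by auto
  ultimately show ?case by blast
qed

text \<open>The weights inside \<open>D\<close> form a stochastic matrix, which preserves the
  constant lower bound \<open>Min (range r)\<close>; paths leaving \<open>D\<close> only
  add.\<close>

lemma path_weight_scc_lower:
  assumes fin: "\<And>v. finite (F `` {v})" "finite (range r)"
    and W: "\<And>v w. (v, w) \<in> F \<Longrightarrow> 0 < W v w" and r: "\<And>v. 0 < r v"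
    and D: "\<And>v. v \<in> D \<Longrightarrow> (\<Sum>w\<in>F `` {v} \<inter> D. W v w) = 1"
    and b: "b \<in> D"
  shows "\<exists>c>0. \<forall>m. c \<le> path_weight F W r m b"
proof -
  define c where "c = Min (range r)"
  have c: "c > 0" "\<And>v. c \<le> r v" using fin r by (auto simp: c_def)
  have "c \<le> path_weight F W r m v" if "v \<in> D" for m v
    using that
  proof (induction m arbitrary: v)
    case 0
    then show ?case using c by simp
  next
    case (Suc m)
    have "c = (\<Sum>w\<in>F `` {v} \<inter> D. W v w * c)"
      using D[OF Suc.prems] by (simp flip: sum_distrib_right)
    also have "\<dots> \<le> (\<Sum>w\<in>F `` {v} \<inter> D. W v w * path_weight F W r m w)"
      using Suc.IH W by (intro sum_mono mult_left_mono) (auto intro: less_imp_le)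
    also have "\<dots> \<le> path_weight F W r (Suc m) v"
      unfolding path_weight.simps
      by (rule sum_mono2) (use fin path_weight_term_nonneg[OF W r] in auto)
    finally show ?case .
  qed
  then show ?thesis using c b by blast
qed

text \<open>Integrating the path weights against the stationary vector of the first component turns
  the recursion into an additive one: each step keeps the mass in the component and adds a
  constant that has leaked towards the second component.\<close>

lemma path_weight_linear_growth:
  assumes fin: "finite S" "F \<subseteq> S \<times> S" "finite (range r)"
    and W: "\<And>v w. (v, w) \<in> F \<Longrightarrow> 0 < W v w" and r: "\<And>v. 0 < r v"
    and C: "\<And>v. v \<in> scc F a \<Longrightarrow> (\<Sum>w\<in>F `` {v} \<inter> scc F a. W v w) = 1"
    and D: "\<And>v. v \<in> scc F b \<Longrightarrow> (\<Sum>w\<in>F `` {v} \<inter> scc F b. W v w) = 1"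
    and a: "a \<in> S" and ab: "(a, b) \<in> F\<^sup>*" and ba: "(b, a) \<notin> F\<^sup>*"
  shows "\<exists>c>0. \<forall>m. c * real m \<le> (\<Sum>v\<in>scc F a. path_weight F W r m v)"
proof -
  define C where "C = scc F a"
  have fin': "finite (F `` {v})" for v
    using fin by (meson finite_Image finite_SigmaI finite_subset finite.emptyI finite.insertI)
  have "C \<subseteq> S" 
  proof
    fix v assume "v \<in> C"
    then have "(a, v) \<in> F\<^sup>*" by (simp add: C_def scc_def)
    then show "v \<in> S" by (cases rule: rtranclE) (use fin a in auto)
  qed
  then have finC: "finite C" using fin finite_subset by blast
  have aC: "a \<in> C" by (simp add: C_def scc_def)
  have FC: "{w \<in> C. (v, w) \<in> F} = F `` {v} \<inter> C" for v by auto
  \<comment> \<open>\<open>W\<close> is arbitrary off \<open>F\<close>, so it is cut to 0 there; on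
    \<open>C\<close> the result is a stochastic matrix with a stationary vector.\<close>
  define Q where "Q v w = (if (v, w) \<in> F then W v w else 0)" for v w
  have Qsum: "(\<Sum>w\<in>C. Q v w * h w) = (\<Sum>w\<in>F `` {v} \<inter> C. W v w * h w)" for v h
  proof -
    have "(\<Sum>w\<in>C. Q v w * h w) = (\<Sum>w\<in>C. if (v, w) \<in> F then W v w * h w else 0)"
      by (intro sum.cong) (auto simp: Q_def)
    also have "\<dots> = (\<Sum>w\<in>F `` {v} \<inter> C. W v w * h w)"
      by (subst sum.inter_filter[symmetric]) (auto simp: finC FC)
    finally show ?thesis .
  qed
  have Q: "stochastic_matrix C Q"
    unfolding stochastic_matrix_def probability_vector_def
    using Qsum[of _ "\<lambda>_. 1"] C W by (auto simp: Q_def C_def intro: less_imp_le)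
  obtain u where u: "probability_vector C u" "\<And>w. w \<in> C \<Longrightarrow> (\<Sum>v\<in>C. u v * Q v w) = u w"
    using stationary_exists[OF finC _ Q] aC by blast
  have u1: "u v \<le> 1" "0 \<le> u v" if "v \<in> C" for v
    using u(1) member_le_sum[of v C u] finC that by (auto simp: probability_vector_def)
  have upos: "0 < u v" if "v \<in> C" for v
    by (rule stationary_pos[of C Q u "F \<inter> C \<times> C"])
       (use finC Q u that W scc_irreducible[of _ F a] in \<open>auto simp: C_def Q_def\<close>)
  have bC: "b \<notin> C" using ba by (auto simp: C_def scc_def)
  obtain v0 w0 where vw: "v0 \<in> C" "w0 \<notin> C" "(v0, w0) \<in> F" "(w0, b) \<in> F\<^sup>*"
    using rtrancl_exits[OF ab aC bC] by blast
  obtain c where c: "c > 0" "\<And>m. c \<le> path_weight F W r m w0"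
    using path_weight_lower_bound[OF vw(4) fin' W r path_weight_scc_lower[OF fin' fin(3) W r D, of b]]
    by (auto simp: scc_def)
  define g where "g = path_weight F W r"
  have g0: "0 \<le> g m v" for m v
    unfolding g_def by (intro path_weight_nonneg less_imp_le W r)
  \<comment> \<open>Gain per step: stationary mass at the exit \<open>v0\<close>, times the weight
    of the exit edge, times the lower bound for continuing from \<open>w0\<close>.\<close>
  define d where "d = u v0 * W v0 w0 * c"
  have d: "d > 0" using upos vw W c by (simp add: d_def)
  have main: "d * real m \<le> (\<Sum>v\<in>C. u v * g m v)" for m
  proof (induction m)
    case 0
    then show ?case using u1 g0 by (auto intro!: sum_nonneg)
  next
    case (Suc m)
    have step: "(\<Sum>w\<in>C. Q v w * g m w) + (if v = v0 then W v0 w0 * c else 0) \<le> g (Suc m) v" for v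
    proof -
      have "(\<Sum>w\<in>F `` {v} - C. W v w * g m w) \<ge> (if v = v0 then W v0 w0 * c else 0)"
      proof (cases "v = v0")
        case True
        have "W v0 w0 * c \<le> W v0 w0 * g m w0"
          using c W[of v0 w0] vw by (auto simp: g_def intro!: mult_left_mono less_imp_le)
        also have "\<dots> \<le> (\<Sum>w\<in>F `` {v0} - C. W v0 w * g m w)"
          by (rule member_le_sum[of w0 _ "\<lambda>w. W v0 w * g m w"])
             (use fin' vw path_weight_term_nonneg[OF W r] in \<open>auto simp: g_def\<close>)
        finally show ?thesis using True by simp
      next
        case False
        have "0 \<le> W v w * g m w" if "(v, w) \<in> F" for w
          unfolding g_def by (rule path_weight_term_nonneg[OF W r that])
        then show ?thesis using False by (auto intro!: sum_nonneg)
      qed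
      moreover have "g (Suc m) v = (\<Sum>w\<in>F `` {v} \<inter> C. W v w * g m w) + (\<Sum>w\<in>F `` {v} - C. W v w * g m w)"
        unfolding g_def path_weight.simps using sum.Int_Diff[OF fin'] by blast
      ultimately show ?thesis using Qsum[of v "g m"] by simp
    qed
    have "d * real (Suc m) \<le> (\<Sum>w\<in>C. u w * g m w) + d"
      using Suc by (simp add: algebra_simps)
    also have "(\<Sum>w\<in>C. u w * g m w) = (\<Sum>w\<in>C. (\<Sum>v\<in>C. u v * Q v w) * g m w)"
      using u(2) by simp
    also have "\<dots> = (\<Sum>v\<in>C. u v * (\<Sum>w\<in>C. Q v w * g m w))"
      unfolding sum_distrib_left sum_distrib_right by (subst sum.swap) (simp add: mult.assoc)
    also have "(\<Sum>v\<in>C. u v * (\<Sum>w\<in>C. Q v w * g m w)) + d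
        = (\<Sum>v\<in>C. u v * (\<Sum>w\<in>C. Q v w * g m w)) + (\<Sum>v\<in>C. if v = v0 then u v * (W v0 w0 * c) else 0)"
      using finC vw by (simp add: d_def)
    also have "\<dots> = (\<Sum>v\<in>C. u v * ((\<Sum>w\<in>C. Q v w * g m w) + (if v = v0 then W v0 w0 * c else 0)))"
      by (subst sum.distrib[symmetric], intro sum.cong) (auto simp: algebra_simps)
    also have "\<dots> \<le> (\<Sum>v\<in>C. u v * g (Suc m) v)"
      using step u1 by (intro sum_mono mult_left_mono) auto
    finally show ?case .
  qed
  have "d * real m \<le> (\<Sum>v\<in>C. g m v)" for m
  proof -
    have "(\<Sum>v\<in>C. u v * g m v) \<le> (\<Sum>v\<in>C. g m v)"
      using u1 g0 by (intro sum_mono) (auto intro!: mult_left_le_one_le)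
    then show ?thesis using main[of m] by linarith
  qed
  then show ?thesis using d unfolding C_def g_def by blast
qed

text \<open>Each critical component that can still be met costs one power of \<open>1 + m\<close>,
  the number of possible times of leaving it, and there are two of them.\<close>

lemma path_weight_quadratic_bound:
  assumes fin: "\<And>v. finite (F `` {v})"
    and W: "\<And>v w. (v, w) \<in> F \<Longrightarrow> 0 < W v w" and r: "\<And>v. 0 < r v" "\<And>v. r v \<le> 1"
    and row: "\<And>v. v \<notin> scc F a \<Longrightarrow> v \<notin> scc F b \<Longrightarrow> (\<Sum>w\<in>F `` {v}. W v w) \<le> 1"
    and C: "\<And>v. v \<in> scc F a \<Longrightarrow> (\<Sum>w\<in>F `` {v} \<inter> scc F a. W v w) = 1"
      "\<And>v. v \<in> scc F a \<Longrightarrow> (\<Sum>w\<in>F `` {v} - scc F a. W v w) \<le> 1"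
    and D: "\<And>v. v \<in> scc F b \<Longrightarrow> (\<Sum>w\<in>F `` {v} \<inter> scc F b. W v w) = 1"
      "\<And>v. v \<in> scc F b \<Longrightarrow> (\<Sum>w\<in>F `` {v} - scc F b. W v w) \<le> 1"
  shows "path_weight F W r m v \<le> (1 + real m)^2"
proof -
  \<comment> \<open>The exponent at \<open>v\<close>: it never increases along an edge and drops
    strictly on leaving a critical component, from which there is no way back.\<close>
  define l where "l v = (if (v, a) \<in> F\<^sup>* then 1 else 0) + (if (v, b) \<in> F\<^sup>* then 1 else 0 :: nat)" for v
  have mono: "l w \<le> l v" if "(v, w) \<in> F" for v w
    using that by (auto simp: l_def intro: converse_rtrancl_into_rtrancl)
  have strict: "l w < l v" if "(v, w) \<in> F" "v \<in> scc F c" "w \<notin> scc F c" "c = a \<or> c = b" for v w c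
  proof -
    have "(c, v) \<in> F\<^sup>*" "(v, c) \<in> F\<^sup>*" using that by (auto simp: scc_def)
    then have "(c, w) \<in> F\<^sup>*" using that(1) by (meson rtrancl.rtrancl_into_rtrancl)
    then have "(w, c) \<notin> F\<^sup>*" using that by (auto simp: scc_def)
    then show ?thesis using that \<open>(v, c) \<in> F\<^sup>*\<close>
      by (auto simp: l_def intro: converse_rtrancl_into_rtrancl)
  qed
  have main: "path_weight F W r m v \<le> (1 + real m) ^ l v"
  proof (induction m arbitrary: v)
    case 0
    then show ?case using r by simp
  next
    case (Suc m)
    \<comment> \<open>Inside the component the exponent stays, outside it is lower by one, and
      \<open>(1 + m)^l + (1 + m)^(l - 1) = (1 + m)^(l - 1) * (2 + m)\<close>.\<close>
    have leak: "path_weight F W r (Suc m) v \<le> (1 + real (Suc m)) ^ l v"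
      if c: "v \<in> scc F c" "c = a \<or> c = b" and 1: "(\<Sum>w\<in>F `` {v} \<inter> scc F c. W v w) = 1"
        and 2: "(\<Sum>w\<in>F `` {v} - scc F c. W v w) \<le> 1" for c
    proof -
      have lv: "l v \<ge> 1" using c by (auto simp: scc_def l_def)
      have "path_weight F W r (Suc m) v = (\<Sum>w\<in>F `` {v} \<inter> scc F c. W v w * path_weight F W r m w)
         + (\<Sum>w\<in>F `` {v} - scc F c. W v w * path_weight F W r m w)"
        unfolding path_weight.simps using sum.Int_Diff[OF fin] by blast
      also have "\<dots> \<le> (\<Sum>w\<in>F `` {v} \<inter> scc F c. W v w * (1 + real m) ^ l v)
         + (\<Sum>w\<in>F `` {v} - scc F c. W v w * (1 + real m) ^ (l v - 1))"
      proof (intro add_mono sum_mono mult_left_mono)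
        fix w assume "w \<in> F `` {v} \<inter> scc F c"
        then have "l w \<le> l v" using mono by auto
        then show "path_weight F W r m w \<le> (1 + real m) ^ l v"
          using Suc[of w] power_increasing[of "l w" "l v" "1 + real m"] by simp
      next
        fix w assume "w \<in> F `` {v} - scc F c"
        then have "l w \<le> l v - 1" using strict[of v w c] c by force
        then show "path_weight F W r m w \<le> (1 + real m) ^ (l v - 1)"
          using Suc[of w] power_increasing[of "l w" "l v - 1" "1 + real m"] by simp
      qed (auto intro: less_imp_le W)
      also have "\<dots> \<le> (1 + real m) ^ l v + 1 * (1 + real m) ^ (l v - 1)"
        unfolding sum_distrib_right[symmetric] 1
        by (intro add_mono mult_right_mono 2) auto
      also have "\<dots> = (1 + real m) ^ (l v - 1) * (1 + real (Suc m))"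
        using lv by (cases "l v") (auto simp: algebra_simps)
      also have "\<dots> \<le> (1 + real (Suc m)) ^ (l v - 1) * (1 + real (Suc m))"
        by (intro mult_right_mono power_mono) auto
      also have "\<dots> = (1 + real (Suc m)) ^ l v" using lv by (cases "l v") auto
      finally show ?thesis .
    qed
    consider "v \<in> scc F a" | "v \<in> scc F b" | "v \<notin> scc F a" "v \<notin> scc F b" by blast
    then show ?case
    proof cases
      case 1 then show ?thesis by (intro leak[of a] C) auto
    next
      case 2 then show ?thesis by (intro leak[of b] D) auto
    next
      case 3
      have "path_weight F W r (Suc m) v \<le> (\<Sum>w\<in>F `` {v}. W v w * (1 + real m) ^ l v)"
        unfolding path_weight.simps
      proof (intro sum_mono mult_left_mono)
        fix w assume "w \<in> F `` {v}"
        then have "l w \<le> l v" using mono by auto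
        then show "path_weight F W r m w \<le> (1 + real m) ^ l v"
          using Suc[of w] power_increasing[of "l w" "l v" "1 + real m"] by simp
      qed (auto intro: less_imp_le W)
      also have "\<dots> \<le> 1 * (1 + real m) ^ l v"
        unfolding sum_distrib_right[symmetric] using row 3 by (intro mult_right_mono) auto
      also have "\<dots> \<le> (1 + real (Suc m)) ^ l v" by (simp add: power_mono)
      finally show ?thesis .
    qed
  qed
  have "(1 + real m) ^ l v \<le> (1 + real m) ^ 2"
    by (intro power_increasing) (auto simp: l_def)
  then show ?thesis using main by linarith
qed

section \<open>Prescribed weights realised by an irreducible chain\<close>

text \<open>\<open>r v\<close> is the probability that the walk with substochastic weights
  \<open>W\<close>, killed with the missing mass, ever hits \<open>X\<close> from \<open>v\<close>.
  First-step analysis gives harmonicity off \<open>X\<close>, and reachability of \<open>X\<close>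
  gives positivity.\<close>

lemma positive_harmonic_exists:
  fixes W :: "'s \<Rightarrow> 's \<Rightarrow> real"
  assumes fin: "\<And>v. finite (F `` {v})" and W: "\<And>v w. (v, w) \<in> F \<Longrightarrow> 0 < W v w"
    and row: "\<And>v. (\<Sum>w\<in>F `` {v}. W v w) \<le> 1"
  shows "\<exists>r. (\<forall>v. 0 \<le> r v \<and> r v \<le> 1) \<and> (\<forall>v\<in>X. r v = 1) \<and>
    (\<forall>v. v \<notin> X \<longrightarrow> r v = (\<Sum>w\<in>F `` {v}. W v w * r w)) \<and>
    (\<forall>v x. (v, x) \<in> F\<^sup>* \<longrightarrow> x \<in> X \<longrightarrow> 0 < r v)"
proof -
  \<comment> \<open>\<open>h n v\<close> is the probability of hitting \<open>X\<close> within
    \<open>n\<close> steps; it is increasing in \<open>n\<close> and bounded by 1, so its limit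
    exists.\<close>
  define h :: "nat \<Rightarrow> 's \<Rightarrow> real" where
    "h = rec_nat (\<lambda>v. if v \<in> X then 1 else 0)
           (\<lambda>_ g v. if v \<in> X then 1 else (\<Sum>w\<in>F `` {v}. W v w * g w))"
  have h0: "h 0 v = (if v \<in> X then 1 else 0)" for v by (simp add: h_def)
  have hS: "h (Suc n) v = (if v \<in> X then 1 else (\<Sum>w\<in>F `` {v}. W v w * h n w))" for n v
    by (simp add: h_def)
  have nn: "0 \<le> h n v" for n v
  proof (induction n arbitrary: v)
    case (Suc n)
    have "0 \<le> W v w * h n w" if "(v, w) \<in> F" for w
      using W[OF that] Suc[of w] by simp
    then show ?case by (auto simp: hS intro!: sum_nonneg)
  qed (simp add: h0)
  have le1: "h n v \<le> 1" for n v
  proof (induction n arbitrary: v)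
    case (Suc n)
    have "(\<Sum>w\<in>F `` {v}. W v w * h n w) \<le> (\<Sum>w\<in>F `` {v}. W v w * 1)"
      using Suc W by (intro sum_mono mult_left_mono) (auto intro: less_imp_le)
    then show ?case using row[of v] by (auto simp: hS)
  qed (simp add: h0)
  have mono: "h n v \<le> h (Suc n) v" for n v
  proof (induction n arbitrary: v)
    case 0
    show ?case
    proof (cases "v \<in> X")
      case True
      then show ?thesis by (simp add: h0 hS)
    next
      case False
      then have "h 0 v = 0" by (simp add: h0)
      then show ?thesis using nn[of "Suc 0" v] by linarith
    qed
  next
    case (Suc n)
    have "(\<Sum>w\<in>F `` {v}. W v w * h n w) \<le> (\<Sum>w\<in>F `` {v}. W v w * h (Suc n) w)"
      by (intro sum_mono mult_left_mono Suc less_imp_le[OF W]) auto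
    then show ?case unfolding hS[of "Suc n"] hS[of n] by simp
  qed
  have inc: "incseq (\<lambda>n. h n v)" for v using mono by (intro incseq_SucI)
  define r where "r v = lim (\<lambda>n. h n v)" for v
  have lim: "(\<lambda>n. h n v) \<longlonglongrightarrow> r v" for v
    unfolding r_def convergent_LIMSEQ_iff[symmetric]
    using inc[of v] le1 nn by (intro Bseq_mono_convergent BseqI'[of _ 1]) (auto simp: incseq_def)
  have ge: "h n v \<le> r v" for n v by (rule incseq_le[OF inc lim])
  have eq: "r v = (if v \<in> X then 1 else (\<Sum>w\<in>F `` {v}. W v w * r w))" for v
  proof (rule LIMSEQ_unique)
    show "(\<lambda>n. h (Suc n) v) \<longlonglongrightarrow> r v" by (rule LIMSEQ_Suc[OF lim])
    show "(\<lambda>n. h (Suc n) v) \<longlonglongrightarrow> (if v \<in> X then 1 else (\<Sum>w\<in>F `` {v}. W v w * r w))"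
      unfolding hS by (auto intro!: tendsto_sum tendsto_mult lim)
  qed
  have r01: "0 \<le> r v" "r v \<le> 1" for v
    using nn[of 0 v] ge[of 0 v] LIMSEQ_le_const2[OF lim] le1 by (auto intro: order_trans)
  have pos: "0 < r v" if "(v, x) \<in> F\<^sup>*" "x \<in> X" for v x
    using that(1)
  proof (induction rule: converse_rtrancl_induct)
    case base then show ?case using eq[of x] that(2) by simp
  next
    case (step v w)
    have "0 < W v w * r w" using step W by simp
    also have "\<dots> \<le> (\<Sum>w\<in>F `` {v}. W v w * r w)"
      by (rule member_le_sum[of w _ "\<lambda>w. W v w * r w"])
         (use step fin mult_nonneg_nonneg[OF less_imp_le[OF W] r01(1)] in auto)
    finally show ?case using eq[of v] by (auto split: if_splits)
  qed
  show ?thesis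
    using r01 eq pos by (intro exI[of _ r] conjI allI ballI impI) (auto split: if_splits)
qed

text \<open>A stochastic matrix realising prescribed weights on \<open>F\<close> up to a change of coordinates by
  a positive function \<open>r\<close>; states without an edge outside \<open>F\<close> leave no room for slack, so that \<open>r\<close>
  has to be harmonic there.\<close>

lemma stochastic_completion:
  fixes W :: "'s \<Rightarrow> 's \<Rightarrow> real"
  assumes S: "finite S" "E \<subseteq> S \<times> S" "F \<subseteq> E" "F \<noteq> E"
    and irr: "\<And>u v. u \<in> S \<Longrightarrow> v \<in> S \<Longrightarrow> (u, v) \<in> E\<^sup>*"
    and W: "\<And>v w. (v, w) \<in> F \<Longrightarrow> 0 < W v w"
    and row: "\<And>v. (\<Sum>w\<in>F `` {v}. W v w) < 1"
  shows "\<exists>P r. stochastic_matrix S P \<and> (\<forall>u v. (u, v) \<in> E \<longrightarrow> 0 < P u v) \<and>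
    (\<forall>u v. (u, v) \<notin> E \<longrightarrow> P u v = 0) \<and> (\<forall>v. 0 < r v \<and> r v \<le> 1) \<and> finite (range r) \<and>
    (\<forall>v w. (v, w) \<in> F \<longrightarrow> P v w = W v w * r w / r v)"
proof -
  have finE: "finite (E `` {v})" for v
    using S by (meson finite_Image finite_SigmaI finite_subset finite.emptyI finite.insertI)
  then have finF: "finite (F `` {v})" for v
    using S by (meson Image_mono finite_subset order_refl)
  \<comment> \<open>The states with room for slack: mass missing on \<open>F\<close> can be put on
    their remaining edges.\<close>
  define X where "X = {v\<in>S. (E - F) `` {v} \<noteq> {}}"
  obtain r0 where r0: "\<And>v. 0 \<le> r0 v" "\<And>v. r0 v \<le> 1" "\<And>v. v \<in> X \<Longrightarrow> r0 v = 1"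
    "\<And>v. v \<notin> X \<Longrightarrow> r0 v = (\<Sum>w\<in>F `` {v}. W v w * r0 w)"
    "\<And>v x. (v, x) \<in> F\<^sup>* \<Longrightarrow> x \<in> X \<Longrightarrow> 0 < r0 v"
    using positive_harmonic_exists[OF finF W less_imp_le[OF row], of X] by blast
  obtain e f where ef: "(e, f) \<in> E - F" using S by auto
  then have eX: "e \<in> X" using S by (auto simp: X_def)
  \<comment> \<open>Follow an \<open>E\<close>-path towards \<open>e \<in> X\<close>. The first edge
    outside \<open>F\<close>, if there is one, starts in \<open>X\<close>, so an initial piece of
    the path stays in \<open>F\<close> and ends in \<open>X\<close>.\<close>
  have reach: "\<exists>x\<in>X. (v, x) \<in> F\<^sup>*" if "v \<in> S" for v
  proof -
    have "e \<in> S" using eX by (simp add: X_def)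
    then have "(v, e) \<in> E\<^sup>*" using irr that by blast
    then show ?thesis
    proof (induction rule: converse_rtrancl_induct)
      case base then show ?case using eX by blast
    next
      case (step v w)
      show ?case
      proof (cases "(v, w) \<in> F")
        case True
        then show ?thesis using step.IH by (meson converse_rtrancl_into_rtrancl)
      next
        case False
        then have "v \<in> X" using step S by (auto simp: X_def)
        then show ?thesis by blast
      qed
    qed
  qed
  have rpos: "0 < r0 v" if "v \<in> S" for v using reach[OF that] r0(5) by blast
  define r where "r v = (if v \<in> S then r0 v else 1)" for v
  have r: "0 < r v" "r v \<le> 1" for v using rpos r0 by (auto simp: r_def)
  have "finite (range r)"
  proof (rule finite_subset)
    show "range r \<subseteq> insert 1 (r0 ` S)" by (auto simp: r_def)
  qed (use S in auto)
  define s where "s v = (\<Sum>w\<in>F `` {v}. W v w * r w / r v)" for v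
  have s0: "s v * r v = (\<Sum>w\<in>F `` {v}. W v w * r0 w)" if "v \<in> S" for v
    unfolding s_def sum_distrib_right using S r[of v] that
    by (intro sum.cong) (auto simp: r_def)
  have s1: "s v = 1" if "v \<in> S" "v \<notin> X" for v
    using s0[OF that(1)] r0(4)[OF that(2)] that rpos[OF that(1)] by (simp add: r_def)
  \<comment> \<open>On \<open>X\<close> the function \<open>r\<close> attains its maximum 1, so
    conjugation does not increase the row sum, which was strictly below 1.\<close>
  have s2: "s v < 1" if "v \<in> X" for v
  proof -
    have "v \<in> S" using that by (simp add: X_def)
    have "s v = (\<Sum>w\<in>F `` {v}. W v w * r0 w)" using s0[OF \<open>v \<in> S\<close>] r0(3)[OF that] \<open>v \<in> S\<close> by (simp add: r_def)
    also have "\<dots> \<le> (\<Sum>w\<in>F `` {v}. W v w * 1)"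
      using r0 W by (intro sum_mono mult_left_mono) (auto intro: less_imp_le)
    finally show ?thesis using row[of v] by simp
  qed
  define P where "P v w = (if (v, w) \<in> F then W v w * r w / r v
     else if (v, w) \<in> E then (1 - s v) / card ((E - F) `` {v}) else 0)" for v w
  have finEF: "finite ((E - F) `` {v})" for v
    using finE[of v] by (auto intro: finite_subset)
  have pos: "0 < P v w" if "(v, w) \<in> E" for v w
  proof (cases "(v, w) \<in> F")
    case True then show ?thesis using r W by (simp add: P_def)
  next
    case False
    then have "v \<in> X" "w \<in> (E - F) `` {v}" using that S by (auto simp: X_def)
    then have "0 < card ((E - F) `` {v})" using finEF[of v] by (auto simp: card_gt_0_iff)
    then show ?thesis using s2[of v] \<open>v \<in> X\<close> that False by (simp add: P_def)
  qed
  have sum1: "(\<Sum>w\<in>S. P v w) = 1" if v: "v \<in> S" for v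
  proof -
    have "(\<Sum>w\<in>S. P v w) = (\<Sum>w\<in>E `` {v}. P v w)"
      using S by (intro sum.mono_neutral_right) (auto simp: P_def)
    also have "E `` {v} = F `` {v} \<union> (E - F) `` {v}" using S by auto
    also have "(\<Sum>w\<in>\<dots>. P v w) = (\<Sum>w\<in>F `` {v}. P v w) + (\<Sum>w\<in>(E - F) `` {v}. P v w)"
      using finF finEF by (intro sum.union_disjoint) auto
    also have "(\<Sum>w\<in>F `` {v}. P v w) = s v" by (simp add: P_def s_def)
    also have "(\<Sum>w\<in>(E - F) `` {v}. P v w) = (\<Sum>w\<in>(E - F) `` {v}. (1 - s v) / card ((E - F) `` {v}))"
      by (intro sum.cong) (auto simp: P_def)
    also have "\<dots> = 1 - s v"
    proof (cases "v \<in> X")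
      case True
      then have "card ((E - F) `` {v}) > 0" using finEF by (auto simp: X_def card_gt_0_iff)
      then show ?thesis by simp
    next
      case False
      then show ?thesis using s1 v by simp
    qed
    finally show ?thesis by simp
  qed
  have "stochastic_matrix S P"
    unfolding stochastic_matrix_def probability_vector_def
  proof (intro ballI conjI sum1)
    fix a b show "0 \<le> P a b"
      using pos[of a b] S by (cases "(a, b) \<in> E") (auto simp: P_def)
  qed
  moreover have "P v w = W v w * r w / r v" if "(v, w) \<in> F" for v w
    using that by (simp add: P_def)
  moreover have "P v w = 0" if "(v, w) \<notin> E" for v w
    using that S by (auto simp: P_def)
  ultimately show ?thesis using pos r \<open>finite (range r)\<close> by blast
qed

text \<open>The bounds with \<open>e = 1/4\<close> say that the chain stays on \<open>F\<close> for
  m steps with probability exponential up to a factor between m and its square. Row sums of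
  \<open>W\<close> are kept below 1 only to allow the completion; the growth is computed for
  \<open>q\<close>, and the powers of 1/4 are restored at the end.\<close>

lemma chain_with_polynomial_correction:
  fixes E F :: "('s \<times> 's) set"
  assumes S: "finite S" "E \<subseteq> S \<times> S" "F \<subseteq> E"
    and irr: "\<And>u v. u \<in> S \<Longrightarrow> v \<in> S \<Longrightarrow> (u, v) \<in> E\<^sup>*"
    and ab: "a \<in> S" "b \<in> S" "(a, a) \<in> F\<^sup>+" "(b, b) \<in> F\<^sup>+" "(a, b) \<in> F\<^sup>*" "(b, a) \<notin> F\<^sup>*"
  shows "\<exists>P p e c K. stochastic_matrix S P \<and> (\<forall>u v. (u, v) \<in> E \<longrightarrow> 0 < P u v) \<and>
    (\<forall>u v. (u, v) \<notin> E \<longrightarrow> P u v = 0) \<and> probability_vector S p \<and> (\<forall>v\<in>S. 0 < p v) \<and>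
    (\<forall>w\<in>S. (\<Sum>v\<in>S. p v * P v w) = p w) \<and> 0 < e \<and> 0 < c \<and>
    (\<forall>m. c * real m * e ^ m \<le> (\<Sum>v\<in>S. p v * path_weight F P (\<lambda>_. 1) m v) \<and>
         (\<Sum>v\<in>S. p v * path_weight F P (\<lambda>_. 1) m v) \<le> K * (1 + real m)\<^sup>2 * e ^ m)"
proof -
  have FS: "F \<subseteq> S \<times> S" using S by blast
  have finF: "finite (F `` {v})" for v
    using S(1) FS by (meson finite_Image finite_SigmaI finite_subset finite.emptyI finite.insertI)
  \<comment> \<open>Otherwise irreducibility would lead from \<open>b\<close> back to
    \<open>a\<close>.\<close>
  have FE: "F \<noteq> E" using irr ab by metis
  define C where "C = scc F a"
  define D where "D = scc F b"
  have disj: "v \<notin> D" if "v \<in> C" for v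
    using that ab(6) by (auto simp: C_def D_def scc_def dest: rtrancl_trans)
  define T where "T v = (if v \<in> C then C else if v \<in> D then D else {})" for v
  define n where "n v = card (F `` {v} \<inter> T v)" for v
  \<comment> \<open>Uniform on the edges staying in the critical component of \<open>v\<close>, so
    that these sum to 1. All other edges get \<open>1 / card S\<close>, so that at most
    \<open>card S\<close> of them sum to at most 1.\<close>
  define q where "q v w = (if w \<in> T v then 1 / n v else 1 / card S)" for v w
  have cS: "card S > 0" using S ab by (auto simp: card_gt_0_iff)
  have nC: "n v > 0" if "v \<in> C \<union> D" for v
    using scc_out[OF ab(3), of v] scc_out[OF ab(4), of v] that finF disj
    by (auto simp: n_def card_gt_0_iff T_def C_def D_def)
  have n0: "n v > 0" if "(v, w) \<in> F" "w \<in> T v" for v w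
    using that finF by (auto simp: n_def card_gt_0_iff)
  have q: "0 < q v w" if "(v, w) \<in> F" for v w
    using n0[OF that] cS by (auto simp: q_def)
  have q1: "(\<Sum>w\<in>F `` {v} \<inter> T v. q v w) = 1" if "v \<in> C \<union> D" for v
  proof -
    have "(\<Sum>w\<in>F `` {v} \<inter> T v. q v w) = (\<Sum>w\<in>F `` {v} \<inter> T v. 1 / n v)"
      by (intro sum.cong) (auto simp: q_def)
    also have "\<dots> = n v * (1 / n v)" by (simp add: n_def)
    finally show ?thesis using nC[OF that] by simp
  qed
  have q2: "(\<Sum>w\<in>F `` {v} - T v. q v w) \<le> 1" for v
  proof -
    have "(\<Sum>w\<in>F `` {v} - T v. q v w) = (\<Sum>w\<in>F `` {v} - T v. 1 / card S)"
      by (intro sum.cong) (auto simp: q_def)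
    also have "\<dots> = card (F `` {v} - T v) / card S" by simp
    also have "\<dots> \<le> 1"
      using FS S cS by (simp add: divide_le_eq) (intro card_mono, auto)
    finally show ?thesis .
  qed
  have q3: "(\<Sum>w\<in>F `` {v}. q v w) \<le> 2" for v
  proof -
    have "(\<Sum>w\<in>F `` {v}. q v w) = (\<Sum>w\<in>F `` {v} \<inter> T v. q v w) + (\<Sum>w\<in>F `` {v} - T v. q v w)"
      by (rule sum.Int_Diff[OF finF])
    also have "(\<Sum>w\<in>F `` {v} \<inter> T v. q v w) \<le> 1"
      using q1[of v] by (cases "v \<in> C \<union> D") (auto simp: T_def)
    finally show ?thesis using q2[of v] by simp
  qed
  define W where "W v w = 1/4 * q v w" for v w
  have "(\<Sum>w\<in>F `` {v}. W v w) < 1" for v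
    using q3[of v] unfolding W_def sum_distrib_left[symmetric] by simp
  moreover have "0 < W v w" if "(v, w) \<in> F" for v w using q[OF that] by (simp add: W_def)
  ultimately obtain P r where P: "stochastic_matrix S P" "\<And>u v. (u, v) \<in> E \<Longrightarrow> 0 < P u v"
      "\<And>u v. (u, v) \<notin> E \<Longrightarrow> P u v = 0"
    and r: "\<And>v. 0 < r v" "\<And>v. r v \<le> 1" "finite (range r)"
    and PW: "\<And>v w. (v, w) \<in> F \<Longrightarrow> P v w = W v w * r w / r v"
    using stochastic_completion[OF S FE irr, of W] by metis
  obtain p where p: "probability_vector S p" "\<And>w. w \<in> S \<Longrightarrow> (\<Sum>v\<in>S. p v * P v w) = p w"
    using stationary_exists[OF S(1) _ P(1)] ab by blast
  have ppos: "0 < p v" if "v \<in> S" for v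
    by (rule stationary_pos[OF S(1) P(1) p S(2) P(2) irr that])
  define g where "g = path_weight F q r"
  have g0: "0 \<le> g m v" for m v
    unfolding g_def by (intro path_weight_nonneg less_imp_le q r)
  have pw: "path_weight F P (\<lambda>_. 1) m v = (1/4) ^ m * (g m v / r v)" if "v \<in> S" for m v
  proof -
    have "path_weight F W r m v = (1/4) ^ m * g m v"
      using path_weight_scale[of F "1/4" q r m v] by (simp add: W_def[abs_def] g_def)
    then show ?thesis using path_weight_conj[OF S(1) FS r(1) that PW] by simp
  qed
  define Z where "Z m = (\<Sum>v\<in>S. p v * path_weight F P (\<lambda>_. 1) m v)" for m
  have Z: "Z m = (1/4)^m * (\<Sum>v\<in>S. p v / r v * g m v)" for m
    unfolding Z_def sum_distrib_left by (intro sum.cong) (auto simp: pw)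
  have upper: "g m v \<le> (1 + real m)\<^sup>2" for m v
    unfolding g_def
  proof (rule path_weight_quadratic_bound[where a = a and b = b])
    fix v assume v: "v \<notin> scc F a" "v \<notin> scc F b"
    then have "T v = {}" by (simp add: T_def C_def D_def)
    then show "(\<Sum>w\<in>F `` {v}. q v w) \<le> 1" using q2[of v] by simp
  next
    fix v assume v: "v \<in> scc F a"
    then have "T v = scc F a" by (simp add: T_def C_def)
    then show "(\<Sum>w\<in>F `` {v} \<inter> scc F a. q v w) = 1" "(\<Sum>w\<in>F `` {v} - scc F a. q v w) \<le> 1"
      using q1[of v] q2[of v] v by (auto simp: C_def)
  next
    fix v assume v: "v \<in> scc F b"
    then have "T v = scc F b" using disj[of v] by (auto simp: T_def D_def)
    then show "(\<Sum>w\<in>F `` {v} \<inter> scc F b. q v w) = 1" "(\<Sum>w\<in>F `` {v} - scc F b. q v w) \<le> 1"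
      using q1[of v] q2[of v] v by (auto simp: D_def)
  qed (use finF q r in auto)
  have q1': "(\<Sum>w\<in>F `` {v} \<inter> scc F c. q v w) = 1" if "v \<in> scc F c" "c = a \<or> c = b" for v c
  proof -
    have "T v = scc F c" "v \<in> C \<union> D" using that disj[of v] by (auto simp: T_def C_def D_def)
    then show ?thesis using q1[of v] by simp
  qed
  obtain c0 where c0: "c0 > 0" "\<And>m. c0 * real m \<le> (\<Sum>v\<in>scc F a. g m v)"
    using path_weight_linear_growth[OF S(1) FS r(3) q r(1) q1' q1' ab(1,5,6)] unfolding g_def by auto
  have CS: "scc F a \<subseteq> S"
  proof
    fix v assume "v \<in> scc F a"
    then have "(a, v) \<in> F\<^sup>*" by (simp add: scc_def)
    then show "v \<in> S" by (cases rule: rtranclE) (use FS ab in auto)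
  qed
  define k where "k = Min (p ` S)"
  have k: "k > 0" "\<And>v. v \<in> S \<Longrightarrow> k \<le> p v" 
  proof -
    show "k > 0" unfolding k_def by (subst Min_gr_iff) (use S(1) ab(1) ppos in auto)
    show "k \<le> p v" if "v \<in> S" for v using S(1) that by (auto simp: k_def)
  qed
  define K where "K = (\<Sum>v\<in>S. p v / r v)"
  have "k * c0 * real m * (1/4)^m \<le> Z m" for m
  proof -
    have "k * (c0 * real m) \<le> k * (\<Sum>v\<in>scc F a. g m v)" using c0 k by (intro mult_left_mono) auto
    also have "\<dots> \<le> k * (\<Sum>v\<in>S. g m v)"
      using k S CS g0 by (intro mult_left_mono sum_mono2) auto
    also have "\<dots> \<le> (\<Sum>v\<in>S. p v / r v * g m v)"
      unfolding sum_distrib_left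
    proof (intro sum_mono mult_right_mono)
      fix v assume v: "v \<in> S"
      \<comment> \<open>The bound \<open>r \<le> 1\<close> makes the factor \<open>1 / r v\<close>
        left by the conjugation harmless in the lower bound.\<close>
      have "p v \<le> p v / r v" using ppos[OF v] r by (simp add: le_divide_eq mult_left_le)
      then show "k \<le> p v / r v" using k(2)[OF v] by linarith
    qed (use g0 in auto)
    finally show ?thesis by (simp add: Z mult_ac)
  qed
  moreover have "Z m \<le> K * (1 + real m)\<^sup>2 * (1/4)^m" for m
  proof -
    have "(\<Sum>v\<in>S. p v / r v * g m v) \<le> (\<Sum>v\<in>S. p v / r v * (1 + real m)\<^sup>2)"
      using upper ppos r by (intro sum_mono mult_left_mono) (auto intro!: divide_nonneg_nonneg less_imp_le)
    then show ?thesis unfolding Z K_def sum_distrib_right[symmetric] by (simp add: mult_ac)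
  qed
  ultimately show ?thesis
    using P p ppos k c0 unfolding Z_def
    by (intro exI[of _ P] exI[of _ p] exI[of _ "1/4"] exI[of _ "k * c0"] exI[of _ K]) auto
qed

section \<open>Two-sided stationary Markov processes\<close>

text \<open>Driving noise for a two-sided Markov chain: coordinate \<open>(i, a)\<close> holds the symbol at time \<open>i\<close>
  that follows \<open>a\<close> at time \<open>i - 1\<close> (if \<open>i > 0\<close>) or precedes \<open>a\<close> at time \<open>i + 1\<close> (if \<open>i < 0\<close>), and
  the coordinates \<open>(0, a)\<close> hold the initial symbol.  With this choice a cylinder event is a box of
  finitely many coordinates.\<close>

fun forward_path :: "'s \<Rightarrow> (int \<times> 's \<Rightarrow> 's) \<Rightarrow> nat \<Rightarrow> 's" where
  "forward_path z \<omega> 0 = \<omega> (0, z)"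
| "forward_path z \<omega> (Suc n) = \<omega> (int (Suc n), forward_path z \<omega> n)"

fun backward_path :: "'s \<Rightarrow> (int \<times> 's \<Rightarrow> 's) \<Rightarrow> nat \<Rightarrow> 's" where
  "backward_path z \<omega> 0 = \<omega> (0, z)"
| "backward_path z \<omega> (Suc n) = \<omega> (- int (Suc n), backward_path z \<omega> n)"

definition two_sided_path :: "'s \<Rightarrow> (int \<times> 's \<Rightarrow> 's) \<Rightarrow> int \<Rightarrow> 's" where
  "two_sided_path z \<omega> i = (if 0 \<le> i then forward_path z \<omega> (nat i) else backward_path z \<omega> (nat (- i)))"

text \<open>The symbol from which the one at time \<open>i\<close> is generated: the neighbour
  nearer to time 0. At time 0 the dummy \<open>z\<close> only selects one of the coordinates
  \<open>(0, a)\<close>.\<close>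

definition towards_zero :: "'s \<Rightarrow> (int \<Rightarrow> 's) \<Rightarrow> int \<Rightarrow> 's" where
  "towards_zero z w i = (if i = 0 then z else if 0 < i then w (i - 1) else w (i + 1))"

lemma two_sided_path_rec:
  "two_sided_path z \<omega> i = \<omega> (i, towards_zero z (two_sided_path z \<omega>) i)"
proof -
  consider "i = 0" | n where "i = int (Suc n)" | n where "i = - int (Suc n)"
    by (metis int_cases neq0_conv not0_implies_Suc of_nat_0)
  then show ?thesis
  proof cases
    case 1 then show ?thesis by (simp add: two_sided_path_def towards_zero_def)
  next
    case 2
    then have "nat i = Suc n" "nat (i - 1) = n" by auto
    then show ?thesis using 2 by (simp add: two_sided_path_def towards_zero_def)
  next
    case (3 n)
    then have "nat (- i) = Suc n" "nat (- (i + 1)) = n" by auto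
    then show ?thesis using 3
      by (cases n) (simp_all add: two_sided_path_def towards_zero_def)
  qed
qed

text \<open>Once the path agrees with \<open>w\<close> nearer to 0, the coordinate consulted at time
  \<open>i\<close> has a known index, so induction on the distance to 0 applies. Different times use
  different coordinates, which are independent in a product measure.\<close>

lemma two_sided_path_eq_iff:
  "(\<forall>i\<in>{- int l..int n}. two_sided_path z \<omega> i = w i) \<longleftrightarrow>
   (\<forall>i\<in>{- int l..int n}. \<omega> (i, towards_zero z w i) = w i)" (is "?L \<longleftrightarrow> ?R")
proof
  assume L: ?L
  show ?R
  proof
    fix i assume i: "i \<in> {- int l..int n}"
    have "towards_zero z w i = towards_zero z (two_sided_path z \<omega>) i"
      using L i by (auto simp: towards_zero_def)
    then show "\<omega> (i, towards_zero z w i) = w i"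
      using L i two_sided_path_rec[of z \<omega> i] by auto
  qed
next
  assume R: ?R
  have "i \<in> {- int l..int n} \<Longrightarrow> two_sided_path z \<omega> i = w i" for i
  proof (induction "nat \<bar>i\<bar>" arbitrary: i rule: less_induct)
    case less
    have "towards_zero z (two_sided_path z \<omega>) i = towards_zero z w i"
      using less(1)[of "i - 1"] less(1)[of "i + 1"] less(2) by (auto simp: towards_zero_def)
    then show ?case using R less(2) two_sided_path_rec[of z \<omega> i] by auto
  qed
  then show ?L by blast
qed

text \<open>At negative times the reversed kernel contributes quotients of \<open>p\<close> that
  cancel from time 0 down to \<open>- int l\<close>, so a construction started at time 0 yields the
  formula started at the left end.\<close>

lemma stationary_telescope:
  fixes w :: "int \<Rightarrow> 's"
  assumes p: "\<And>i. i \<in> {- int l..int n} \<Longrightarrow> p (w i) \<noteq> (0::real)"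
  shows "(\<Prod>i\<in>{- int l..int n}. if i = 0 then p (w 0) else if 0 < i then P (w (i - 1)) (w i)
            else p (w i) * P (w i) (w (i + 1)) / p (w (i + 1)))
       = p (w (- int l)) * (\<Prod>i\<in>{- int l..<int n}. P (w i) (w (i + 1)))"
    (is "prod ?f _ = _")
  using p
proof (induction n)
  case 0
  then show ?case
  proof (induction l)
    case (Suc l)
    have 1: "{- int (Suc l)..int 0} = insert (- int (Suc l)) {- int l..int 0}"
      and 2: "{- int (Suc l)..<int 0} = insert (- int (Suc l)) {- int l..<int 0}" by auto
    have 3: "- int (Suc l) + 1 = - int l" by simp
    have 4: "p (w (- int l)) \<noteq> 0" using Suc.prems[of "- int l"] by simp
    have IH: "prod ?f {- int l..int 0} = p (w (- int l)) * (\<Prod>i\<in>{- int l..<int 0}. P (w i) (w (i + 1)))"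
      using Suc by force
    have "prod ?f {- int (Suc l)..int 0} = ?f (- int (Suc l)) * prod ?f {- int l..int 0}"
      unfolding 1 by (subst prod.insert) auto
    also have "\<dots> = p (w (- int (Suc l))) * P (w (- int (Suc l))) (w (- int l)) *
        (\<Prod>i\<in>{- int l..<int 0}. P (w i) (w (i + 1)))"
      unfolding IH using 4 3 by simp
    also have "\<dots> = p (w (- int (Suc l))) * (\<Prod>i\<in>{- int (Suc l)..<int 0}. P (w i) (w (i + 1)))"
      unfolding 2 by (subst prod.insert) (use 3 in auto)
    finally show ?case .
  qed simp
next
  case (Suc n)
  have 1: "{- int l..int (Suc n)} = insert (int (Suc n)) {- int l..int n}"
    and 2: "{- int l..<int (Suc n)} = insert (int n) {- int l..<int n}" by auto
  have "prod ?f {- int l..int (Suc n)} = ?f (int (Suc n)) * prod ?f {- int l..int n}"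
    unfolding 1 by (subst prod.insert) auto
  also have "prod ?f {- int l..int n} = p (w (- int l)) * (\<Prod>i\<in>{- int l..<int n}. P (w i) (w (i + 1)))"
    using Suc by force
  also have "?f (int (Suc n)) * \<dots> = p (w (- int l)) * (\<Prod>i\<in>{- int l..<int (Suc n)}. P (w i) (w (i + 1)))"
    unfolding 2 by (subst prod.insert) (auto simp: add_ac)
  finally show ?case .
qed

text \<open>The edge condition holds for every sample point and not just almost surely, so every
  sample path can later be read as a point of the shift.\<close>

lemma stationary_process_exists:
  fixes P :: "'s \<Rightarrow> 's \<Rightarrow> real"
  assumes S: "finite S" "E \<subseteq> S \<times> S" and P: "stochastic_matrix S P"
    and PE: "\<And>u v. (u, v) \<notin> E \<Longrightarrow> P u v = 0"
    and p: "probability_vector S p" "\<And>v. v \<in> S \<Longrightarrow> 0 < p v"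
      "\<And>w. w \<in> S \<Longrightarrow> (\<Sum>v\<in>S. p v * P v w) = p w"
  shows "\<exists>(M :: (int \<times> 's \<Rightarrow> 's) measure) \<xi>. prob_space M \<and>
    (\<forall>\<omega>\<in>space M. \<forall>i. (\<xi> \<omega> i, \<xi> \<omega> (i + 1)) \<in> E) \<and>
    (\<forall>i s. {\<omega>\<in>space M. \<xi> \<omega> i = s} \<in> sets M) \<and>
    (\<forall>w l n. w 0 \<in> S \<longrightarrow> (\<forall>i\<in>{- int l..<int n}. (w i, w (i + 1)) \<in> E) \<longrightarrow>
       measure M {\<omega>\<in>space M. \<forall>i\<in>{- int l..int n}. \<xi> \<omega> i = w i}
         = p (w (- int l)) * (\<Prod>i\<in>{- int l..<int n}. P (w i) (w (i + 1))))"
proof -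
  \<comment> \<open>Initial law, forward kernel and time-reversed kernel; stationarity of
    \<open>p\<close> makes the rows of the last one sum to 1.\<close>
  define q where "q i a b = (if i = (0::int) then p b else if 0 < i then P a b else p b * P b a / p a)" for i a b
  define R where "R i a = (if i = (0::int) then S else if 0 < i then E `` {a} else E\<inverse> `` {a})" for i a
  have finR: "finite (R i a)" for i a
    by (rule finite_subset[OF _ S(1)]) (use S in \<open>auto simp: R_def\<close>)
  have nn: "0 \<le> P a b" if "a \<in> S" "b \<in> S" for a b
    using P that by (auto simp: stochastic_matrix_def probability_vector_def)
  have qsum: "(\<Sum>b\<in>R i a. q i a b) = 1" if a: "a \<in> S" for i a
  proof -
    have "(\<Sum>b\<in>R i a. q i a b) = (\<Sum>b\<in>S. q i a b)"
      by (rule sum.mono_neutral_left) (use S PE in \<open>auto simp: R_def q_def split: if_splits\<close>)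
    also have "\<dots> = 1"
    proof -
      consider "i = 0" | "i > 0" | "i < 0" by linarith
      then show ?thesis
      proof cases
        case 3
        then have "(\<Sum>b\<in>S. q i a b) = (\<Sum>b\<in>S. p b * P b a) / p a"
          by (simp add: q_def sum_divide_distrib)
        then show ?thesis using p(3)[OF a] p(2)[OF a] by simp
      qed (use P p a in \<open>auto simp: q_def stochastic_matrix_def probability_vector_def\<close>)
    qed
    finally show ?thesis .
  qed
  have qnn: "0 \<le> q i a b" if "a \<in> S" "b \<in> R i a" for i a b
  proof -
    have "b \<in> S" using that S by (auto simp: R_def split: if_splits)
    then show ?thesis using that nn p(2)[of a] p(2)[of b] by (simp add: q_def)
  qed
  \<comment> \<open>The factor spaces contain only the symbols \<open>R i a\<close> allowed next to
    \<open>a\<close>, which builds the edge condition into the sample space. For \<open>a\<close>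
    outside \<open>S\<close> the factor is a dummy that is never consulted.\<close>
  define N where "N = (\<lambda>(i, a). if a \<in> S then point_measure (R i a) (\<lambda>b. ennreal (q i a b)) else point_measure {a} (\<lambda>_. 1))"
  have spN: "space (N (i, a)) = (if a \<in> S then R i a else {a})"
    and stN: "sets (N (i, a)) = Pow (space (N (i, a)))" for i a
    by (auto simp: N_def space_point_measure sets_point_measure)
  have probN: "prob_space (N x)" for x
    using qsum qnn finR
    by (cases x) (auto simp: N_def intro!: prob_space_point_measure simp: sum_ennreal)
  interpret product_prob_space N UNIV
    by (rule product_prob_spaceI) (rule probN)
  define M where "M = PiM UNIV N"
  have S0: "S \<noteq> {}" using p(1) by (auto simp: probability_vector_def)
  then obtain z where z: "z \<in> S" by blast
  define \<xi> where "\<xi> = two_sided_path z"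
  have spM: "\<omega> (i, a) \<in> R i a" if "\<omega> \<in> space M" "a \<in> S" for \<omega> i a
  proof -
    have "\<omega> (i, a) \<in> space (N (i, a))" using that by (auto simp: M_def space_PiM PiE_iff)
    then show ?thesis using that by (simp add: spN)
  qed
  have RS: "R i a \<subseteq> S" for i a using S by (auto simp: R_def)
  have xi_S: "\<xi> \<omega> i \<in> S" if "\<omega> \<in> space M" for \<omega> i
  proof (induction "nat \<bar>i\<bar>" arbitrary: i rule: less_induct)
    case less
    have "towards_zero z (\<xi> \<omega>) i \<in> S"
      using less[of "i - 1"] less[of "i + 1"] z by (auto simp: towards_zero_def)
    then show ?case
      using two_sided_path_rec[of z \<omega> i] spM[OF that] RS unfolding \<xi>_def by fastforce
  qed
  have xi_E: "(\<xi> \<omega> i, \<xi> \<omega> (i + 1)) \<in> E" if "\<omega> \<in> space M" for \<omega> i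
  proof (cases "0 \<le> i")
    case True
    have "\<xi> \<omega> (i + 1) = \<omega> (i + 1, \<xi> \<omega> i)"
      using two_sided_path_rec[of z \<omega> "i + 1"] True by (simp add: \<xi>_def towards_zero_def)
    then show ?thesis using spM[OF that xi_S[OF that], of "i + 1" i] True by (auto simp: R_def)
  next
    case False
    have "\<xi> \<omega> i = \<omega> (i, \<xi> \<omega> (i + 1))"
      using two_sided_path_rec[of z \<omega> i] False by (simp add: \<xi>_def towards_zero_def)
    then show ?thesis using spM[OF that xi_S[OF that], of i "i + 1"] False by (auto simp: R_def)
  qed
  have coord: "{\<omega>\<in>space M. \<omega> x = s} \<in> sets M" for x s
  proof -
    have "(\<lambda>\<omega>. \<omega> x) \<in> measurable M (N x)" unfolding M_def by (rule measurable_component_singleton) simp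
    moreover have "{s} \<inter> space (N x) \<in> sets (N x)" using stN by (cases x) auto
    ultimately have "(\<lambda>\<omega>. \<omega> x) -` ({s} \<inter> space (N x)) \<inter> space M \<in> sets M" by (rule measurable_sets)
    moreover have "(\<lambda>\<omega>. \<omega> x) -` ({s} \<inter> space (N x)) \<inter> space M = {\<omega>\<in>space M. \<omega> x = s}"
      by (auto simp: M_def space_PiM)
    ultimately show ?thesis by simp
  qed
  have meas: "{\<omega>\<in>space M. \<xi> \<omega> i = s} \<in> sets M" for i s
  proof (induction "nat \<bar>i\<bar>" arbitrary: i s rule: less_induct)
    case less
    have t: "{\<omega>\<in>space M. towards_zero z (\<xi> \<omega>) i = a} \<in> sets M" for a
    proof -
      consider "i = 0" | "i > 0" | "i < 0" by linarith
      then show ?thesis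
      proof cases
        case 1
        then have "{\<omega>\<in>space M. towards_zero z (\<xi> \<omega>) i = a} = (if a = z then space M else {})"
          by (auto simp: towards_zero_def)
        then show ?thesis by simp
      next
        case 2 then show ?thesis using less[of "i - 1" a] by (simp add: towards_zero_def)
      next
        case 3 then show ?thesis using less[of "i + 1" a] by (simp add: towards_zero_def)
      qed
    qed
    have "towards_zero z (\<xi> \<omega>) i \<in> S" if "\<omega> \<in> space M" for \<omega>
      using xi_S[OF that] z by (auto simp: towards_zero_def)
    then have "{\<omega>\<in>space M. \<xi> \<omega> i = s} = (\<Union>a\<in>S. {\<omega>\<in>space M. towards_zero z (\<xi> \<omega>) i = a} \<inter> {\<omega>\<in>space M. \<omega> (i, a) = s})"
      using two_sided_path_rec[of z _ i] unfolding \<xi>_def by auto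
    also have "\<dots> \<in> sets M" using S(1) t coord by (intro sets.finite_UN) auto
    finally show ?case .
  qed
  have cyl: "measure M {\<omega>\<in>space M. \<forall>i\<in>{- int l..int n}. \<xi> \<omega> i = w i}
         = p (w (- int l)) * (\<Prod>i\<in>{- int l..<int n}. P (w i) (w (i + 1)))"
    if w0: "w 0 \<in> S" and w: "\<forall>i\<in>{- int l..<int n}. (w i, w (i + 1)) \<in> E" for w l n
  proof -
    have wS: "w i \<in> S" if "i \<in> {- int l..int n}" for i
    proof -
      consider "i = 0" | "0 < i" | "i < 0" by linarith
      then show ?thesis
      proof cases
        case 2 then have "(w (i - 1), w (i - 1 + 1)) \<in> E" using that w by (intro bspec[OF w]) auto
        then show ?thesis using S by auto
      next
        case 3 then have "(w i, w (i + 1)) \<in> E" using that w by auto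
        then show ?thesis using S by auto
      qed (use w0 in simp)
    qed
    define tz where "tz = towards_zero z w"
    have tzS: "tz i \<in> S" if "i \<in> {- int l..int n}" for i
      using that wS z by (auto simp: tz_def towards_zero_def)
    have wR: "w i \<in> R i (tz i)" if i: "i \<in> {- int l..int n}" for i
    proof -
      consider "i = 0" | "0 < i" | "i < 0" by linarith
      then show ?thesis
      proof cases
        case 2 then have "(w (i - 1), w (i - 1 + 1)) \<in> E" using i w by (intro bspec[OF w]) auto
        then show ?thesis using 2 by (auto simp: R_def tz_def towards_zero_def)
      next
        case 3 then have "(w i, w (i + 1)) \<in> E" using i w by auto
        then show ?thesis using 3 by (auto simp: R_def tz_def towards_zero_def)
      qed (use w0 in \<open>simp add: R_def\<close>)
    qed
    define J where "J = (\<lambda>i. (i, tz i)) ` {- int l..int n}"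
    define B where "B x = {w (fst x)}" for x :: "int \<times> 's"
    have "{\<omega>\<in>space M. \<forall>i\<in>{- int l..int n}. \<xi> \<omega> i = w i} = {\<omega>\<in>space M. \<forall>x\<in>J. \<omega> x \<in> B x}"
      unfolding \<xi>_def two_sided_path_eq_iff by (auto simp: J_def B_def tz_def)
    moreover have "emeasure M {\<omega>\<in>space M. \<forall>x\<in>J. \<omega> x \<in> B x} = (\<Prod>x\<in>J. emeasure (N x) (B x))"
      unfolding M_def by (rule emeasure_PiM_Collect) (use tzS wR in \<open>auto simp: J_def B_def stN spN\<close>)
    moreover have "(\<Prod>x\<in>J. emeasure (N x) (B x)) = (\<Prod>i\<in>{- int l..int n}. emeasure (N (i, tz i)) {w i})"
      unfolding J_def by (subst prod.reindex) (auto simp: inj_on_def B_def)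
    moreover have "\<dots> = (\<Prod>i\<in>{- int l..int n}. ennreal (q i (tz i) (w i)))"
      using tzS wR finR by (intro prod.cong) (auto simp: N_def emeasure_point_measure_finite)
    moreover have "\<dots> = ennreal (\<Prod>i\<in>{- int l..int n}. q i (tz i) (w i))"
      using qnn tzS wR by (intro prod_ennreal) auto
    moreover have "0 \<le> (\<Prod>i\<in>{- int l..int n}. q i (tz i) (w i))"
      using qnn tzS wR by (intro prod_nonneg) auto
    ultimately have "measure M {\<omega>\<in>space M. \<forall>i\<in>{- int l..int n}. \<xi> \<omega> i = w i} = (\<Prod>i\<in>{- int l..int n}. q i (tz i) (w i))"
      by (simp add: measure_def)
    also have "\<dots> = (\<Prod>i\<in>{- int l..int n}. if i = 0 then p (w 0) else if 0 < i then P (w (i - 1)) (w i)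
            else p (w i) * P (w i) (w (i + 1)) / p (w (i + 1)))"
      by (intro prod.cong) (auto simp: q_def tz_def towards_zero_def)
    also have "\<dots> = p (w (- int l)) * (\<Prod>i\<in>{- int l..<int n}. P (w i) (w (i + 1)))"
      using wS p(2) by (intro stationary_telescope) force
    finally show ?thesis .
  qed
  have "prob_space M" unfolding M_def by (rule prob_space_PiM) (rule probN)
  then show ?thesis using xi_E meas cyl by (intro exI[of _ M] exI[of _ \<xi>]) blast
qed

section \<open>Topology and Borel sets of shift spaces\<close>

lemma topspace_shift_topology:
  assumes "\<forall>x\<in>X. range x \<subseteq> A"
  shows "topspace (shift_topology A X) = X"
  using assms by (auto simp: shift_topology_def full_shift_topology_def)

lemma openin_shift_topology_iff:
  assumes XA: "\<forall>x\<in>X. range x \<subseteq> A"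
  shows "openin (shift_topology A X) U \<longleftrightarrow>
    U \<subseteq> X \<and> (\<forall>x\<in>U. \<exists>n. \<forall>x'\<in>X. (\<forall>i\<in>{- int n..int n}. x' i = x i) \<longrightarrow> x' \<in> U)"
    (is "_ \<longleftrightarrow> ?R")
proof
  assume U: "openin (shift_topology A X) U"
  then obtain V where V: "openin (full_shift_topology A) V" "U = V \<inter> X"
    by (auto simp: shift_topology_def openin_subtopology)
  have "\<exists>n. \<forall>x'\<in>X. (\<forall>i\<in>{- int n..int n}. x' i = x i) \<longrightarrow> x' \<in> U" if "x \<in> U" for x
  proof -
    have "x \<in> V" using that V by simp
    then obtain W where W: "finite {i. W i \<noteq> A}" "x \<in> Pi\<^sub>E UNIV W" "Pi\<^sub>E UNIV W \<subseteq> V"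
      using V(1) unfolding full_shift_topology_def openin_product_topology_alt by fastforce
    define n where "n = Max (insert 0 ((\<lambda>i. nat \<bar>i\<bar>) ` {i. W i \<noteq> A}))"
    have n: "nat \<bar>i\<bar> \<le> n" if "W i \<noteq> A" for i
      unfolding n_def using W(1) that by (intro Max_ge) auto
    have "x' \<in> U" if x': "x' \<in> X" "\<forall>i\<in>{- int n..int n}. x' i = x i" for x'
    proof -
      have "x' i \<in> W i" for i
      proof (cases "W i = A")
        case False
        then have "i \<in> {- int n..int n}" using n[OF False] by auto
        then have "x' i = x i" using x' by blast
        then show ?thesis using W(2) by (simp add: PiE_iff)
      qed (use bspec[OF XA x'(1)] in auto)
      then show ?thesis using W x' V by auto
    qed
    then show ?thesis by blast
  qed
  moreover have "U \<subseteq> X" using V by simp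
  ultimately show ?R by blast
next
  assume R: ?R
  have "\<exists>T. openin (shift_topology A X) T \<and> x \<in> T \<and> T \<subseteq> U" if x: "x \<in> U" for x
  proof -
    obtain n where n: "\<forall>x'\<in>X. (\<forall>i\<in>{- int n..int n}. x' i = x i) \<longrightarrow> x' \<in> U" using R x by blast
    have xX: "x \<in> X" using R x by blast
    define W where "W i = (if i \<in> {- int n..int n} then {x i} else A)" for i
    have "{i. W i \<noteq> A} \<subseteq> {- int n..int n}" by (auto simp: W_def)
    then have "finite {i. W i \<noteq> A}" by (rule finite_subset) simp
    then have "openin (full_shift_topology A) (Pi\<^sub>E UNIV W)"
      using bspec[OF XA xX] unfolding full_shift_topology_def openin_PiE_gen by (auto simp: W_def)
    then have "openin (shift_topology A X) (Pi\<^sub>E UNIV W \<inter> X)"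
      by (auto simp: shift_topology_def openin_subtopology)
    moreover have "x \<in> Pi\<^sub>E UNIV W \<inter> X" using xX subsetD[OF bspec[OF XA xX]] by (auto simp: W_def)
    moreover have "Pi\<^sub>E UNIV W \<inter> X \<subseteq> U"
    proof
      fix x' assume "x' \<in> Pi\<^sub>E UNIV W \<inter> X"
      then have "x' \<in> X" and W: "x' i \<in> W i" for i by auto
      have "x' i = x i" if "i \<in> {- int n..int n}" for i
        using that W[of i] by (simp add: W_def)
      then show "x' \<in> U" using n \<open>x' \<in> X\<close> by blast
    qed
    ultimately show ?thesis by blast
  qed
  then show "openin (shift_topology A X) U" by (subst openin_subopen) blast
qed

lemma continuous_map_shift_topology:
  assumes XA: "\<forall>x\<in>X. range x \<subseteq> A" and ZB: "\<forall>z\<in>Z. range z \<subseteq> B"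
    and f: "\<And>x. x \<in> X \<Longrightarrow> f x \<in> Z"
    and loc: "\<And>i. \<exists>n. \<forall>x\<in>X. \<forall>x'\<in>X. (\<forall>j\<in>{- int n..int n}. x' j = x j) \<longrightarrow> f x' i = f x i"
  shows "continuous_map (shift_topology A X) (shift_topology B Z) f"
proof -
  have "continuous_map (shift_topology A X) (discrete_topology B) (\<lambda>x. f x i)" for i
    unfolding continuous_map
  proof (intro conjI allI impI)
    show "(\<lambda>x. f x i) ` topspace (shift_topology A X) \<subseteq> topspace (discrete_topology B)"
      using bspec[OF ZB f] by (auto simp: topspace_shift_topology[OF XA])
    fix U
    obtain n where "\<forall>x\<in>X. \<forall>x'\<in>X. (\<forall>j\<in>{- int n..int n}. x' j = x j) \<longrightarrow> f x' i = f x i"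
      using loc by blast
    then show "openin (shift_topology A X) {x \<in> topspace (shift_topology A X). f x i \<in> U}"
      unfolding openin_shift_topology_iff[OF XA] topspace_shift_topology[OF XA]
      by (metis (mono_tags, lifting) mem_Collect_eq subsetI)
  qed
  then show ?thesis
    unfolding shift_topology_def[of B] full_shift_topology_def
    using f by (auto simp: continuous_map_in_subtopology continuous_map_componentwise_UNIV
        topspace_shift_topology[OF XA])
qed

lemma space_shift_borel:
  assumes "\<forall>x\<in>X. range x \<subseteq> A"
  shows "space (shift_borel A X) = X"
  using topspace_shift_topology[of X A] assms openin_subset[of "shift_topology A X"]
  by (simp add: shift_borel_def space_measure_of_conv)

lemma sets_shift_borel:
  "sets (shift_borel A X) = sigma_sets (topspace (shift_topology A X)) {U. openin (shift_topology A X) U}"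
  unfolding shift_borel_def by (rule sets_measure_of) (use openin_subset in blast)

lemma measurable_shift_borel_continuous:
  assumes "\<forall>x\<in>X. range x \<subseteq> A" "continuous_map (shift_topology A X) (shift_topology B Z) f"
  shows "f \<in> measurable (shift_borel A X) (shift_borel B Z)"
  unfolding shift_borel_def[of B Z]
proof (rule measurable_measure_of)
  show "{U. openin (shift_topology B Z) U} \<subseteq> Pow (topspace (shift_topology B Z))"
    using openin_subset by blast
  show "f \<in> space (shift_borel A X) \<rightarrow> topspace (shift_topology B Z)"
    using assms topspace_shift_topology[of X A] continuous_map_image_subset_topspace[OF assms(2)]
    by (auto simp: space_shift_borel)
  fix U assume "U \<in> {U. openin (shift_topology B Z) U}"
  then have "openin (shift_topology A X) {x \<in> topspace (shift_topology A X). f x \<in> U}"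
    using openin_continuous_map_preimage[OF assms(2)] by simp
  moreover have "f -` U \<inter> space (shift_borel A X) = {x \<in> topspace (shift_topology A X). f x \<in> U}"
    using assms(1) by (auto simp: space_shift_borel topspace_shift_topology)
  ultimately show "f -` U \<inter> space (shift_borel A X) \<in> sets (shift_borel A X)"
    by (auto simp: sets_shift_borel)
qed

lemma shift_borel_openI: "openin (shift_topology A X) U \<Longrightarrow> U \<in> sets (shift_borel A X)"
  by (auto simp: sets_shift_borel)

lemma length_block [simp]: "length (block x i n) = n"
  by (simp add: block_def)

lemma nth_block [simp]: "k < n \<Longrightarrow> block x i n ! k = x (i + int k)"
  by (simp add: block_def)

lemma block_eq_iff: "block x i n = block x' j n \<longleftrightarrow> (\<forall>k<n. x (i + int k) = x' (j + int k))"
  by (auto simp: list_eq_iff_nth_eq)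

lemma block_shift: "block (\<lambda>j. x (j + k)) i n = block x (i + k) n"
  by (simp add: block_def add_ac)

lemma hd_block: "0 < n \<Longrightarrow> hd (block x i n) = x i"
  by (subst hd_conv_nth) (simp_all flip: length_greater_0_conv)

text \<open>A cylinder in terms of states of the \<open>N\<close>-block graph, so that Markov
  formulas apply to it directly. The two ends are independent because the shift moves them in
  opposite directions as seen from 0.\<close>

definition window :: "(int \<Rightarrow> 'a) set \<Rightarrow> nat \<Rightarrow> nat \<Rightarrow> nat \<Rightarrow> (int \<Rightarrow> 'a) \<Rightarrow> (int \<Rightarrow> 'a) set" where
  "window X N l n x = {x'\<in>X. \<forall>i\<in>{- int l..int n}. block x' i N = block x i N}"

lemma openin_locally_constant:
  assumes XA: "\<forall>x\<in>X. range x \<subseteq> A"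
    and "\<And>x x'. x \<in> X \<Longrightarrow> x' \<in> X \<Longrightarrow> (\<forall>i\<in>{- int n..int n}. x' i = x i) \<Longrightarrow> Q x \<Longrightarrow> Q x'"
  shows "openin (shift_topology A X) {x\<in>X. Q x}"
  unfolding openin_shift_topology_iff[OF XA] using assms(2) by blast

text \<open>Blanking all positions outside \<open>{l..n}\<close> before applying \<open>Q\<close>
  expresses that the condition depends on finitely many blocks; concrete conditions are obtained by
  instantiating \<open>Q\<close>.\<close>

lemma openin_block_condition:
  assumes XA: "\<forall>x\<in>X. range x \<subseteq> A"
  shows "openin (shift_topology A X) {x\<in>X. Q (\<lambda>i. if i \<in> {l..n} then block x i N else [])}"
proof (rule openin_locally_constant[OF XA])
  define m where "m = nat (\<bar>l\<bar> + \<bar>n\<bar> + int N)"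
  fix x x' assume *: "\<forall>i\<in>{- int m..int m}. x' i = x i"
    and Q: "Q (\<lambda>i. if i \<in> {l..n} then block x i N else [])"
  have "(\<lambda>i. if i \<in> {l..n} then block x' i N else []) = (\<lambda>i. if i \<in> {l..n} then block x i N else [])"
  proof -
    have "x' (i + int k) = x (i + int k)" if "i \<in> {l..n}" "k < N" for i k
      using that by (intro bspec[OF *]) (auto simp: m_def)
    then show ?thesis by (auto simp: block_eq_iff fun_eq_iff)
  qed
  then show "Q (\<lambda>i. if i \<in> {l..n} then block x' i N else [])" using Q by simp
qed

lemma openin_window:
  assumes XA: "\<forall>x\<in>X. range x \<subseteq> A"
  shows "openin (shift_topology A X) (window X N l n x)"
proof -
  have "window X N l n x = {x'\<in>X. (\<lambda>s. \<forall>i\<in>{- int l..int n}. s i = block x i N)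
      (\<lambda>i. if i \<in> {- int l..int n} then block x' i N else [])}"
    by (auto simp: window_def)
  then show ?thesis
    using openin_block_condition[OF XA, where Q = "\<lambda>s. \<forall>i\<in>{- int l..int n}. s i = block x i N"
        and l = "- int l" and n = "int n" and N = N] by simp
qed

text \<open>An open set is the union of the windows inside it, and over a finite alphabet there are
  only countably many windows. The bound \<open>1 \<le> n\<close> leaves room to shift a window by
  one later.\<close>

lemma sets_shift_borel_windows:
  assumes fin: "finite A" and XA: "\<forall>x\<in>X. range x \<subseteq> A" and N: "0 < N"
  shows "sets (shift_borel A X) = sigma_sets X (insert {} (insert X {window X N n n x | n x. 1 \<le> n \<and> x \<in> X}))"
    (is "_ = sigma_sets X ?G")
proof -
  have "sigma_sets X {U. openin (shift_topology A X) U} = sigma_sets X ?G"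
  proof (rule sigma_sets_eqI)
    fix U assume "U \<in> {U. openin (shift_topology A X) U}"
    then have U: "U \<subseteq> X" "\<And>x. x \<in> U \<Longrightarrow> \<exists>n. \<forall>x'\<in>X. (\<forall>i\<in>{- int n..int n}. x' i = x i) \<longrightarrow> x' \<in> U"
      using openin_shift_topology_iff[OF XA] by auto
    define H where "H = {window X N n n x | n x. 1 \<le> n \<and> x \<in> X}"
    define L where "L = {u. set u \<subseteq> A \<and> length u = N}"
    have "H \<subseteq> (\<Union>n. (\<lambda>f. {x'\<in>X. \<forall>i\<in>{- int n..int n}. block x' i N = f i}) ` Pi\<^sub>E {- int n..int n} (\<lambda>_. L))"
    proof
      fix V assume "V \<in> H"
      then obtain n x where V: "V = window X N n n x" "x \<in> X" by (auto simp: H_def)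
      define f where "f = restrict (\<lambda>i. block x i N) {- int n..int n}"
      have "f \<in> Pi\<^sub>E {- int n..int n} (\<lambda>_. L)"
        using subsetD[OF bspec[OF XA V(2)]] by (auto simp: f_def L_def block_def)
      moreover have "V = {x'\<in>X. \<forall>i\<in>{- int n..int n}. block x' i N = f i}"
        using V by (auto simp: window_def f_def)
      ultimately show "V \<in> (\<Union>n. (\<lambda>f. {x'\<in>X. \<forall>i\<in>{- int n..int n}. block x' i N = f i}) ` Pi\<^sub>E {- int n..int n} (\<lambda>_. L))"
        by blast
    qed
    moreover have "finite L" unfolding L_def using finite_lists_length_eq[OF fin] by simp
    then have "countable (\<Union>n. (\<lambda>f. {x'\<in>X. \<forall>i\<in>{- int n..int n}. block x' i N = f i}) ` Pi\<^sub>E {- int n..int n} (\<lambda>_. L))"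
      by (intro countable_UN[OF countableI_type] countable_finite finite_imageI finite_PiE) auto
    ultimately have "countable H" by (rule countable_subset)
    then have "countable {V\<in>H. V \<subseteq> U}" by (rule countable_subset[rotated]) auto
    moreover have "U = \<Union>{V\<in>H. V \<subseteq> U}"
    proof (rule equalityI; rule subsetI)
      fix x assume x: "x \<in> U"
      then obtain n where n: "\<forall>x'\<in>X. (\<forall>i\<in>{- int n..int n}. x' i = x i) \<longrightarrow> x' \<in> U" using U by blast
      have "window X N (Suc n) (Suc n) x \<subseteq> U"
      proof
        fix x' assume x': "x' \<in> window X N (Suc n) (Suc n) x"
        have "x' i = x i" if "i \<in> {- int n..int n}" for i
        proof -
          have "block x' i N = block x i N" using x' that by (auto simp: window_def)
          then show ?thesis using N by (metis hd_block)
        qed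
        then show "x' \<in> U" using n x' by (auto simp: window_def)
      qed
      moreover have "window X N (Suc n) (Suc n) x \<in> H" using x U by (auto simp: H_def)
      moreover have "x \<in> window X N (Suc n) (Suc n) x" using x U by (auto simp: window_def)
      ultimately show "x \<in> \<Union>{V\<in>H. V \<subseteq> U}" by blast
    qed auto
    ultimately show "U \<in> sigma_sets X ?G"
      by (subst \<open>U = _\<close>, intro sigma_sets_UNION) (auto simp: H_def)
  next
    fix V assume "V \<in> ?G"
    then have "openin (shift_topology A X) V"
      using openin_window[OF XA] openin_topspace[of "shift_topology A X"]
      by (auto simp: topspace_shift_topology[OF XA])
    then show "V \<in> sigma_sets X {U. openin (shift_topology A X) U}" by auto
  qed
  then show ?thesis by (simp add: sets_shift_borel topspace_shift_topology[OF XA])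
qed

text \<open>Two symmetric windows are nested or disjoint, so together with \<open>{}\<close> and
  \<open>X\<close> they form an intersection-stable generator.\<close>

lemma shift_borel_measure_eqI:
  assumes fin: "finite A" and XA: "\<forall>x\<in>X. range x \<subseteq> A" and N: "0 < N"
    and M: "prob_space M" "sets M = sets (shift_borel A X)"
    and M': "prob_space M'" "sets M' = sets (shift_borel A X)"
    and eq: "\<And>n x. 1 \<le> n \<Longrightarrow> x \<in> X \<Longrightarrow> measure M (window X N n n x) = measure M' (window X N n n x)"
  shows "M = M'"
proof -
  interpret M: prob_space M by fact
  interpret M': prob_space M' by fact
  have sp: "space M = X" "space M' = X"
    using sets_eq_imp_space_eq[OF M(2)] sets_eq_imp_space_eq[OF M'(2)] space_shift_borel[OF XA] by auto
  let ?G = "insert {} (insert X {window X N n n x | n x. 1 \<le> n \<and> x \<in> X})"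
  have aux: "window X N m m x \<inter> window X N n n x' \<in> {{}, window X N n n x'}" if "m \<le> n" for m n x x'
  proof (cases "window X N m m x \<inter> window X N n n x' = {}")
    case False
    then obtain z where z: "z \<in> window X N m m x" "z \<in> window X N n n x'" by blast
    have "block y i N = block x i N" if "y \<in> window X N n n x'" "i \<in> {- int m..int m}" for y i
      using that z \<open>m \<le> n\<close> by (auto simp: window_def)
    moreover have "y \<in> X" if "y \<in> window X N n n x'" for y using that by (simp add: window_def)
    ultimately have "window X N n n x' \<subseteq> window X N m m x"
      by (subst (2) window_def) blast
    then show ?thesis by auto
  qed simp
  show ?thesis
  proof (rule measure_eqI_generator_eq[where E = ?G and \<Omega> = X and A = "\<lambda>_. X"])
    show "Int_stable ?G"
    proof (rule Int_stableI)
      fix U V assume U: "U \<in> ?G" and V: "V \<in> ?G"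
      have sub: "W \<subseteq> X" if "W \<in> ?G" for W using that by (auto simp: window_def)
      show "U \<inter> V \<in> ?G"
      proof (cases "U \<in> {{}, X} \<or> V \<in> {{}, X}")
        case True
        then show ?thesis using U V sub[OF U] sub[OF V] by (elim disjE) (auto simp: Int_absorb1 Int_absorb2)
      next
        case False
        then obtain m x n x' where "U = window X N m m x" "V = window X N n n x'" "1 \<le> m" "1 \<le> n" "x \<in> X" "x' \<in> X"
          using U V by auto
        then have "U \<inter> V \<in> {{}, U, V}"
          using aux[of m n x x'] aux[of n m x' x] by (cases "m \<le> n") (auto simp: Int_commute)
        then show ?thesis using U V by (elim insertE emptyE) simp_all
      qed
    qed
    show "?G \<subseteq> Pow X" by (auto simp: window_def)
    fix U assume "U \<in> ?G"
    then show "emeasure M U = emeasure M' U"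
      using eq M.emeasure_space_1 M'.emeasure_space_1
      by (auto simp: M.emeasure_eq_measure M'.emeasure_eq_measure sp)
  qed (use sets_shift_borel_windows[OF fin XA N] M M' M.emeasure_space_1 sp in auto)
qed

lemma measurable_shift_borelI:
  assumes fin: "finite A" and XA: "\<forall>x\<in>X. range x \<subseteq> A"
    and f: "\<And>\<omega>. \<omega> \<in> space M \<Longrightarrow> f \<omega> \<in> X"
    and meas: "\<And>i a. {\<omega>\<in>space M. f \<omega> i = a} \<in> sets M"
  shows "f \<in> measurable M (shift_borel A X)"
proof (rule measurableI)
  fix U assume "U \<in> sets (shift_borel A X)"
  then have "U \<in> sigma_sets X (insert {} (insert X {window X 1 n n x | n x. 1 \<le> n \<and> x \<in> X}))"
    using sets_shift_borel_windows[OF fin XA, of 1] by auto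
  then show "f -` U \<inter> space M \<in> sets M"
  proof (induction rule: sigma_sets.induct)
    case (Basic U)
    have "f -` X \<inter> space M = space M" using f by auto
    moreover have "f -` window X 1 n n x \<inter> space M \<in> sets M" for n x
    proof -
      have "f -` window X 1 n n x \<inter> space M = (\<Inter>i\<in>{- int n..int n}. {\<omega>\<in>space M. f \<omega> i = x i})"
        using f by (force simp: window_def block_def)
      also have "\<dots> \<in> sets M" using meas by (intro sets.finite_INT) auto
      finally show ?thesis .
    qed
    ultimately show ?case using Basic by auto
  next
    case (Compl U)
    have "f -` (X - U) \<inter> space M = space M - (f -` U \<inter> space M)" using f by auto
    then show ?case using Compl by auto
  next
    case (Union U)
    then have "(\<Union>i. f -` U i \<inter> space M) \<in> sets M" by (intro sets.countable_UN) auto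
    moreover have "f -` (\<Union>i. U i) \<inter> space M = (\<Union>i. f -` U i \<inter> space M)" by auto
    ultimately show ?case by simp
  qed auto
qed (use f space_shift_borel[OF XA] in auto)

section \<open>One-step shifts of finite type and their block graphs\<close>

definition block_states :: "(int \<Rightarrow> 'a) set \<Rightarrow> nat \<Rightarrow> 'a list set" where
  "block_states X N = {block x i N | x i. x \<in> X}"

definition block_edges :: "(int \<Rightarrow> 'a) set \<Rightarrow> nat \<Rightarrow> ('a list \<times> 'a list) set" where
  "block_edges X N = {(block x i N, block x (i + 1) N) | x i. x \<in> X}"

lemma block_edges_subset: "block_edges X N \<subseteq> block_states X N \<times> block_states X N"
  by (auto simp: block_edges_def block_states_def)

lemma block_edgesI: "x \<in> X \<Longrightarrow> (block x i N, block x (i + 1) N) \<in> block_edges X N"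
  by (auto simp: block_edges_def)

lemma block_statesI: "x \<in> X \<Longrightarrow> block x i N \<in> block_states X N"
  by (auto simp: block_states_def)

locale one_step_sft =
  fixes A :: "'a set" and X :: "(int \<Rightarrow> 'a) set"
  assumes fin: "finite A" and sft: "sft A X" and one_step: "one_step X" and ne: "X \<noteq> {}"
begin

lemma XA: "\<forall>x\<in>X. range x \<subseteq> A"
  using sft by (auto simp: sft_def)

lemma in_A: "x \<in> X \<Longrightarrow> x i \<in> A"
  using XA by auto

text \<open>The one-step property glues overlapping 2-words into words of the language of any
  length, and no such word is forbidden. Membership thus becomes a condition on adjacent symbols,
  whatever the lengths of the forbidden words.\<close>

lemma mem_iff_two_blocks:
  "x \<in> X \<longleftrightarrow> (\<forall>i. \<exists>z\<in>X. \<exists>j. x i = z j \<and> x (i + 1) = z (j + 1))"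
proof
  assume R: "\<forall>i. \<exists>z\<in>X. \<exists>j. x i = z j \<and> x (i + 1) = z (j + 1)"
  have two: "[x i, x (i + 1)] \<in> language X" for i
  proof -
    obtain z j where "z \<in> X" "x i = z j" "x (i + 1) = z (j + 1)" using R by blast
    then have "[x i, x (i + 1)] = block z j 2" by (simp add: block_def upt_rec)
    then show ?thesis using \<open>z \<in> X\<close> by (auto simp: language_def)
  qed
  have blocks: "block x i n \<in> language X" for i n
  proof (induction n)
    case 0
    obtain z where "z \<in> X" using ne by blast
    moreover have "block x i 0 = block z 0 0" by (simp add: block_def)
    ultimately show ?case unfolding language_def by blast
  next
    case (Suc n)
    show ?case
    proof (cases n)
      case 0
      obtain z j where "z \<in> X" "x i = z j" using R by blast
      then have "block x i (Suc n) = block z j 1" using 0 by (simp add: block_def)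
      then show ?thesis using \<open>z \<in> X\<close> by (auto simp: language_def)
    next
      case (Suc m)
      define u where "u = block x i m"
      let ?a = "x (i + int m)" and ?b = "x (i + int m + 1)"
      have "u @ [?a] \<in> language X" using Suc.IH Suc by (simp add: u_def block_def)
      moreover have "[?a] @ [?b] \<in> language X" using two[of "i + int m"] by simp
      moreover have "length [?a] = 1" by simp
      ultimately have "u @ [?a] @ [?b] \<in> language X"
        using one_step unfolding one_step_def by blast
      moreover have "block x i (Suc n) = u @ [?a] @ [?b]" using Suc by (simp add: u_def block_def add_ac)
      ultimately show ?thesis by simp
    qed
  qed
  obtain F where F: "F \<subseteq> lists A" "X = {x. range x \<subseteq> A \<and> (\<forall>w\<in>F. \<forall>i. block x i (length w) \<noteq> w)}"
    using sft unfolding sft_def by blast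
  have "x i \<in> A" for i
  proof -
    obtain z j where "z \<in> X" "x i = z j" using R by blast
    then show ?thesis using in_A by auto
  qed
  moreover have "block x i (length w) \<noteq> w" if "w \<in> F" for w i
  proof
    assume w: "block x i (length w) = w"
    then obtain z j n where z: "z \<in> X" "w = block z j n" using blocks[of i "length w"] by (auto simp: language_def)
    then have "n = length w" by simp
    then have "block z j (length w) = w" using z by simp
    moreover have "z \<in> {x. range x \<subseteq> A \<and> (\<forall>w\<in>F. \<forall>i. block x i (length w) \<noteq> w)}"
      using z F(2) by blast
    ultimately show False using that by blast
  qed
  ultimately show "x \<in> X" using F(2) by blast
qed blast

lemma shift_mem: "x \<in> X \<Longrightarrow> (\<lambda>i. x (i + k)) \<in> X"
  by (subst mem_iff_two_blocks) (metis add.assoc add.commute)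

lemma splice_mem:
  assumes "x \<in> X" "z \<in> X" "x n = z n"
  shows "(\<lambda>i. if i \<le> n then x i else z i) \<in> X"
proof (subst mem_iff_two_blocks, rule allI)
  fix i
  show "\<exists>y\<in>X. \<exists>j. (if i \<le> n then x i else z i) = y j \<and> (if i + 1 \<le> n then x (i + 1) else z (i + 1)) = y (j + 1)"
  proof (cases "i + 1 \<le> n")
    case True then show ?thesis using assms by (intro bexI[of _ x] exI[of _ i]) auto
  next
    case False then show ?thesis using assms by (intro bexI[of _ z] exI[of _ i]) (auto dest: order_antisym)
  qed
qed

lemma finite_block_states: "finite (block_states X N)"
proof (rule finite_subset)
  show "block_states X N \<subseteq> {u. set u \<subseteq> A \<and> length u = N}"
    using in_A by (auto simp: block_states_def block_def)
  show "finite {u. set u \<subseteq> A \<and> length u = N}" by (rule finite_lists_length_eq[OF fin])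
qed

text \<open>Successive blocks on a path overlap in all but one symbol, so the heads of the blocks
  carry the whole path; bi-infinite paths in the block graph are the points of
  \<open>X\<close>.\<close>

lemma path_point:
  assumes N: "0 < N" and s: "\<And>i. (s i, s (i + 1)) \<in> block_edges X N"
  shows "(\<lambda>i. hd (s i)) \<in> X" "block (\<lambda>i. hd (s i)) i N = s i"
proof -
  have ex: "\<exists>z\<in>X. \<exists>j. s i = block z j N \<and> s (i + 1) = block z (j + 1) N" for i
    using s[of i] by (auto simp: block_edges_def)
  show "(\<lambda>i. hd (s i)) \<in> X"
    using ex N by (subst mem_iff_two_blocks) (metis hd_block)
  have len: "length (s i) = N" for i using ex[of i] by auto
  have overlap: "s i ! Suc k = s (i + 1) ! k" if "Suc k < N" for i k
  proof -
    obtain z j where "s i = block z j N" "s (i + 1) = block z (j + 1) N" using ex by blast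
    then show ?thesis using that by (simp add: add_ac)
  qed
  have "s i ! k = hd (s (i + int k))" if "k < N" for i k
    using that
  proof (induction k arbitrary: i)
    case 0
    then show ?case using len[of i] by (subst hd_conv_nth) auto
  next
    case (Suc k)
    then have "s i ! Suc k = s (i + 1) ! k" using overlap by simp
    also have "\<dots> = hd (s (i + 1 + int k))" using Suc by simp
    finally show ?case by (simp add: add_ac)
  qed
  then show "block (\<lambda>i. hd (s i)) i N = s i" using len by (auto simp: list_eq_iff_nth_eq)
qed

lemma mixing_irreducible:
  assumes mix: "mixing X" and uv: "u \<in> block_states X N" "v \<in> block_states X N"
  shows "(u, v) \<in> (block_edges X N)\<^sup>*"
proof -
  have "u \<in> language X" "v \<in> language X" using uv by (auto simp: block_states_def language_def)
  then obtain w where "u @ w @ v \<in> language X" using mix unfolding mixing_def by blast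
  then obtain x i n where x: "x \<in> X" "u @ w @ v = block x i n" by (auto simp: language_def)
  have len: "length u = N" "length v = N" using uv by (auto simp: block_states_def)
  have n: "n = N + length w + N" using arg_cong[OF x(2), of length] len by simp
  have u: "u = block x i N"
  proof (rule nth_equalityI)
    fix k assume k: "k < length u"
    have "u ! k = (u @ w @ v) ! k" using k by (simp add: nth_append)
    then show "u ! k = block x i N ! k" using k len n unfolding x(2) by simp
  qed (use len in simp)
  have v: "v = block x (i + int (N + length w)) N"
  proof (rule nth_equalityI)
    fix k assume k: "k < length v"
    have "v ! k = (u @ w @ v) ! (N + length w + k)" using k len by (simp add: nth_append)
    then show "v ! k = block x (i + int (N + length w)) N ! k" using k len n unfolding x(2) by (simp add: add_ac)
  qed (use len in simp)
  have "(block x i N, block x (i + int k) N) \<in> (block_edges X N)\<^sup>*" for k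
  proof (induction k)
    case (Suc k)
    have "(block x (i + int k) N, block x (i + int (Suc k)) N) \<in> block_edges X N"
      using block_edgesI[OF x(1), of "i + int k" N] by (simp add: add_ac)
    then show ?case using Suc by (meson rtrancl.rtrancl_into_rtrancl)
  qed simp
  from this[of "N + length w"] show ?thesis unfolding u[symmetric] v[symmetric] .
qed

end

section \<open>Markov measures on one-step shifts\<close>

lemma (in one_step_sft) continuous_shift_map: "continuous_map (shift_topology A X) (shift_topology A X) shift_map"
proof (rule continuous_map_shift_topology[OF XA XA])
  fix i :: int
  have "i + 1 \<in> {- int (nat (\<bar>i\<bar> + 1))..int (nat (\<bar>i\<bar> + 1))}" by auto
  then show "\<exists>n. \<forall>x\<in>X. \<forall>x'\<in>X. (\<forall>j\<in>{- int n..int n}. x' j = x j) \<longrightarrow> shift_map x' i = shift_map x i"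
    unfolding shift_map_def by blast
qed (use shift_mem in \<open>auto simp: shift_map_def\<close>)

text \<open>The stationary process on blocks is read as a random point of \<open>X\<close> through
  the heads of its blocks. Shift invariance needs checking on windows only, where it is visible from
  the product formula.\<close>

lemma (in one_step_sft) block_measure_exists:
  assumes N: "0 < N"
    and P: "stochastic_matrix (block_states X N) P"
    and PE: "\<And>u v. (u, v) \<notin> block_edges X N \<Longrightarrow> P u v = 0"
    and p: "probability_vector (block_states X N) p" "\<And>v. v \<in> block_states X N \<Longrightarrow> 0 < p v"
      "\<And>w. w \<in> block_states X N \<Longrightarrow> (\<Sum>v\<in>block_states X N. p v * P v w) = p w"
  shows "\<exists>\<mu>. invariant_measure A X \<mu> \<and> (\<forall>l n. \<forall>x\<in>X. measure \<mu> (window X N l n x)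
     = p (block x (- int l) N) * (\<Prod>i\<in>{- int l..<int n}. P (block x i N) (block x (i + 1) N)))"
proof -
  obtain M :: "(int \<times> 'a list \<Rightarrow> 'a list) measure" and \<xi> where M: "prob_space M"
    and xi: "\<forall>\<omega>\<in>space M. \<forall>i. (\<xi> \<omega> i, \<xi> \<omega> (i + 1)) \<in> block_edges X N"
    and meas: "\<forall>i s. {\<omega>\<in>space M. \<xi> \<omega> i = s} \<in> sets M"
    and cyl: "\<forall>w l n. w 0 \<in> block_states X N \<longrightarrow> (\<forall>i\<in>{- int l..<int n}. (w i, w (i + 1)) \<in> block_edges X N) \<longrightarrow>
       measure M {\<omega>\<in>space M. \<forall>i\<in>{- int l..int n}. \<xi> \<omega> i = w i}
         = p (w (- int l)) * (\<Prod>i\<in>{- int l..<int n}. P (w i) (w (i + 1)))"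
    using stationary_process_exists[OF finite_block_states block_edges_subset P PE p] by auto
  interpret M: prob_space M by fact
  define \<Psi> where "\<Psi> \<omega> = (\<lambda>i. hd (\<xi> \<omega> i))" for \<omega>
  have Psi: "\<Psi> \<omega> \<in> X" "block (\<Psi> \<omega>) i N = \<xi> \<omega> i" if "\<omega> \<in> space M" for \<omega> i
    using path_point[OF N, of "\<xi> \<omega>"] bspec[OF xi that] by (auto simp: \<Psi>_def)
  have measPsi: "\<Psi> \<in> measurable M (shift_borel A X)"
  proof (rule measurable_shift_borelI[OF fin XA Psi(1)])
    fix i a
    have "{\<omega> \<in> space M. \<Psi> \<omega> i = a} = (\<Union>u\<in>{u\<in>block_states X N. hd u = a}. {\<omega>\<in>space M. \<xi> \<omega> i = u})"
      using xi block_edges_subset by (fastforce simp: \<Psi>_def)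
    also have "\<dots> \<in> sets M" using finite_block_states[of N] meas by (intro sets.finite_UN) auto
    finally show "{\<omega> \<in> space M. \<Psi> \<omega> i = a} \<in> sets M" .
  qed
  define \<mu> where "\<mu> = distr M (shift_borel A X) \<Psi>"
  have mu: "prob_space \<mu>" "sets \<mu> = sets (shift_borel A X)"
    unfolding \<mu>_def by (auto intro: M.prob_space_distr measPsi)
  have win: "window X N l n x \<in> sets (shift_borel A X)" for l n x
    by (intro shift_borel_openI openin_window[OF XA])
  have form: "measure \<mu> (window X N l n x)
     = p (block x (- int l) N) * (\<Prod>i\<in>{- int l..<int n}. P (block x i N) (block x (i + 1) N))"
    if x: "x \<in> X" for l n x
  proof -
    have "measure \<mu> (window X N l n x) = measure M (\<Psi> -` window X N l n x \<inter> space M)"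
      unfolding \<mu>_def by (rule measure_distr[OF measPsi win])
    also have "\<Psi> -` window X N l n x \<inter> space M = {\<omega>\<in>space M. \<forall>i\<in>{- int l..int n}. \<xi> \<omega> i = block x i N}"
      using Psi by (auto simp: window_def)
    finally show ?thesis using spec[OF spec[OF spec[OF cyl, of "\<lambda>i. block x i N"], of l], of n] x by (simp add: block_edgesI block_statesI)
  qed
  have meas_shift: "shift_map \<in> measurable \<mu> (shift_borel A X)"
    using measurable_shift_borel_continuous[OF XA continuous_shift_map] mu(2)
    by (simp cong: measurable_cong_sets)
  have "distr \<mu> (shift_borel A X) shift_map = \<mu>"
  proof (rule shift_borel_measure_eqI[OF fin XA N _ _ mu])
    show "prob_space (distr \<mu> (shift_borel A X) shift_map)"
      using mu(1) meas_shift by (rule prob_space.prob_space_distr)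
    fix n :: nat and x assume n: "1 \<le> n" and x: "x \<in> X"
    \<comment> \<open>The shift-preimage of a window of \<open>x\<close> is a window of
      \<open>x1\<close> reaching one less to the left and one more to the right; this uses
      \<open>1 \<le> n\<close>.\<close>
    define x1 where "x1 = (\<lambda>i. x (i + (- 1)))"
    have x1: "x1 \<in> X" unfolding x1_def by (rule shift_mem[OF x])
    have b1: "block x1 i N = block x (i - 1) N" for i
      unfolding x1_def block_shift by simp
    have "space \<mu> = X" using sets_eq_imp_space_eq[OF mu(2)] space_shift_borel[OF XA] by simp
    then have "measure (distr \<mu> (shift_borel A X) shift_map) (window X N n n x)
        = measure \<mu> (shift_map -` window X N n n x \<inter> X)"
      using measure_distr[OF meas_shift win] by simp
    also have "shift_map -` window X N n n x \<inter> X = window X N (n - 1) (n + 1) x1"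
    proof -
      have "(\<forall>i\<in>{- int n..int n}. block x' (i + 1) N = block x i N) \<longleftrightarrow>
          (\<forall>i\<in>{- int (n - 1)..int (n + 1)}. block x' i N = block x (i - 1) N)" (is "?L \<longleftrightarrow> ?R") for x'
      proof
        assume L: ?L show ?R
        proof
          fix i assume "i \<in> {- int (n - 1)..int (n + 1)}"
          then have "i - 1 \<in> {- int n..int n}" using n by auto
          from bspec[OF L this] show "block x' i N = block x (i - 1) N" by simp
        qed
      next
        assume R: ?R show ?L
        proof
          fix i assume "i \<in> {- int n..int n}"
          then have "i + 1 \<in> {- int (n - 1)..int (n + 1)}" using n by auto
          from bspec[OF R this] show "block x' (i + 1) N = block x i N" by simp
        qed
      qed
      then show ?thesis
        using shift_mem[of _ 1] unfolding window_def b1 shift_map_def by (auto simp: block_shift)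
    qed
    also have "measure \<mu> \<dots> = p (block x (- int n) N) *
        (\<Prod>i\<in>{- int (n - 1)..<int (n + 1)}. P (block x (i - 1) N) (block x i N))"
      using form[OF x1, of "n - 1" "n + 1"] n by (simp add: b1 of_nat_diff)
    also have "(\<Prod>i\<in>{- int (n - 1)..<int (n + 1)}. P (block x (i - 1) N) (block x i N))
        = (\<Prod>i\<in>{- int n..<int n}. P (block x i N) (block x (i + 1) N))"
      by (rule prod.reindex_bij_witness[of _ "\<lambda>i. i + 1" "\<lambda>i. i - 1"]) (use n in auto)
    finally show "measure (distr \<mu> (shift_borel A X) shift_map) (window X N n n x) = measure \<mu> (window X N n n x)"
      by (simp add: form[OF x])
  qed simp
  then have "invariant_measure A X \<mu>" using mu by (simp add: invariant_measure_def)
  then show ?thesis using form by blast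
qed

lemma (in one_step_sft) fully_supported_window:
  assumes N: "0 < N" and mu: "invariant_measure A X \<mu>"
    and pos: "\<And>n x. x \<in> X \<Longrightarrow> 0 < measure \<mu> (window X N n n x)"
  shows "fully_supported X \<mu>"
  unfolding fully_supported_def
proof (intro allI impI)
  fix w i assume "cylinder X w i \<noteq> {}"
  then obtain x where x: "x \<in> X" "block x i (length w) = w" by (auto simp: cylinder_def)
  define n where "n = nat \<bar>i\<bar> + length w"
  interpret prob_space \<mu> using mu by (simp add: invariant_measure_def)
  have "window X N n n x \<subseteq> cylinder X w i"
  proof
    fix x' assume x': "x' \<in> window X N n n x"
    have "x' (i + int k) = x (i + int k)" if "k < length w" for k
    proof -
      have "i + int k \<in> {- int n..int n}" using that by (auto simp: n_def)
      then have "block x' (i + int k) N = block x (i + int k) N"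
        using x' unfolding window_def by blast
      then show ?thesis using N by (metis hd_block)
    qed
    then have "block x' i (length w) = block x i (length w)" by (simp add: block_eq_iff)
    then show "x' \<in> cylinder X w i" using x x' by (simp add: cylinder_def window_def)
  qed
  moreover have "cylinder X w i \<in> sets \<mu>"
  proof -
    have "cylinder X w i = {x\<in>X. (\<lambda>s. s i = w) (\<lambda>j. if j \<in> {i..i} then block x j (length w) else [])}"
      by (auto simp: cylinder_def)
    then show ?thesis
      using openin_block_condition[OF XA, where Q = "\<lambda>s. s i = w" and l = i and n = i and N = "length w"] mu
      by (auto simp: invariant_measure_def intro: shift_borel_openI)
  qed
  ultimately have "measure \<mu> (window X N n n x) \<le> measure \<mu> (cylinder X w i)"
    by (rule finite_measure_mono)
  then show "0 < measure \<mu> (cylinder X w i)" using pos[OF x(1), of n] by linarith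
qed

text \<open>The \<open>N\<close>-block code is a conjugacy onto the paths of the block graph, and
  there the window formula is the cylinder formula of a one-step Markov measure.\<close>

lemma (in one_step_sft) markov_measure_window:
  assumes N: "0 < N" and mu: "invariant_measure A X \<mu>"
    and P: "stochastic_matrix (block_states X N) P" and p: "probability_vector (block_states X N) p"
    and form: "\<And>l n x. x \<in> X \<Longrightarrow> measure \<mu> (window X N l n x)
     = p (block x (- int l) N) * (\<Prod>i\<in>{- int l..<int n}. P (block x i N) (block x (i + 1) N))"
  shows "markov_measure A X \<mu>"
proof -
  define S where "S = block_states X N"
  define E where "E = block_edges X N"
  have finS: "finite S" unfolding S_def by (rule finite_block_states)
  \<comment> \<open>The definition of a Markov measure asks for an alphabet of naturals, so blocks
    are numbered.\<close>
  obtain code :: "'a list \<Rightarrow> nat" where code: "inj_on code S"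
    using finite_imp_inj_to_nat_seg[OF finS] by blast
  define dec where "dec = the_inv_into S code"
  have dec: "dec (code u) = u" if "u \<in> S" for u
    unfolding dec_def by (rule the_inv_into_f_f[OF code that])
  define B where "B = code ` S"
  define \<phi> where "\<phi> x = (\<lambda>i. code (block x i N))" for x
  define Z where "Z = \<phi> ` X"
  have finB: "finite B" using finS by (simp add: B_def)
  have bS: "block x i N \<in> S" if "x \<in> X" for x i using that by (simp add: S_def block_statesI)
  have ZB: "\<forall>z\<in>Z. range z \<subseteq> B" using bS by (auto simp: Z_def \<phi>_def B_def)
  have sftZ: "sft B Z"
  proof -
    define F where "F = {[c, d] | c d. c \<in> B \<and> d \<in> B \<and> (dec c, dec d) \<notin> E}"
    have "F \<subseteq> (\<lambda>(c, d). [c, d]) ` (B \<times> B)" by (auto simp: F_def)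
    then have "finite F" by (rule finite_subset) (use finB in auto)
    moreover have "F \<subseteq> lists B" by (auto simp: F_def)
    moreover have "Z = {z. range z \<subseteq> B \<and> (\<forall>w\<in>F. \<forall>i. block z i (length w) \<noteq> w)}"
    proof (rule equalityI; rule subsetI)
      fix z assume z: "z \<in> Z"
      then obtain x where x: "x \<in> X" "z = \<phi> x" by (auto simp: Z_def)
      have "block z i (length w) \<noteq> w" if w: "w \<in> F" for w i
      proof
        assume eq: "block z i (length w) = w"
        obtain c d where cd: "w = [c, d]" "(dec c, dec d) \<notin> E" using w by (auto simp: F_def)
        then have "c = z i" "d = z (i + 1)" using eq by (auto simp: block_def upt_rec)
        then show False using cd x bS dec by (simp add: \<phi>_def E_def block_edgesI)
      qed
      then show "z \<in> {z. range z \<subseteq> B \<and> (\<forall>w\<in>F. \<forall>i. block z i (length w) \<noteq> w)}" using z ZB by blast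
    next
      fix z assume z: "z \<in> {z. range z \<subseteq> B \<and> (\<forall>w\<in>F. \<forall>i. block z i (length w) \<noteq> w)}"
      have edge: "(dec (z i), dec (z (i + 1))) \<in> E" for i
      proof (rule ccontr)
        assume "(dec (z i), dec (z (i + 1))) \<notin> E"
        then have "[z i, z (i + 1)] \<in> F" using z by (auto simp: F_def)
        moreover have "block z i (length [z i, z (i + 1)]) = [z i, z (i + 1)]"
          by (simp add: block_def upt_rec)
        ultimately show False using z by blast
      qed
      define x where "x = (\<lambda>i. hd (dec (z i)))"
      have x: "x \<in> X" "block x i N = dec (z i)" for i
        using path_point[OF N, of "\<lambda>i. dec (z i)"] edge unfolding x_def E_def by auto
      have "code (dec (z i)) = z i" for i
      proof -
        have "z i \<in> code ` S" using z by (auto simp: B_def)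
        then show ?thesis unfolding dec_def by (rule f_the_inv_into_f[OF code])
      qed
      then have "z = \<phi> x" using x by (auto simp: \<phi>_def)
      then show "z \<in> Z" using x by (auto simp: Z_def)
    qed
    ultimately show ?thesis unfolding sft_def by blast
  qed
  have cont: "continuous_map (shift_topology A X) (shift_topology B Z) \<phi>"
  proof (rule continuous_map_shift_topology[OF XA ZB])
    fix i
    define n where "n = nat \<bar>i\<bar> + N"
    have "\<phi> x' i = \<phi> x i" if *: "\<forall>j\<in>{- int n..int n}. x' j = x j" for x x'
    proof -
      have "x' (i + int k) = x (i + int k)" if "k < N" for k
        using that by (intro bspec[OF *]) (auto simp: n_def)
      then have "block x' i N = block x i N" by (simp add: block_eq_iff)
      then show ?thesis by (simp add: \<phi>_def)
    qed
    then show "\<exists>n. \<forall>x\<in>X. \<forall>x'\<in>X. (\<forall>j\<in>{- int n..int n}. x' j = x j) \<longrightarrow> \<phi> x' i = \<phi> x i" by blast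
  qed (auto simp: Z_def)
  define \<psi> where "\<psi> z = (\<lambda>i. hd (dec (z i)))" for z :: "int \<Rightarrow> nat"
  have psi: "\<psi> (\<phi> x) = x" if "x \<in> X" for x
    using that N by (simp add: \<psi>_def \<phi>_def dec bS hd_block)
  have phi: "\<phi> (\<psi> z) = z" "\<psi> z \<in> X" if "z \<in> Z" for z
    using that psi by (auto simp: Z_def)
  have cont': "continuous_map (shift_topology B Z) (shift_topology A X) \<psi>"
  proof (rule continuous_map_shift_topology[OF ZB XA phi(2)])
    fix i :: int
    have "\<psi> x' i = \<psi> x i" if *: "\<forall>j\<in>{- int (nat \<bar>i\<bar>)..int (nat \<bar>i\<bar>)}. x' j = x j" for x x'
    proof -
      have "x' i = x i" by (rule bspec[OF *]) auto
      then show ?thesis by (simp add: \<psi>_def)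
    qed
    then show "\<exists>n. \<forall>x\<in>Z. \<forall>x'\<in>Z. (\<forall>j\<in>{- int n..int n}. x' j = x j) \<longrightarrow> \<psi> x' i = \<psi> x i" by blast
  qed
  have "homeomorphic_maps (shift_topology A X) (shift_topology B Z) \<phi> \<psi>"
    unfolding homeomorphic_maps_def
    using cont cont' psi phi by (simp add: topspace_shift_topology[OF XA] topspace_shift_topology[OF ZB])
  moreover have equi: "\<phi> (shift_map x) = shift_map (\<phi> x)" for x
    by (simp add: \<phi>_def shift_map_def block_shift)
  ultimately have conj: "conjugacy A X B Z \<phi>"
    unfolding conjugacy_def homeomorphic_map_maps by blast
  define \<nu> where "\<nu> = distr \<mu> (shift_borel B Z) \<phi>"
  have sets_mu: "sets \<mu> = sets (shift_borel A X)" and prob: "prob_space \<mu>"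
    and inv: "distr \<mu> (shift_borel A X) shift_map = \<mu>"
    using mu by (auto simp: invariant_measure_def)
  have sp: "space \<mu> = X" using sets_eq_imp_space_eq[OF sets_mu] space_shift_borel[OF XA] by simp
  have mphi: "\<phi> \<in> measurable \<mu> (shift_borel B Z)"
    using measurable_shift_borel_continuous[OF XA cont] sets_mu by (simp cong: measurable_cong_sets)
  have mshift: "shift_map \<in> measurable \<mu> (shift_borel A X)"
    using measurable_shift_borel_continuous[OF XA continuous_shift_map] sets_mu by (simp cong: measurable_cong_sets)
  have mphi': "\<phi> \<in> measurable (shift_borel A X) (shift_borel B Z)"
    by (rule measurable_shift_borel_continuous[OF XA cont])
  have contZ: "continuous_map (shift_topology B Z) (shift_topology B Z) shift_map"
  proof (rule continuous_map_shift_topology[OF ZB ZB])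
    fix z assume "z \<in> Z"
    then obtain x where "x \<in> X" "z = \<phi> x" by (auto simp: Z_def)
    then have "shift_map x \<in> X" "shift_map z = \<phi> (shift_map x)"
      using shift_mem[of x 1] by (simp_all add: equi) (simp add: shift_map_def)
    then show "shift_map z \<in> Z" by (simp add: Z_def)
  next
    fix i :: int
    have "i + 1 \<in> {- int (nat (\<bar>i\<bar> + 1))..int (nat (\<bar>i\<bar> + 1))}" by auto
    then show "\<exists>n. \<forall>x\<in>Z. \<forall>x'\<in>Z. (\<forall>j\<in>{- int n..int n}. x' j = x j) \<longrightarrow> shift_map x' i = shift_map x i"
      unfolding shift_map_def by blast
  qed
  have mshiftZ: "shift_map \<in> measurable (shift_borel B Z) (shift_borel B Z)"
    by (rule measurable_shift_borel_continuous[OF ZB contZ])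
  have invnu: "invariant_measure B Z \<nu>"
    unfolding invariant_measure_def
  proof (intro conjI)
    show "prob_space \<nu>" unfolding \<nu>_def using prob mphi by (rule prob_space.prob_space_distr)
    show "sets \<nu> = sets (shift_borel B Z)" by (simp add: \<nu>_def)
    have "distr \<nu> (shift_borel B Z) shift_map = distr \<mu> (shift_borel B Z) (shift_map \<circ> \<phi>)"
      unfolding \<nu>_def by (rule distr_distr[OF mshiftZ mphi])
    also have "shift_map \<circ> \<phi> = \<phi> \<circ> shift_map" by (auto simp: equi)
    also have "distr \<mu> (shift_borel B Z) (\<phi> \<circ> shift_map) = distr (distr \<mu> (shift_borel A X) shift_map) (shift_borel B Z) \<phi>"
      by (rule distr_distr[OF mphi' mshift, symmetric])
    finally show "distr \<nu> (shift_borel B Z) shift_map = \<nu>" by (simp add: inv \<nu>_def)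
  qed
  define p' where "p' c = p (dec c)" for c
  define P' where "P' c d = P (dec c) (dec d)" for c d
  have sumB: "(\<Sum>c\<in>B. h (dec c)) = (\<Sum>u\<in>S. h u)" for h :: "'a list \<Rightarrow> real"
    unfolding B_def by (subst sum.reindex[OF code]) (simp add: dec)
  have decS: "dec c \<in> S" if "c \<in> B" for c using that dec by (auto simp: B_def)
  have "probability_vector B p'"
    using p sumB[of p] decS by (auto simp: probability_vector_def p'_def S_def)
  moreover have "stochastic_matrix B P'"
    using P sumB decS by (auto simp: stochastic_matrix_def probability_vector_def P'_def S_def)
  moreover have "measure \<nu> (cylinder Z w 0) = p' (w ! 0) * (\<Prod>i<length w - 1. P' (w ! i) (w ! Suc i))"
    if w: "w \<in> language Z" "w \<noteq> []" for w
  proof -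
    obtain x0 i n0 where x0: "x0 \<in> X" "w = block (\<phi> x0) i n0" using w by (auto simp: language_def Z_def)
    \<comment> \<open>A word of the language may occur at any position; recentring at 0 makes its
      cylinder a window with left end 0.\<close>
    define x where "x = (\<lambda>j. x0 (j + i))"
    have x: "x \<in> X" unfolding x_def by (rule shift_mem[OF x0(1)])
    define n where "n = length w - 1"
    have n0: "n0 = Suc n" using w x0 by (cases n0) (auto simp: n_def block_def)
    have wk: "w ! k = code (block x (int k) N)" if "k \<le> n" for k
      using that n0 x0(2) by (simp add: \<phi>_def x_def block_shift add_ac)
    have lw: "length w = Suc n" using x0 n0 by simp
    have "cylinder Z w 0 \<in> sets (shift_borel B Z)"
    proof -
      have "cylinder Z w 0 = {x\<in>Z. (\<lambda>s. s 0 = w) (\<lambda>j. if j \<in> {0..0} then block x j (length w) else [])}"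
        by (auto simp: cylinder_def)
      then show ?thesis
        using openin_block_condition[OF ZB, where Q = "\<lambda>s. s 0 = w" and l = 0 and n = 0 and N = "length w"]
        by (auto intro: shift_borel_openI)
    qed
    then have "measure \<nu> (cylinder Z w 0) = measure \<mu> (\<phi> -` cylinder Z w 0 \<inter> X)"
      unfolding \<nu>_def using measure_distr[OF mphi] sp by metis
    also have "\<phi> -` cylinder Z w 0 \<inter> X = window X N 0 n x"
    proof -
      have "block (\<phi> x') 0 (length w) = w \<longleftrightarrow> (\<forall>i\<in>{- int 0..int n}. block x' i N = block x i N)"
        if x': "x' \<in> X" for x'
      proof -
        have "block (\<phi> x') 0 (length w) = w \<longleftrightarrow> (\<forall>k\<le>n. code (block x' (int k) N) = code (block x (int k) N))"
          by (auto simp: list_eq_iff_nth_eq lw wk less_Suc_eq_le \<phi>_def)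
        also have "\<dots> \<longleftrightarrow> (\<forall>k\<le>n. block x' (int k) N = block x (int k) N)"
          using bS[OF x'] bS[OF x] code by (auto simp: inj_on_eq_iff)
        also have "\<dots> \<longleftrightarrow> (\<forall>i\<in>{- int 0..int n}. block x' i N = block x i N)"
        proof
          assume L: "\<forall>k\<le>n. block x' (int k) N = block x (int k) N"
          show "\<forall>i\<in>{- int 0..int n}. block x' i N = block x i N"
          proof
            fix i assume "i \<in> {- int 0..int n}"
            then have "nat i \<le> n" "int (nat i) = i" by auto
            then show "block x' i N = block x i N" using L by metis
          qed
        qed auto
        finally show ?thesis .
      qed
      then show ?thesis by (auto simp: cylinder_def window_def Z_def)
    qed
    also have "measure \<mu> (window X N 0 n x) = p (block x 0 N) * (\<Prod>i\<in>{0..<int n}. P (block x i N) (block x (i + 1) N))"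
      using form[OF x, of 0 n] by simp
    also have "(\<Prod>i\<in>{0..<int n}. P (block x i N) (block x (i + 1) N)) = (\<Prod>k<n. P (block x (int k) N) (block x (int k + 1) N))"
      by (rule prod.reindex_bij_witness[of _ int nat]) auto
    also have "\<dots> = (\<Prod>k<n. P' (w ! k) (w ! Suc k))"
      by (intro prod.cong) (auto simp: P'_def wk dec bS[OF x] add_ac)
    also have "p (block x 0 N) = p' (w ! 0)" by (simp add: p'_def wk dec bS[OF x])
    finally show ?thesis by (simp add: n_def)
  qed
  ultimately have "one_step_markov B Z \<nu>" using invnu unfolding one_step_markov_def by blast
  then show ?thesis
    unfolding markov_measure_def using mu finB sftZ conj \<nu>_def by blast
qed

text \<open>Splitting by the next state turns the event into disjoint pieces whose measures obey the
  recursion of \<open>path_weight\<close>, the Markov property being contained in the product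
  formula.\<close>

lemma (in one_step_sft) measure_paths_in:
  assumes N: "0 < N" and mu: "invariant_measure A X \<mu>" and F: "F \<subseteq> block_edges X N"
    and form: "\<And>l n x. x \<in> X \<Longrightarrow> measure \<mu> (window X N l n x)
     = p (block x (- int l) N) * (\<Prod>i\<in>{- int l..<int n}. P (block x i N) (block x (i + 1) N))"
  shows "measure \<mu> {x\<in>X. \<forall>j\<in>{0..<int m}. (block x j N, block x (j + 1) N) \<in> F}
    = (\<Sum>v\<in>block_states X N. p v * path_weight F P (\<lambda>_. 1) m v)"
proof -
  interpret prob_space \<mu> using mu by (simp add: invariant_measure_def)
  have sets_mu: "sets \<mu> = sets (shift_borel A X)" using mu by (simp add: invariant_measure_def)
  define S where "S = block_states X N"
  have finS: "finite S" unfolding S_def by (rule finite_block_states)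
  have FS: "F \<subseteq> S \<times> S" using F block_edges_subset unfolding S_def by blast
  have finF: "finite (F `` {v})" for v
    by (rule finite_subset[OF _ finS]) (use FS in auto)
  \<comment> \<open>Past fixed up to time \<open>l\<close>, then \<open>m\<close> free steps along
    \<open>F\<close>. In the induction on \<open>m\<close> each step moves one time unit from the
    future to the past, so \<open>l\<close> and \<open>x\<close> must stay general.\<close>
  define G where "G l m x = {x'\<in>X. (\<forall>i\<in>{0..int l}. block x' i N = block x i N) \<and>
      (\<forall>j\<in>{int l..<int (l + m)}. (block x' j N, block x' (j + 1) N) \<in> F)}" for l m x
  have Gsets: "G l m x \<in> sets \<mu>" for l m x
  proof -
    have "G l m x = {x'\<in>X. (\<lambda>s. (\<forall>i\<in>{0..int l}. s i = block x i N) \<and>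
        (\<forall>j\<in>{int l..<int (l + m)}. (s j, s (j + 1)) \<in> F)) (\<lambda>j. if j \<in> {0..int (l + m)} then block x' j N else [])}"
      by (auto simp: G_def)
    then show ?thesis unfolding sets_mu
      using openin_block_condition[OF XA, where Q = "\<lambda>s. (\<forall>i\<in>{0..int l}. s i = block x i N) \<and>
        (\<forall>j\<in>{int l..<int (l + m)}. (s j, s (j + 1)) \<in> F)" and l = 0 and n = "int (l + m)" and N = N]
      by (auto intro: shift_borel_openI)
  qed
  have G0: "G l 0 x = window X N 0 l x" for l x by (auto simp: G_def window_def)
  have main: "measure \<mu> (G l m x) = measure \<mu> (window X N 0 l x) * path_weight F P (\<lambda>_. 1) m (block x (int l) N)"
    if "x \<in> X" for l m x
    using that
  proof (induction m arbitrary: l x)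
    case 0
    then show ?case by (simp add: G0)
  next
    case (Suc m)
    define v where "v = block x (int l) N"
    \<comment> \<open>Every edge at the last state continues the given past: the path of
      \<open>x\<close> is spliced with that of a point \<open>z\<close> in which the edge
      occurs.\<close>
    have "\<exists>y\<in>X. (\<forall>i\<in>{0..int l}. block y i N = block x i N) \<and> block y (int l + 1) N = w" if w: "(v, w) \<in> F" for w
    proof -
      obtain z i where z: "z \<in> X" "v = block z i N" "w = block z (i + 1) N"
        using w F by (auto simp: block_edges_def)
      define s where "s j = (if j \<le> int l then block x j N else block z (i + (j - int l)) N)" for j
      have "(s j, s (j + 1)) \<in> block_edges X N" for j
      proof -
        consider "j < int l" | "j = int l" | "int l < j" by linarith
        then show ?thesis
        proof cases
          case 1 then show ?thesis using block_edgesI[OF Suc.prems] by (simp add: s_def)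
        next
          case 2
          then have "s j = block z i N" "s (j + 1) = block z (i + 1) N"
            using z by (auto simp: s_def v_def)
          then show ?thesis using block_edgesI[OF z(1)] by simp
        next
          case 3 then show ?thesis using block_edgesI[OF z(1), of "i + (j - int l)" N]
            by (simp add: s_def algebra_simps)
        qed
      qed
      note pp = path_point[where s = s, OF N this]
      show ?thesis using pp z by (intro bexI[OF _ pp(1)]) (auto simp: s_def)
    qed
    then obtain e where e: "\<And>w. (v, w) \<in> F \<Longrightarrow> e w \<in> X"
      "\<And>w i. (v, w) \<in> F \<Longrightarrow> i \<in> {0..int l} \<Longrightarrow> block (e w) i N = block x i N"
      "\<And>w. (v, w) \<in> F \<Longrightarrow> block (e w) (int l + 1) N = w"
      by metis
    have decomp: "G l (Suc m) x = (\<Union>w\<in>F `` {v}. G (Suc l) m (e w))"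
    proof (rule equalityI; rule subsetI)
      fix x' assume x': "x' \<in> G l (Suc m) x"
      define w where "w = block x' (int l + 1) N"
      have "block x' (int l) N = v" using x' by (auto simp: G_def v_def)
      moreover have "int l \<in> {int l..<int (l + Suc m)}" by simp
      then have "(block x' (int l) N, block x' (int l + 1) N) \<in> F" using x' unfolding G_def by blast
      ultimately have vw: "(v, w) \<in> F" by (simp add: w_def)
      have "block x' i N = block (e w) i N" if "i \<in> {0..int (Suc l)}" for i
      proof (cases "i = int l + 1")
        case True then show ?thesis using e(3)[OF vw] by (simp add: w_def)
      next
        case False
        then have "i \<in> {0..int l}" using that by auto
        then show ?thesis using e(2)[OF vw] x' by (simp add: G_def)
      qed
      then have "x' \<in> G (Suc l) m (e w)" using x' by (simp add: G_def)
      then show "x' \<in> (\<Union>w\<in>F `` {v}. G (Suc l) m (e w))" using vw by auto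
    next
      fix x' assume "x' \<in> (\<Union>w\<in>F `` {v}. G (Suc l) m (e w))"
      then obtain w where vw: "(v, w) \<in> F" and x': "x' \<in> G (Suc l) m (e w)" by auto
      have b: "block x' i N = block x i N" if "i \<in> {0..int l}" for i
        using x' e(2)[OF vw that] that by (simp add: G_def)
      have "block x' (int l + 1) N = w" using x' e(3)[OF vw] by (simp add: G_def)
      then have "(block x' (int l) N, block x' (int l + 1) N) \<in> F" using b[of "int l"] vw by (simp add: v_def)
      moreover have "(block x' j N, block x' (j + 1) N) \<in> F" if "j \<in> {int (Suc l)..<int (Suc l + m)}" for j
        using x' that by (simp add: G_def)
      ultimately have "(block x' j N, block x' (j + 1) N) \<in> F" if "j \<in> {int l..<int (l + Suc m)}" for j
        using that by (cases "j = int l") auto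
      then show "x' \<in> G l (Suc m) x" using b x' by (simp add: G_def)
    qed
    have win: "measure \<mu> (window X N 0 (Suc l) (e w)) = measure \<mu> (window X N 0 l x) * P v w"
      if vw: "(v, w) \<in> F" for w
    proof -
      have "{- int 0..<int (Suc l)} = insert (int l) {- int 0..<int l}" by auto
      moreover have "(\<Prod>i\<in>{- int 0..<int l}. P (block (e w) i N) (block (e w) (i + 1) N))
          = (\<Prod>i\<in>{- int 0..<int l}. P (block x i N) (block x (i + 1) N))"
        using e(2)[OF vw] by (intro prod.cong) auto
      ultimately show ?thesis
        using form[OF e(1)[OF vw], of 0 "Suc l"] form[OF Suc.prems, of 0 l] e(2)[OF vw] e(3)[OF vw]
        by (simp add: v_def)
    qed
    have "measure \<mu> (G l (Suc m) x) = (\<Sum>w\<in>F `` {v}. measure \<mu> (G (Suc l) m (e w)))"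
      unfolding decomp
    proof (rule finite_measure_finite_Union)
      show "disjoint_family_on (\<lambda>w. G (Suc l) m (e w)) (F `` {v})"
      proof (unfold disjoint_family_on_def, intro ballI impI)
        fix w w' assume ww: "w \<in> F `` {v}" "w' \<in> F `` {v}" "w \<noteq> w'"
        have "block x' (int l + 1) N = u" if "x' \<in> G (Suc l) m (e u)" "u \<in> F `` {v}" for x' u
          using that e(3)[of u] by (simp add: G_def)
        then show "G (Suc l) m (e w) \<inter> G (Suc l) m (e w') = {}" using ww by blast
      qed
    qed (use finF Gsets in auto)
    also have "\<dots> = (\<Sum>w\<in>F `` {v}. measure \<mu> (window X N 0 l x) * (P v w * path_weight F P (\<lambda>_. 1) m w))"
    proof (rule sum.cong)
      fix w assume "w \<in> F `` {v}"
      then have vw: "(v, w) \<in> F" by simp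
      then show "measure \<mu> (G (Suc l) m (e w)) = measure \<mu> (window X N 0 l x) * (P v w * path_weight F P (\<lambda>_. 1) m w)"
        using Suc.IH[OF e(1)[OF vw], of "Suc l"] win[OF vw] e(3)[OF vw] by (simp add: add_ac)
    qed simp
    finally show ?case by (simp add: v_def sum_distrib_left)
  qed
  have "\<exists>y\<in>X. block y 0 N = v" if v: "v \<in> S" for v
  proof -
    obtain z i where "z \<in> X" "v = block z i N" using v by (auto simp: S_def block_states_def)
    then show ?thesis using shift_mem[of z i] by (intro bexI[of _ "\<lambda>j. z (j + i)"]) (auto simp: block_shift)
  qed
  then obtain e where e: "\<And>v. v \<in> S \<Longrightarrow> e v \<in> X" "\<And>v. v \<in> S \<Longrightarrow> block (e v) 0 N = v" by metis
  have "{x\<in>X. \<forall>j\<in>{0..<int m}. (block x j N, block x (j + 1) N) \<in> F} = (\<Union>v\<in>S. G 0 m (e v))"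
    using e by (auto simp: G_def S_def block_statesI)
  also have "measure \<mu> (\<Union>v\<in>S. G 0 m (e v)) = (\<Sum>v\<in>S. measure \<mu> (G 0 m (e v)))"
  proof (rule finite_measure_finite_Union)
    show "disjoint_family_on (\<lambda>v. G 0 m (e v)) S"
    proof (unfold disjoint_family_on_def, intro ballI impI)
      fix w w' assume ww: "w \<in> S" "w' \<in> S" "w \<noteq> w'"
      have "block x' 0 N = u" if "x' \<in> G 0 m (e u)" "u \<in> S" for x' u
        using that e(2)[of u] by (simp add: G_def)
      then show "G 0 m (e w) \<inter> G 0 m (e w') = {}" using ww by blast
    qed
  qed (use finS Gsets in auto)
  also have "\<dots> = (\<Sum>v\<in>S. p v * path_weight F P (\<lambda>_. 1) m v)"
    using main[of _ 0] e form[of _ 0 0] by (intro sum.cong) auto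
  finally show ?thesis by (simp add: S_def)
qed

section \<open>Right transitions in the block graph\<close>

text \<open>All phases \<open>j\<close> are put into one graph. When \<open>N\<close> is a period of
  \<open>y\<close>, a state over \<open>y\<close> determines its phase up to shifts leaving
  \<open>y\<close> unchanged, so paths cannot switch phase.\<close>

definition edges_over :: "('a \<Rightarrow> 'b) \<Rightarrow> (int \<Rightarrow> 'a) set \<Rightarrow> nat \<Rightarrow> (int \<Rightarrow> 'b) \<Rightarrow> ('a list \<times> 'a list) set" where
  "edges_over \<pi> X N y = {(u, v) \<in> block_edges X N. \<exists>j. map \<pi> u = block y j N \<and> map \<pi> v = block y (j + 1) N}"

lemma fiber_iff: "z \<in> fiber \<pi> X y \<longleftrightarrow> z \<in> X \<and> (\<forall>i. \<pi> (z i) = y i)"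
  by (auto simp: fiber_def one_block_def fun_eq_iff)

lemma map_block: "map \<pi> (block z i N) = block (\<lambda>i. \<pi> (z i)) i N"
  by (simp add: block_def)

lemma map_block_fiber: "z \<in> fiber \<pi> X y \<Longrightarrow> map \<pi> (block z i N) = block y i N"
  by (simp add: fiber_iff block_def)

lemma edges_over_fiber:
  "z \<in> fiber \<pi> X y \<Longrightarrow> (block z i N, block z (i + 1) N) \<in> edges_over \<pi> X N y"
  using map_block_fiber[of z \<pi> X y] by (auto simp: edges_over_def fiber_iff block_edgesI)

lemma edges_over_fiber_relpow:
  assumes "z \<in> fiber \<pi> X y"
  shows "(block z i N, block z (i + int d) N) \<in> edges_over \<pi> X N y ^^ d"
proof (induction d)
  case (Suc d)
  have "(block z (i + int d) N, block z (i + int (Suc d)) N) \<in> edges_over \<pi> X N y"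
    using edges_over_fiber[OF assms, of "i + int d" N] by (simp add: add_ac)
  then show ?case using Suc by auto
qed simp

lemma periodic_mod:
  assumes N: "0 < N" and y: "\<And>i. y (i + int N) = y i"
  shows "y (j + k mod int N) = y (j + k)"
proof -
  have pos: "y (i + int N * int q) = y i" for i q
  proof (induction q)
    case (Suc q)
    then show ?case using y[of "i + int N * int q"] by (simp add: algebra_simps)
  qed simp
  have "y (i + int N * q) = y i" for i q
    using pos[of i "nat q"] pos[of "i + int N * q" "nat (- q)"] by (cases "0 \<le> q") auto
  from this[of "j + k mod int N" "k div int N"] show ?thesis by (simp add: add_ac)
qed

lemma block_period_determines:
  assumes N: "0 < N" and y: "\<And>i. y (i + int N) = y i" and eq: "block y i N = block y j N"
  shows "y (i + k) = y (j + k)"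
proof -
  have "y (i + k mod int N) = y (j + k mod int N)"
  proof -
    have "nat (k mod int N) < N" "int (nat (k mod int N)) = k mod int N" using N by (auto simp: nat_less_iff)
    then show ?thesis using eq unfolding block_eq_iff by metis
  qed
  then show ?thesis using periodic_mod[where y = y, OF N y] by simp
qed

lemma edges_over_phase:
  assumes N: "0 < N" and y: "\<And>i. y (i + int N) = y i"
    and uv: "(u, v) \<in> edges_over \<pi> X N y" and u: "map \<pi> u = block y i N"
  shows "map \<pi> v = block y (i + 1) N"
proof -
  obtain j where j: "map \<pi> u = block y j N" "map \<pi> v = block y (j + 1) N"
    using uv by (auto simp: edges_over_def)
  have "y (j + k) = y (i + k)" for k
    using j u by (intro block_period_determines[where y = y, OF N y]) simp
  from this[of "1 + int _"] have "block y (j + 1) N = block y (i + 1) N"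
    by (simp add: block_eq_iff add.assoc)
  then show ?thesis using j by simp
qed

context one_step_sft
begin

text \<open>A correct phase at the single position \<open>j\<close> fixes it everywhere, since along
  edges over \<open>y\<close> the phase advances by exactly one.\<close>

lemma fiber_path_point:
  assumes N: "0 < N" and y: "\<And>i. y (i + int N) = y i"
    and s: "\<And>i. (s i, s (i + 1)) \<in> edges_over \<pi> X N y" and j: "map \<pi> (s j) = block y j N"
  shows "(\<lambda>i. hd (s i)) \<in> fiber \<pi> X y"
proof -
  have E: "(s i, s (i + 1)) \<in> block_edges X N" for i using s[of i] by (auto simp: edges_over_def)
  note pp = path_point[where s = s, OF N E]
  have fwd: "map \<pi> (s (j + int k)) = block y (j + int k) N" for k
  proof (induction k)
    case (Suc k)
    then show ?case using edges_over_phase[where y = y, OF N y s Suc] by (simp add: add_ac)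
  qed (use j in simp)
  have per: "\<exists>k. map \<pi> (s i) = block y k N" for i
    using s[of i] by (auto simp: edges_over_def)
  \<comment> \<open>Phases propagate only forwards: the earlier state has some phase
    \<open>h\<close>, which is pushed ahead to \<open>j\<close>, compared there, and transferred
    back by periodicity.\<close>
  have bwd: "map \<pi> (s (j - int k)) = block y (j - int k) N" for k
  proof -
    obtain h where h: "map \<pi> (s (j - int k)) = block y h N" using per by blast
    have "map \<pi> (s (j - int k + int q)) = block y (h + int q) N" for q
    proof (induction q)
      case (Suc q)
      then show ?case using edges_over_phase[where y = y, OF N y s Suc] by (simp add: add_ac)
    qed (use h in simp)
    from this[of k] have "block y (h + int k) N = block y j N" using j by simp
    then have "y (h + int k + q) = y (j + q)" for q by (rule block_period_determines[where y = y, OF N y])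
    from this[of "int _ - int k"] have "block y h N = block y (j - int k) N"
      by (simp add: block_eq_iff algebra_simps)
    then show ?thesis using h by simp
  qed
  have all: "map \<pi> (s i) = block y i N" for i
    using fwd[of "nat (i - j)"] bwd[of "nat (j - i)"] by (cases "j \<le> i") auto
  have "\<pi> (hd (s i)) = y i" for i
  proof -
    have "s i \<noteq> []" using pp(2)[of i] N by (metis length_block less_numeral_extra(3) list.size(3))
    then have "\<pi> (hd (s i)) = hd (map \<pi> (s i))" by (simp add: hd_map)
    then show ?thesis using all[of i] hd_block[OF N] by simp
  qed
  then show ?thesis using pp(1) by (simp add: fiber_iff)
qed

text \<open>The second bridge is started only at the place \<open>n\<close> where the first has
  already merged with \<open>x'\<close>.\<close>

lemma right_trans_trans:
  assumes "(x, x') \<in> right_trans \<pi> X y" "(x', x'') \<in> right_trans \<pi> X y"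
  shows "(x, x'') \<in> right_trans \<pi> X y"
  unfolding right_trans_def
proof (safe)
  show "x \<in> fiber \<pi> X y" "x'' \<in> fiber \<pi> X y" using assms by (auto simp: right_trans_def)
  fix m
  obtain z n where z: "z \<in> fiber \<pi> X y" "n > m" "\<And>i. i \<le> m \<Longrightarrow> z i = x i" "\<And>i. i \<ge> n \<Longrightarrow> z i = x' i"
    using assms(1) unfolding right_trans_def right_bridge_def by blast
  obtain z' n' where z': "z' \<in> fiber \<pi> X y" "n' > n" "\<And>i. i \<le> n \<Longrightarrow> z' i = x' i" "\<And>i. i \<ge> n' \<Longrightarrow> z' i = x'' i"
    using assms(2) unfolding right_trans_def right_bridge_def by blast
  have "(\<lambda>i. if i \<le> n then z i else z' i) \<in> fiber \<pi> X y"
    using z z' splice_mem[of z z' n] by (auto simp: fiber_iff)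
  moreover have "(if i \<le> n then z i else z' i) = x i" if "i \<le> m" for i using that z by simp
  moreover have "(if i \<le> n then z i else z' i) = x'' i" if "i \<ge> n'" for i using that z' by simp
  moreover have "n' > m" using z z' by simp
  ultimately show "\<exists>z. right_bridge \<pi> X y m x x'' z"
    unfolding right_bridge_def by blast
qed

lemma right_trans_refl: "x \<in> fiber \<pi> X y \<Longrightarrow> (x, x) \<in> right_trans \<pi> X y"
  unfolding right_trans_def right_bridge_def by (auto intro!: exI[of _ x] exI[of _ "m + 1" for m])

lemma one_way_transition_of_classes:
  assumes C: "C \<in> right_classes \<pi> X y" "C' \<in> right_classes \<pi> X y" "C \<noteq> C'" "class_trans \<pi> X y C C'"
  shows "\<exists>x x'. (x, x') \<in> right_trans \<pi> X y \<and> (x', x) \<notin> right_trans \<pi> X y"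
proof -
  define r where "r = right_equiv \<pi> X y"
  obtain x where x: "x \<in> fiber \<pi> X y" "C = r `` {x}" using C(1) by (auto simp: right_classes_def r_def elim: quotientE)
  obtain x' where x': "x' \<in> fiber \<pi> X y" "C' = r `` {x'}" using C(2) by (auto simp: right_classes_def r_def elim: quotientE)
  have "x \<in> C" "x' \<in> C'" using x x' right_trans_refl by (auto simp: r_def right_equiv_def)
  then have t: "(x, x') \<in> right_trans \<pi> X y" using C(4) by (auto simp: class_trans_def)
  moreover have "(x', x) \<notin> right_trans \<pi> X y"
  proof
    assume "(x', x) \<in> right_trans \<pi> X y"
    then have "r `` {x} = r `` {x'}"
      using t right_trans_trans by (auto simp: r_def right_equiv_def)
    then show False using C(3) x x' by simp
  qed
  ultimately show ?thesis by blast
qed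

text \<open>States that \<open>x\<close> and \<open>x'\<close> show simultaneously and infinitely
  often lie on cycles, and a bridge joins them. A return path from \<open>b\<close> to
  \<open>a\<close> would give bridges from \<open>x'\<close> to \<open>x\<close> arbitrarily far to
  the right, once its length is fitted to the times at which \<open>b\<close> and \<open>a\<close>
  occur.\<close>

lemma recurrent_states_of_transition:
  assumes N: "0 < N" and y: "\<And>i. y (i + int N) = y i"
    and t: "(x, x') \<in> right_trans \<pi> X y" "(x', x) \<notin> right_trans \<pi> X y"
  defines "F \<equiv> edges_over \<pi> X N y"
  shows "\<exists>a\<in>block_states X N. \<exists>b\<in>block_states X N.
    (a, a) \<in> F\<^sup>+ \<and> (b, b) \<in> F\<^sup>+ \<and> (a, b) \<in> F\<^sup>* \<and> (b, a) \<notin> F\<^sup>*"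
proof -
  have fib: "x \<in> fiber \<pi> X y" "x' \<in> fiber \<pi> X y" using t by (auto simp: right_trans_def)
  then have X: "x \<in> X" "x' \<in> X" by (auto simp: fiber_iff)
  define f where "f i = (block x (int i) N, block x' (int i) N)" for i :: nat
  have "finite (range f)"
  proof (rule finite_subset)
    show "range f \<subseteq> block_states X N \<times> block_states X N" using X by (auto simp: f_def block_statesI)
  qed (use finite_block_states in auto)
  then obtain i1 where i1: "infinite {i\<in>UNIV. f i = f i1}"
    using pigeonhole_infinite[of UNIV f] by auto
  define a where "a = block x (int i1) N"
  define b where "b = block x' (int i1) N"
  define V where "V = {i. f i = (a, b)}"
  have V: "infinite V" using i1 by (simp add: V_def a_def b_def f_def)
  have Vx: "block x (int i) N = a" "block x' (int i) N = b" if "i \<in> V" for i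
    using that by (auto simp: V_def f_def)
  have large: "\<exists>i\<in>W. n \<le> i" if "infinite W" for W :: "nat set" and n
    using that by (meson infinite_nat_iff_unbounded_le)
  obtain i0 where i0: "i0 \<in> V" using V by (meson large)
  \<comment> \<open>The bridge starts late enough for the whole block at \<open>i0\<close> to be
    still that of \<open>x\<close>.\<close>
  obtain z n where z: "z \<in> fiber \<pi> X y" "\<And>i. i \<le> int i0 + int N \<Longrightarrow> z i = x i" "\<And>i. i \<ge> n \<Longrightarrow> z i = x' i"
    using t(1) unfolding right_trans_def right_bridge_def by blast
  obtain j0 where j0: "j0 \<in> V" "max (nat n) (Suc i0) \<le> j0" using large[OF V] by blast
  define d where "d = j0 - i0"
  have d: "d > 0" "int i0 + int d = int j0" using j0 by (auto simp: d_def)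
  have "block z (int i0) N = a"
    using z(2) Vx(1)[OF i0] by (auto simp: block_eq_iff)
  moreover have "block z (int j0) N = b"
    using z(3) Vx(2)[OF j0(1)] j0 by (auto simp: block_eq_iff)
  ultimately have ab: "(a, b) \<in> F ^^ d"
    using edges_over_fiber_relpow[OF z(1), of "int i0" N d] d by (simp add: F_def)
  have aa: "(a, a) \<in> F ^^ d"
    using edges_over_fiber_relpow[OF fib(1), of "int i0" N d] d Vx(1)[OF i0] Vx(1)[OF j0(1)] by (simp add: F_def)
  have bb: "(b, b) \<in> F ^^ d"
    using edges_over_fiber_relpow[OF fib(2), of "int i0" N d] d Vx(2)[OF i0] Vx(2)[OF j0(1)] by (simp add: F_def)
  have "(b, a) \<notin> F\<^sup>*"
  proof
    assume "(b, a) \<in> F\<^sup>*"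
    then obtain l where l: "(b, a) \<in> F ^^ l" using rtrancl_imp_relpow by blast
    \<comment> \<open>Going round from \<open>a\<close> to \<open>b\<close> and back adds
      \<open>d + l\<close> to the length. After \<open>d - 1\<close> rounds the length is a multiple
      of \<open>d\<close>, and cycles of length \<open>d\<close> at \<open>a\<close> then give all
      larger multiples.\<close>
    have *: "(b, a) \<in> F ^^ (l + k * (d + l))" for k
    proof (induction k)
      case (Suc k)
      have "(b, a) \<in> F ^^ (l + k * (d + l)) O F ^^ d O F ^^ l" using Suc ab l by blast
      then show ?case by (simp add: relpow_add[symmetric] algebra_simps)
    qed (use l in simp)
    have "l + (d - 1) * (d + l) = d * (l + d - 1)" using d(1)
      by (cases d) (auto simp: algebra_simps)
    then have q0: "(b, a) \<in> F ^^ (d * (l + d - 1))" using *[of "d - 1"] by simp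
    have "(b, a) \<in> F ^^ (d * (l + d - 1 + k))" for k
    proof (induction k)
      case (Suc k)
      then have "(b, a) \<in> F ^^ (d * (l + d - 1 + k)) O F ^^ d" using aa by blast
      then show ?case by (simp add: relpow_add[symmetric] algebra_simps)
    qed (use q0 in simp)
    then have ba: "(b, a) \<in> F ^^ (d * q)" if "q \<ge> l + d - 1" for q
      using that by (metis le_add_diff_inverse)
    \<comment> \<open>Restricting to recurrence times in one residue class makes every gap between
      them a multiple of \<open>d\<close>, hence, if large, the length of a path from
      \<open>b\<close> to \<open>a\<close>.\<close>
    have "finite ((\<lambda>i. i mod d) ` V)" by (rule finite_subset[of _ "{..<d}"]) (use d in auto)
    then obtain i2 where "infinite {i\<in>V. i mod d = i2 mod d}"
      using pigeonhole_infinite[OF V] by blast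
    then have large': "\<exists>i\<in>V. i mod d = i2 mod d \<and> n \<le> i" for n
      using large[of "{i\<in>V. i mod d = i2 mod d}" n] by auto
    have "\<exists>z. right_bridge \<pi> X y m x' x z" for m
    proof -
      obtain j where j: "j \<in> V" "j mod d = i2 mod d" "nat m \<le> j" using large' by blast
      obtain i where i: "i \<in> V" "i mod d = i2 mod d" "j + d * (l + d - 1) \<le> i" using large' by blast
      have "d dvd i - j" using i j by (metis mod_eq_dvd_iff_nat le_add1 le_trans)
      then obtain q where q: "i - j = d * q" by (elim dvdE)
      have "d * (l + d - 1) \<le> d * q" using i q by linarith
      then have "l + d - 1 \<le> q" using d by simp
      then have "(b, a) \<in> F ^^ (i - j)" using ba q by simp
      then obtain g where g: "g 0 = b" "g (i - j) = a" "\<And>k. k < i - j \<Longrightarrow> (g k, g (Suc k)) \<in> F"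
        unfolding relpow_fun_conv by blast
      have ij: "j \<le> i" using i by simp
      define s where "s k = (if k < int j then block x' k N else if k \<le> int i then g (nat (k - int j)) else block x k N)" for k
      have s1: "s k = block x' k N" if "k \<le> int j" for k
        using that g(1) Vx(2)[OF j(1)] ij by (cases "k = int j") (auto simp: s_def)
      have s2: "s k = block x k N" if "k \<ge> int i" for k
        using that g Vx[OF i(1)] ij Vx[OF j(1)]
        by (cases "k = int i") (auto simp: s_def nat_diff_distrib)
      have "(s k, s (k + 1)) \<in> edges_over \<pi> X N y" for k
      proof -
        consider "k < int j" | "int j \<le> k" "k < int i" | "int i \<le> k" by linarith
        then show ?thesis
        proof cases
          case 1 then show ?thesis using s1[of k] s1[of "k + 1"] edges_over_fiber[OF fib(2)] by simp
        next
          case 2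
          then have "nat (k + 1 - int j) = Suc (nat (k - int j))" "nat (k - int j) < i - j" by auto
          then show ?thesis using g(3) 2 by (simp add: s_def F_def)
        next
          case 3 then show ?thesis using s2[of k] s2[of "k + 1"] edges_over_fiber[OF fib(1)] by simp
        qed
      qed
      moreover have "map \<pi> (s (int j)) = block y (int j) N" using s1 map_block_fiber[OF fib(2)] by simp
      ultimately have "(\<lambda>k. hd (s k)) \<in> fiber \<pi> X y" by (rule fiber_path_point[where y = y and s = s, OF N y])
      moreover have "hd (s k) = x' k" if "k \<le> m" for k
        using s1[of k] that j hd_block[OF N] by simp
      moreover have "hd (s k) = x k" if "k \<ge> int i + 1" for k
        using s2[of k] that hd_block[OF N] by simp
      moreover have "int i + 1 > m" using j ij by linarith
      ultimately show ?thesis unfolding right_bridge_def by blast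
    qed
    then show False using t fib by (auto simp: right_trans_def)
  qed
  moreover have "a \<in> block_states X N" "b \<in> block_states X N" using X by (auto simp: a_def b_def block_statesI)
  moreover have "(a, a) \<in> F\<^sup>+" "(b, b) \<in> F\<^sup>+" using aa bb d(1) by (auto simp: trancl_power)
  moreover have "(a, b) \<in> F\<^sup>*" using ab by (rule relpow_imp_rtrancl)
  ultimately show ?thesis by blast
qed

end

section \<open>Failure of the Gibbs property\<close>

text \<open>For \<open>\<theta> \<le> 1\<close> the right side of \<open>lower\<close> stays bounded
  while the left side grows; for \<open>\<theta> > 1\<close> the exponential in \<open>upper\<close>
  outgrows every polynomial.\<close>

lemma exponential_polynomial_contradiction:
  fixes \<theta> c b B K :: real
  assumes pos: "0 < \<theta>" "0 < c" "0 < b"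
    and lower: "\<And>k::nat. 1 \<le> k \<Longrightarrow> c * real k \<le> B * \<theta> ^ k"
    and upper: "\<And>k::nat. 1 \<le> k \<Longrightarrow> b * \<theta> ^ k \<le> K * (1 + real (k * N))\<^sup>2"
  shows False
proof (cases "\<theta> \<le> 1")
  case True
  have "0 < B * \<theta>" using lower[of 1] pos by simp
  then have B: "0 \<le> B" using pos by (simp add: zero_less_mult_iff)
  obtain k :: nat where k: "B / c < real k" using reals_Archimedean2 by blast
  have "c * real (Suc k) \<le> B * \<theta> ^ Suc k" by (rule lower) simp
  also have "\<dots> \<le> B * 1" using B True pos by (intro mult_left_mono power_le_one) auto
  finally have "real (Suc k) \<le> B / c" using pos by (simp add: field_simps)
  then show False using k by simp
next
  case False
  \<comment> \<open>The square root makes the square of \<open>k\<close> over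
    \<open>\<theta>^k\<close> the square of \<open>k * x^k\<close>, which tends to 0.\<close>
  define x where "x = 1 / sqrt \<theta>"
  have x: "norm x < 1" "0 < x" "x\<^sup>2 = 1 / \<theta>" using False by (auto simp: x_def power_divide)
  have "(\<lambda>k. \<bar>K\<bar> * (1 + real N)\<^sup>2 * (real k * x ^ k)\<^sup>2) \<longlonglongrightarrow> \<bar>K\<bar> * (1 + real N)\<^sup>2 * 0\<^sup>2"
    by (intro tendsto_intros powser_times_n_limit_0 x)
  moreover have "b \<le> \<bar>K\<bar> * (1 + real N)\<^sup>2 * (real k * x ^ k)\<^sup>2" if k: "1 \<le> k" for k
  proof -
    have "b * \<theta> ^ k \<le> K * (1 + real (k * N))\<^sup>2" by (rule upper[OF k])
    also have "\<dots> \<le> \<bar>K\<bar> * ((1 + real N) * real k)\<^sup>2"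
      using k by (intro mult_mono power_mono) (auto simp: algebra_simps)
    finally have "b \<le> \<bar>K\<bar> * ((1 + real N) * real k)\<^sup>2 / \<theta> ^ k" using pos by (simp add: field_simps)
    also have "\<dots> = \<bar>K\<bar> * (1 + real N)\<^sup>2 * (real k * x ^ k)\<^sup>2"
      using x(3) by (simp add: power_mult_distrib power_divide flip: power_mult) 
        (simp add: mult.commute[of k] power_mult power_divide)
    finally show ?thesis .
  qed
  ultimately have "b \<le> \<bar>K\<bar> * (1 + real N)\<^sup>2 * 0\<^sup>2" by (intro LIMSEQ_le_const) auto
  then show False using pos by simp
qed

lemma funpow_shift_map: "(shift_map ^^ n) x = (\<lambda>i. x (i + int n))"
  by (induction n) (auto simp: shift_map_def add_ac)

lemma periodic_sum_shift:
  fixes h :: "nat \<Rightarrow> real"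
  assumes "\<And>j. h (j + N) = h j"
  shows "(\<Sum>j<k * N. h (j + i)) = real k * (\<Sum>j<N. h j)"
proof -
  have per: "h (j + k * N) = h j" for j k
  proof (induction k)
    case (Suc k)
    then show ?case using assms[of "j + k * N"] by (simp add: add_ac)
  qed simp
  show ?thesis
proof (induction i)
  case 0
  have "(\<Sum>j<k * N. h j) = (\<Sum>q<k. \<Sum>j\<in>{q * N..<q * N + N}. h j)"
    by (rule sum.nat_group[symmetric])
  also have "\<dots> = (\<Sum>q<k. \<Sum>j<N. h j)"
  proof (rule sum.cong[OF refl])
    fix q
    have "(\<Sum>j\<in>{q * N..<q * N + N}. h j) = (\<Sum>j\<in>{0..<N}. h (j + q * N))"
      using sum.shift_bounds_nat_ivl[of h 0 "q * N" N] by (simp add: add.commute)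
    then show "(\<Sum>j\<in>{q * N..<q * N + N}. h j) = (\<Sum>j<N. h j)"
      using per by (simp add: lessThan_atLeast0)
  qed
  finally show ?case by simp
next
  case (Suc i)
  have "(\<Sum>j<k * N. h (j + Suc i)) + h i = (\<Sum>j<Suc (k * N). h (j + i))"
    by (subst sum.lessThan_Suc_shift) simp
  also have "\<dots> = (\<Sum>j<k * N. h (j + i)) + h i" using per[of i k] by (simp add: add.commute)
  finally show ?case using Suc by simp
qed
qed

text \<open>\<open>m\<close> edges between \<open>N\<close>-blocks cover \<open>m + N\<close>
  symbols, and a phase only matters modulo \<open>N\<close>. So staying on edges over
  \<open>y\<close> means that the image shows one of finitely many words of the orbit of
  \<open>y\<close>.\<close>

lemma (in one_step_sft) paths_over_periodic_point:
  assumes N: "0 < N" and y: "\<And>i. y (i + int N) = y i" and m: "0 < m" and x: "x \<in> X"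
  shows "(\<forall>j\<in>{0..<int m}. (block x j N, block x (j + 1) N) \<in> edges_over \<pi> X N y) \<longleftrightarrow>
    block (one_block \<pi> x) 0 (m + N) \<in> (\<lambda>i. block y (int i) (m + N)) ` {..<N}" (is "?L \<longleftrightarrow> ?R")
proof
  assume L: ?L
  have "(block x 0 N, block x (0 + 1) N) \<in> edges_over \<pi> X N y" using m by (intro bspec[OF L]) auto
  then obtain h where h: "map \<pi> (block x 0 N) = block y h N" by (auto simp: edges_over_def)
  have ph: "map \<pi> (block x (int j) N) = block y (h + int j) N" if "j \<le> m" for j
    using that
  proof (induction j)
    case (Suc j)
    have "(block x (int j) N, block x (int j + 1) N) \<in> edges_over \<pi> X N y"
      using Suc by (intro bspec[OF L]) auto
    from edges_over_phase[where y = y, OF N y this Suc.IH] show ?case using Suc by (simp add: add_ac)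
  qed (use h in simp)
  have eq: "\<pi> (x (int t)) = y (h + int t)" if "t < m + N" for t
  proof -
    define j where "j = min t m"
    define k where "k = t - j"
    have jk: "j \<le> m" "k < N" "t = j + k" using that N by (auto simp: j_def k_def)
    have "map \<pi> (block x (int j) N) ! k = block y (h + int j) N ! k" using ph[OF jk(1)] by simp
    then show ?thesis using jk by (simp add: add_ac)
  qed
  define i where "i = nat (h mod int N)"
  have i: "i < N" "int i = h mod int N" using N by (auto simp: i_def nat_less_iff)
  have "y (int i + int t) = y (h + int t)" for t
    using periodic_mod[where y = y, OF N y, of "int t" h] i by (simp add: add.commute)
  then have "block (one_block \<pi> x) 0 (m + N) = block y (int i) (m + N)"
    using eq by (simp add: block_eq_iff one_block_def)
  then show ?R using i by blast
next
  assume ?R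
  then obtain i where "block (one_block \<pi> x) 0 (m + N) = block y (int i) (m + N)" by blast
  then have eq: "\<pi> (x (int t)) = y (int i + int t)" if "t < m + N" for t
    using that by (simp add: block_eq_iff one_block_def)
  have bl: "map \<pi> (block x (int j) N) = block y (int i + int j) N" if "j \<le> m" for j
    using that eq[of "j + _"] by (auto simp: map_block block_eq_iff add_ac)
  show ?L
  proof
    fix j assume j: "j \<in> {0..<int m}"
    then have "map \<pi> (block x j N) = block y (int i + j) N" "map \<pi> (block x (j + 1) N) = block y (int i + j + 1) N"
      using bl[of "nat j"] bl[of "nat j + 1"] by (auto simp: add_ac)
    then show "(block x j N, block x (j + 1) N) \<in> edges_over \<pi> X N y"
      using block_edgesI[OF x, of j N] unfolding edges_over_def by blast
  qed
qed

theorem proposition3p11: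
  fixes A :: "'a set" and X Y :: "(int \<Rightarrow> 'a) set" and \<pi> :: "'a \<Rightarrow> 'a"
  assumes "finite A"
    and "sft A X" and "one_step X" and "mixing X"
    and "sofic A Y"
    and "factor_map A X A Y (one_block \<pi>)"
    and "\<exists>y\<in>Y. periodic_point y \<and>
           (\<exists>C\<in>right_classes \<pi> X y. \<exists>C'\<in>right_classes \<pi> X y. C \<noteq> C' \<and> class_trans \<pi> X y C C')"
  shows "\<exists>\<mu>. markov_measure A X \<mu> \<and> fully_supported X \<mu> \<and>
           \<not> gibbs_measure A Y (distr \<mu> (shift_borel A Y) (one_block \<pi>))"
proof -
  obtain y C C' where yY: "y \<in> Y" and per: "periodic_point y"
    and C: "C \<in> right_classes \<pi> X y" "C' \<in> right_classes \<pi> X y" "C \<noteq> C'" "class_trans \<pi> X y C C'"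
    using assms(7) by blast
  have onto: "one_block \<pi> ` X = Y"
    and cont: "continuous_map (shift_topology A X) (shift_topology A Y) (one_block \<pi>)"
    using assms(6) by (auto simp: factor_map_def)
  have "X \<noteq> {}" using onto yY by auto
  then interpret one_step_sft A X using assms by unfold_locales
  obtain N where N: "0 < N" and "(shift_map ^^ N) y = y" using per by (auto simp: periodic_point_def)
  then have y: "y (i + int N) = y i" for i unfolding funpow_shift_map by metis
  define F where "F = edges_over \<pi> X N y"
  have FE: "F \<subseteq> block_edges X N" by (auto simp: F_def edges_over_def)
  obtain x x' where "(x, x') \<in> right_trans \<pi> X y" "(x', x) \<notin> right_trans \<pi> X y"
    using one_way_transition_of_classes[OF C] by blast
  then obtain a b where ab: "a \<in> block_states X N" "b \<in> block_states X N"
    "(a, a) \<in> F\<^sup>+" "(b, b) \<in> F\<^sup>+" "(a, b) \<in> F\<^sup>*" "(b, a) \<notin> F\<^sup>*"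
    using recurrent_states_of_transition[where y = y and N = N, OF N y] unfolding F_def by blast
  obtain P p e c K where P: "stochastic_matrix (block_states X N) P" "\<forall>u v. (u, v) \<in> block_edges X N \<longrightarrow> 0 < P u v"
      "\<forall>u v. (u, v) \<notin> block_edges X N \<longrightarrow> P u v = 0"
    and p: "probability_vector (block_states X N) p" "\<forall>v\<in>block_states X N. 0 < p v"
      "\<forall>w\<in>block_states X N. (\<Sum>v\<in>block_states X N. p v * P v w) = p w"
    and e: "0 < e" "0 < c"
      "\<forall>m. c * real m * e ^ m \<le> (\<Sum>v\<in>block_states X N. p v * path_weight F P (\<lambda>_. 1) m v) \<and>
         (\<Sum>v\<in>block_states X N. p v * path_weight F P (\<lambda>_. 1) m v) \<le> K * (1 + real m)\<^sup>2 * e ^ m"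
    using chain_with_polynomial_correction[OF finite_block_states block_edges_subset FE
        mixing_irreducible[OF assms(4)] ab] by auto
  obtain \<mu> where mu: "invariant_measure A X \<mu>" and form: "\<forall>l n. \<forall>x\<in>X. measure \<mu> (window X N l n x)
     = p (block x (- int l) N) * (\<Prod>i\<in>{- int l..<int n}. P (block x i N) (block x (i + 1) N))"
    using block_measure_exists[OF N P(1) _ p(1)] P(3) p by blast
  have markov: "markov_measure A X \<mu>"
    by (rule markov_measure_window[OF N mu P(1) p(1)]) (use form in blast)
  have "0 < measure \<mu> (window X N n n x)" if "x \<in> X" for n x
    using form that P(2) p(2) by (auto intro!: mult_pos_pos prod_pos simp: block_edgesI block_statesI)
  then have supp: "fully_supported X \<mu>" by (rule fully_supported_window[OF N mu])
  define \<nu> where "\<nu> = distr \<mu> (shift_borel A Y) (one_block \<pi>)"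
  have "\<not> gibbs_measure A Y \<nu>"
  proof
    assume "gibbs_measure A Y \<nu>"
    then obtain f K1 K2 R where K: "0 < K1" "0 < K2"
      and gibbs: "\<And>z n. z \<in> Y \<Longrightarrow> 1 \<le> n \<Longrightarrow>
         K1 < measure \<nu> (cylinder Y (block z 0 n) 0) / exp (- real n * R + (\<Sum>j<n. f ((shift_map ^^ j) z))) \<and>
         measure \<nu> (cylinder Y (block z 0 n) 0) / exp (- real n * R + (\<Sum>j<n. f ((shift_map ^^ j) z))) < K2"
      unfolding gibbs_measure_def gibbs_measure_for_def Let_def by metis
    have Yclosed: "closedin (full_shift_topology A) Y" and Yshift: "shift_map ` Y = Y"
      using assms(5) by (auto simp: sofic_def shift_space_def)
    have YA: "\<forall>z\<in>Y. range z \<subseteq> A"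
      using closedin_subset[OF Yclosed] by (auto simp: full_shift_topology_def)
    have sets_mu: "sets \<mu> = sets (shift_borel A X)" using mu by (simp add: invariant_measure_def)
    have sp: "space \<mu> = X" using sets_eq_imp_space_eq[OF sets_mu] space_shift_borel[OF XA] by simp
    interpret prob_space \<mu> using mu by (simp add: invariant_measure_def)
    have meas: "one_block \<pi> \<in> measurable \<mu> (shift_borel A Y)"
      using measurable_shift_borel_continuous[OF XA cont] sets_mu by (simp cong: measurable_cong_sets)
    have cylY: "cylinder Y w 0 \<in> sets (shift_borel A Y)" for w
    proof -
      have "cylinder Y w 0 = {x\<in>Y. (\<lambda>s. s 0 = w) (\<lambda>j. if j \<in> {0..0} then block x j (length w) else [])}"
        by (auto simp: cylinder_def)
      then show ?thesis
        using openin_block_condition[OF YA, where Q = "\<lambda>s. s 0 = w" and l = 0 and n = 0 and N = "length w"]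
        by (auto intro: shift_borel_openI)
    qed
    define h where "h j = f ((shift_map ^^ j) y)" for j
    have hper: "h (j + N) = h j" for j
      unfolding h_def funpow_shift_map by (rule arg_cong[of _ _ f]) (auto simp: y add.assoc[symmetric])
    \<comment> \<open>The Gibbs weight of one full period. Over whole periods the sum of the
      potential does not depend on the starting phase, so every phase yields the same powers of
      \<open>\<rho>\<close>.\<close>
    define \<rho> where "\<rho> = exp (- real N * R + (\<Sum>j<N. h j))"
    have rho: "0 < \<rho>" by (simp add: \<rho>_def)
    have orbit: "(shift_map ^^ i) y \<in> Y" for i
      by (induction i) (use yY Yshift in auto)
    have G: "K1 * \<rho> ^ k \<le> measure \<nu> (cylinder Y (block y (int i) (k * N)) 0)"
      "measure \<nu> (cylinder Y (block y (int i) (k * N)) 0) \<le> K2 * \<rho> ^ k" if k: "1 \<le> k" for i k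
    proof -
      have "(shift_map ^^ j) ((shift_map ^^ i) y) = (shift_map ^^ (j + i)) y" for j
        by (simp add: funpow_add)
      then have "(\<Sum>j<k * N. f ((shift_map ^^ j) ((shift_map ^^ i) y))) = real k * (\<Sum>j<N. h j)"
        using periodic_sum_shift[where h = h and N = N and k = k and i = i, OF hper] by (simp add: h_def)
      then have ex: "exp (- real (k * N) * R + (\<Sum>j<k * N. f ((shift_map ^^ j) ((shift_map ^^ i) y)))) = \<rho> ^ k"
        by (simp add: \<rho>_def algebra_simps flip: exp_of_nat_mult)
      have bl: "block ((shift_map ^^ i) y) 0 (k * N) = block y (int i) (k * N)"
        by (simp add: funpow_shift_map block_shift)
      have "1 \<le> k * N" using k N by simp
      from gibbs[OF orbit[of i] this] show "K1 * \<rho> ^ k \<le> measure \<nu> (cylinder Y (block y (int i) (k * N)) 0)"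
        "measure \<nu> (cylinder Y (block y (int i) (k * N)) 0) \<le> K2 * \<rho> ^ k"
        unfolding ex bl using rho by (auto simp: field_simps)
    qed
    define T where "T m = (\<Sum>v\<in>block_states X N. p v * path_weight F P (\<lambda>_. 1) m v)" for m
    \<comment> \<open>\<open>k * N\<close> edges cover \<open>Suc k * N\<close> symbols, whence the
      extra period. The sum runs over the set of words because different phases may show the same
      word, which must be counted once.\<close>
    have Tsum: "T (k * N) = (\<Sum>u\<in>(\<lambda>i. block y (int i) (Suc k * N)) ` {..<N}. measure \<nu> (cylinder Y u 0))"
      if k: "1 \<le> k" for k
    proof -
      define D where "D = (\<lambda>i. block y (int i) (Suc k * N)) ` {..<N}"
      have len: "length u = Suc k * N" if "u \<in> D" for u using that by (auto simp: D_def)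
      have pre: "one_block \<pi> -` cylinder Y u 0 \<inter> space \<mu> = {x\<in>X. block (one_block \<pi> x) 0 (Suc k * N) = u}"
        if "u \<in> D" for u
        using onto len[OF that] by (auto simp: cylinder_def sp)
      have "(\<Sum>u\<in>D. measure \<nu> (cylinder Y u 0)) = (\<Sum>u\<in>D. measure \<mu> (one_block \<pi> -` cylinder Y u 0 \<inter> space \<mu>))"
        unfolding \<nu>_def by (intro sum.cong refl measure_distr meas cylY)
      also have "\<dots> = measure \<mu> (\<Union>u\<in>D. one_block \<pi> -` cylinder Y u 0 \<inter> space \<mu>)"
      proof (rule finite_measure_finite_Union[symmetric])
        show "disjoint_family_on (\<lambda>u. one_block \<pi> -` cylinder Y u 0 \<inter> space \<mu>) D"
          unfolding disjoint_family_on_def by (auto simp: pre)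
        show "(\<lambda>u. one_block \<pi> -` cylinder Y u 0 \<inter> space \<mu>) ` D \<subseteq> events"
          using measurable_sets[OF meas cylY] by blast
      qed (simp add: D_def)
      also have "(\<Union>u\<in>D. one_block \<pi> -` cylinder Y u 0 \<inter> space \<mu>) =
          {x\<in>X. \<forall>j\<in>{0..<int (k * N)}. (block x j N, block x (j + 1) N) \<in> F}"
      proof -
        have pos: "0 < k * N" and eq: "Suc k * N = k * N + N" using k N by auto
        have "(\<forall>j\<in>{0..<int (k * N)}. (block x j N, block x (j + 1) N) \<in> F) \<longleftrightarrow>
            block (one_block \<pi> x) 0 (Suc k * N) \<in> D" if "x \<in> X" for x
          using paths_over_periodic_point[where y = y, OF N y pos that, of \<pi>]
          unfolding F_def D_def eq .
        then show ?thesis using pre by auto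
      qed
      also have "measure \<mu> \<dots> = T (k * N)"
        unfolding T_def by (rule measure_paths_in[OF N mu FE]) (use form in blast)
      finally show ?thesis by (simp add: D_def)
    qed
    \<comment> \<open>Gibbs rate over chain rate, both per period.\<close>
    define \<theta> where "\<theta> = \<rho> / e ^ N"
    have th: "0 < \<theta>" using rho e by (simp add: \<theta>_def)
    have rk: "\<rho> ^ k = \<theta> ^ k * e ^ (k * N)" for k
      using e by (simp add: \<theta>_def power_divide power_mult mult.commute[of k])
    have lower: "c * real N * real k \<le> (real N * K2 * \<rho>) * \<theta> ^ k" if k: "1 \<le> k" for k
    proof -
      have "c * real (k * N) * e ^ (k * N) \<le> T (k * N)" using e(3) unfolding T_def by blast
      also have "\<dots> \<le> (\<Sum>u\<in>(\<lambda>i. block y (int i) (Suc k * N)) ` {..<N}. K2 * \<rho> ^ Suc k)"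
        unfolding Tsum[OF k] by (rule sum_mono) (use G(2)[of "Suc k"] in auto)
      also have "\<dots> \<le> real N * (K2 * \<rho> ^ Suc k)"
        using card_image_le[of "{..<N}" "\<lambda>i. block y (int i) (Suc k * N)"] K rho
        by (simp add: mult_right_mono)
      also have "\<dots> = real N * K2 * \<rho> * \<theta> ^ k * e ^ (k * N)" by (simp add: rk)
      finally have "c * real N * real k * e ^ (k * N) \<le> real N * K2 * \<rho> * \<theta> ^ k * e ^ (k * N)"
        by (simp add: mult_ac)
      then show ?thesis by (rule mult_right_le_imp_le) (use e(1) in simp)
    qed
    \<comment> \<open>One phase suffices for this direction; the other one bounds all of the at most
      \<open>N\<close> words.\<close>
    have upper: "(K1 * \<rho>) * \<theta> ^ k \<le> K * (1 + real (k * N))\<^sup>2" if k: "1 \<le> k" for k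
    proof -
      define D where "D = (\<lambda>i. block y (int i) (Suc k * N)) ` {..<N}"
      have mem: "block y (int 0) (Suc k * N) \<in> D"
        unfolding D_def by (rule imageI) (use N in simp)
      have "K1 * \<rho> ^ Suc k \<le> measure \<nu> (cylinder Y (block y (int 0) (Suc k * N)) 0)"
        by (rule G(1)) simp
      also have "\<dots> \<le> (\<Sum>u\<in>D. measure \<nu> (cylinder Y u 0))"
        by (rule member_le_sum[of _ D "\<lambda>u. measure \<nu> (cylinder Y u 0)"]) (use mem in \<open>simp_all add: D_def\<close>)
      also have "\<dots> = T (k * N)" using Tsum[OF k] by (simp add: D_def)
      also have "\<dots> \<le> K * (1 + real (k * N))\<^sup>2 * e ^ (k * N)" using e(3) unfolding T_def by blast
      finally have "K1 * \<rho> * \<theta> ^ k * e ^ (k * N) \<le> K * (1 + real (k * N))\<^sup>2 * e ^ (k * N)"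
        by (simp add: rk mult_ac)
      then show ?thesis by (rule mult_right_le_imp_le) (use e(1) in simp)
    qed
    have "0 < c * real N" "0 < K1 * \<rho>" using N e K rho by auto
    from exponential_polynomial_contradiction[OF th this lower upper] show False .
  qed
  then show ?thesis using markov supp unfolding \<nu>_def by blast
qed

end
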